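(* Let $D=[0,1]^d$, $q\in[0,1]$, and for $\Gamma_1(q),\Gamma_2>0$ let $$\mathcal{F}(\Gamma_1(q),\Gamma_2)=\{\mathcal{C}:\ \Gamma_1(q,\mathcal{C})\le\Gamma_1(q),\ \Gamma_2(\mathcal{C})\le\Gamma_2\}.$$ Suppose that $1\le N^\beta\le\big\lfloor\exp\big(\tfrac12\Gamma_2^2\big)\big\rfloor-1$ for some $\beta>1$, that $\Gamma_2\ge2$, and that $\Gamma_1(q)\le M\,N^{(1-q)/2}\,\Gamma_2^{-3+q}$ for a constant $M>0$. Then the minimax risk for estimating the covariance operator over $\mathcal{F}(\Gamma_1(q),\Gamma_2)$ in the operator norm, based on $N$ independent samples $u_1,\dots,u_N$ from $\mathrm{GP}(0,\mathcal{C})$, satisfies $$\inf_{\widehat{\mathcal{C}}}\ \sup_{\mathcal{C}\in\mathcal{F}(\Gamma_1(q),\Gamma_2)}\frac{\mathbb{E}\|\widehat{\mathcal{C}}-\mathcal{C}\|}{\|\mathcal{C}\|}\gtrsim\Gamma_1(q)\left(\frac{\Gamma_2}{\sqrt N}\right)^{1-q}.$$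
   Context: $\mathcal{C}$ ranges over nonzero covariance operators on $L^2(D)$, $(\mathcal{C}\psi)(\cdot)=\int_Dk(\cdot,y)\psi(y)\,dy$, where $k(x,y)=\mathbb{E}[u(x)u(y)]$ is the covariance function of a real-valued centered Gaussian process $u\sim\mathrm{GP}(0,\mathcal{C})$ on $D$. $\|\mathcal{C}\|$ is the operator norm. Put $$\|k\|_q^q=\sup_{x\in D}\int_D|k(x,y)|^q\,dy,\qquad\|k\|_\infty=\sup_{x,y\in D}|k(x,y)|$$ (for $q=0$, with $0^0=0$, $\|k\|_0^0$ is the largest measure of $\{y:k(x,y)\neq0\}$). The $L^q$-sparsity and the capacity of $\mathcal{C}$ are $$\Gamma_1(q,\mathcal{C})=\frac{\|k\|_q^q\,\|k\|_\infty^{1-q}}{\|\mathcal{C}\|},\qquad\Gamma_2(\mathcal{C})=\frac{\mathbb{E}_{u\sim\mathrm{GP}(0,\mathcal{C})}\big[\sup_{x\in D}u(x)\big]}{\sqrt{\|k\|_\infty}}.$$ Here $\Gamma_1(q)$ and $\Gamma_2$ (without $\mathcal{C}$) are given numbers. The infimum is over kernel integral operators $\widehat{\mathcal{C}}$ whose kernel is a measurable function of the data $u_1(\cdot),\dots,u_N(\cdot)$. $a\gtrsim b$ means $a\ge c\,b$ for some constant $c>0$; the constant may depend on $q$, $\beta$, $M$, but not on $N$, $\Gamma_1(q)$, $\Gamma_2$.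
   Formalization: The class F(Γ1(q),Γ2) is additionally assumed to be nonempty: every covariance operator has Γ1(q,C) ≥ 1, so for Γ1(q) < 1 the class is empty and the supremum cannot satisfy the stated positive lower bound; for Γ1(q) ≥ 1 it is always nonempty. *)

theory Defs
  imports "HOL-Probability.Probability"
begin

(* Points of [0,1]^d are coordinate families indexed by {..<d}, so that the dimension is an
   ordinary variable and constants can be uniform in it.  The space of this measure is the domain
   D = [0,1]^d and the measure is Lebesgue measure on it. *)
definition cube :: "nat \<Rightarrow> (nat \<Rightarrow> real) measure" where
  "cube d = (\<Pi>\<^sub>M i\<in>{..<d}. restrict_space lborel {0..1})"

type_synonym point = "nat \<Rightarrow> real"
type_synonym path = "point \<Rightarrow> real"
type_synonym kernel = "point \<Rightarrow> point \<Rightarrow> real"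


section \<open>Kernels and their integral operators\<close>

definition L2 :: "nat \<Rightarrow> (point \<Rightarrow> real) set" where
  "L2 d = {\<psi>. \<psi> \<in> borel_measurable (cube d) \<and> integrable (cube d) (\<lambda>x. (\<psi> x)\<^sup>2)}"

definition kernel_op :: "nat \<Rightarrow> kernel \<Rightarrow> (point \<Rightarrow> real) \<Rightarrow> point \<Rightarrow> real" where
  "kernel_op d k \<psi> x = (\<integral>y. k x y * \<psi> y \<partial>cube d)"

(* Operator norm on L2: the least B with ||T f|| <= B ||f|| for all f.  It is infinite if the
   kernel does not define a bounded operator; the integrability clause is needed because the
   Bochner integral of a non-integrable function is 0. *)
definition op_norm :: "nat \<Rightarrow> kernel \<Rightarrow> ennreal" where
  "op_norm d k = Inf {ennreal B | B. 0 \<le> B \<and>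
     (\<forall>\<psi>\<in>L2 d.
        (AE x in cube d. integrable (cube d) (\<lambda>y. k x y * \<psi> y)) \<and>
        (\<integral>\<^sup>+x. ennreal ((kernel_op d k \<psi> x)\<^sup>2) \<partial>cube d)
          \<le> ennreal (B\<^sup>2 * (\<integral>x. (\<psi> x)\<^sup>2 \<partial>cube d)))}"

(* Since 0 powr 0 = 0 in HOL, the case q = 0 measures the set where k x y is nonzero.
   This and sup_norm are only applied to bounded measurable kernels. *)
definition q_norm_q :: "nat \<Rightarrow> real \<Rightarrow> kernel \<Rightarrow> real" where
  "q_norm_q d q k = (SUP x\<in>space (cube d). \<integral>y. \<bar>k x y\<bar> powr q \<partial>cube d)"

definition sup_norm :: "nat \<Rightarrow> kernel \<Rightarrow> real" where
  "sup_norm d k = (SUP (x, y)\<in>space (cube d) \<times> space (cube d). \<bar>k x y\<bar>)"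


section \<open>Gaussian processes\<close>

(* The point mass at 0 counts as a (degenerate) normal distribution. *)
definition centered_normal :: "'a measure \<Rightarrow> ('a \<Rightarrow> real) \<Rightarrow> bool" where
  "centered_normal P X \<longleftrightarrow> X \<in> borel_measurable P \<and>
     ((AE \<omega> in P. X \<omega> = 0) \<or>
      (\<exists>\<sigma>>0. distributed P lborel X (\<lambda>x. ennreal (normal_density 0 \<sigma> x))))"

(* A centered Gaussian process, given by its law P on a set of sample paths.  The sigma-algebra
   on the paths is part of P: it has to make (u, x) \<mapsto> u x jointly measurable, which no
   sigma-algebra on the set of all paths does. *)
definition gaussian_process :: "nat \<Rightarrow> path measure \<Rightarrow> bool" where
  "gaussian_process d P \<longleftrightarrow>
     prob_space P \<and>
     space P \<subseteq> extensional (space (cube d)) \<and>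
     (\<lambda>(u, x). u x) \<in> borel_measurable (P \<Otimes>\<^sub>M cube d) \<and>
     (\<forall>I a. finite I \<longrightarrow> I \<subseteq> space (cube d) \<longrightarrow> centered_normal P (\<lambda>u. \<Sum>x\<in>I. a x * u x))"

definition cov :: "path measure \<Rightarrow> kernel" where
  "cov P x y = (\<integral>u. u x * u y \<partial>P)"

definition path_sup :: "nat \<Rightarrow> path \<Rightarrow> real" where
  "path_sup d u = (SUP x\<in>space (cube d). u x)"

(* The processes for which the sparsity and the capacity are defined: the covariance operator is
   nonzero, the covariance function is bounded, and the supremum of the process is (almost surely
   finite and) a random variable with finite expectation. *)
definition regular_process :: "nat \<Rightarrow> path measure \<Rightarrow> bool" where
  "regular_process d P \<longleftrightarrow>
     gaussian_process d P \<and>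
     op_norm d (cov P) \<noteq> 0 \<and>
     (\<exists>B. \<forall>x\<in>space (cube d). \<forall>y\<in>space (cube d). \<bar>cov P x y\<bar> \<le> B) \<and>
     (AE u in P. bdd_above (u ` space (cube d))) \<and>
     integrable P (path_sup d)"

definition sparsity :: "nat \<Rightarrow> real \<Rightarrow> path measure \<Rightarrow> real" where
  "sparsity d q P =
     q_norm_q d q (cov P) * sup_norm d (cov P) powr (1 - q) / enn2real (op_norm d (cov P))"

definition capacity :: "nat \<Rightarrow> path measure \<Rightarrow> real" where
  "capacity d P = (\<integral>u. path_sup d u \<partial>P) / sqrt (sup_norm d (cov P))"

(* A covariance operator is represented by the law of a process that has it: as an operator on L2
   it determines k only up to null sets, whereas sup_norm and the capacity use k pointwise. *)
definition cov_class :: "nat \<Rightarrow> real \<Rightarrow> real \<Rightarrow> real \<Rightarrow> path measure set" where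
  "cov_class d q \<Gamma>1 \<Gamma>2 =
     {P. regular_process d P \<and> sparsity d q P \<le> \<Gamma>1 \<and> capacity d P \<le> \<Gamma>2}"


section \<open>Minimax risk\<close>

definition samples :: "nat \<Rightarrow> path measure \<Rightarrow> (nat \<Rightarrow> path) measure" where
  "samples N P = (\<Pi>\<^sub>M n\<in>{..<N}. P)"

(* An estimator maps the data to a kernel.  Measurability is only asked for under the laws in the
   class, so statistics such as the supremum of a sample path may be used. *)
definition estimators ::
  "nat \<Rightarrow> nat \<Rightarrow> path measure set \<Rightarrow> ((nat \<Rightarrow> path) \<Rightarrow> kernel) set" where
  "estimators d N F = {K. \<forall>P\<in>F.
     (\<lambda>(U, x, y). K U x y) \<in> borel_measurable (samples N P \<Otimes>\<^sub>M cube d \<Otimes>\<^sub>M cube d)}"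

definition relative_risk ::
  "nat \<Rightarrow> nat \<Rightarrow> ((nat \<Rightarrow> path) \<Rightarrow> kernel) \<Rightarrow> path measure \<Rightarrow> ennreal" where
  "relative_risk d N K P =
     (\<integral>\<^sup>+U. op_norm d (\<lambda>x y. K U x y - cov P x y) \<partial>samples N P) / op_norm d (cov P)"

definition minimax_risk :: "nat \<Rightarrow> nat \<Rightarrow> path measure set \<Rightarrow> ennreal" where
  "minimax_risk d N F = (INF K\<in>estimators d N F. SUP P\<in>F. relative_risk d N K P)"

end

theory Submission
  imports Defs
begin

text \<open>A class member contributes the risk of any process in the class, so it suffices to find a hard finite family of
  Gaussian step processes. Cut the cube into slabs: m "row" cells, m "column" cells and one wide independent cell.
  The cells have unit variance and row i, if it is switched on, has correlation eps with k column cells chosen at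
  random, subject to every column being used at most 2k times; here eps is a multiple of Gamma2 / sqrt N and k of
  Gamma1 eps^(-q). Applied to the indicator of the columns, the operator of a process reveals which rows are on, so
  the operator norm loss is at least the average over the rows of the error in deciding a single row. Fix all other
  rows. The chi-square distance of the mixture over the k columns of row i from the law with row i off is an average
  of (1 - c' Q c)^(-N) over independent pairs c, c' of cross-covariance vectors, with Q the inverse covariance of the other cells.
  Since Q has bounded row sums on the columns and m / k is large, this average is close to 1, and Le Cam's inequality
  gives a loss of order k eps relative to the norm.\<close>

section \<open>Gaussian measures with a given precision matrix\<close>

text \<open>The signal is as strong as the capacity permits: \<open>4 N \<epsilon>^2\<close> is a
  small multiple of \<Gamma>2^2, so a chi-square factor is exponential in \<Gamma>2^2 and only the
  number of cells can beat it. Capacity \<Gamma>2 admits about exp (\<Gamma>2^2 / 2) cells of unit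
  variance, as the expected maximum of n standard normals is at most sqrt (2 ln n). Two rows share
  about k / L columns, where m = k L, and k^2 \<le> N \<le> exp (\<Gamma>2^2 / (2 \<beta>)) puts k /
  L below a multiple of exp (- (1 - 1 / \<beta>) \<Gamma>2^2 / 2): the room comes from \<beta> > 1.
  The cap on the column degrees has two purposes. A column cell is also a row of the symmetric
  kernel, so its degree enters the sparsity; and Q is controlled on the columns whatever the other
  rows are. The cap makes the rows dependent, but given the others a row remains uniform on a
  product of sets that are at least half of the full blocks, which suffices for the second moment.
  Precision matrices carry the Gaussian part because each correlated row changes them by two
  rank-one terms, so masses, inverses and likelihood ratios follow without determinants.\<close>

definition dot :: "nat set \<Rightarrow> (nat \<Rightarrow> real) \<Rightarrow> (nat \<Rightarrow> real) \<Rightarrow> real" where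
  "dot I a b = (\<Sum>i\<in>I. a i * b i)"

definition mv :: "nat set \<Rightarrow> (nat \<Rightarrow> nat \<Rightarrow> real) \<Rightarrow> (nat \<Rightarrow> real) \<Rightarrow> nat \<Rightarrow> real" where
  "mv I S a i = (\<Sum>j\<in>I. S i j * a j)"

definition bform :: "nat set \<Rightarrow> (nat \<Rightarrow> nat \<Rightarrow> real) \<Rightarrow> (nat \<Rightarrow> real) \<Rightarrow> (nat \<Rightarrow> real) \<Rightarrow> real" where
  "bform I S a b = dot I a (mv I S b)"

definition sym_on :: "nat set \<Rightarrow> (nat \<Rightarrow> nat \<Rightarrow> real) \<Rightarrow> bool" where
  "sym_on I S \<longleftrightarrow> (\<forall>i\<in>I. \<forall>j\<in>I. S i j = S j i)"

text \<open>One product suffices: for symmetric matrices the other one is its transpose.\<close>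

definition inv_on :: "nat set \<Rightarrow> (nat \<Rightarrow> nat \<Rightarrow> real) \<Rightarrow> (nat \<Rightarrow> nat \<Rightarrow> real) \<Rightarrow> bool" where
  "inv_on I Q S \<longleftrightarrow> finite I \<and> sym_on I Q \<and> sym_on I S \<and>
     (\<forall>i\<in>I. \<forall>j\<in>I. (\<Sum>l\<in>I. Q i l * S l j) = of_bool (i = j))"

lemma dot_commute: "dot I a b = dot I b a"
  by (simp add: dot_def mult.commute)

lemma dot_add_right: "dot I a (\<lambda>i. b i + c i) = dot I a b + dot I a c"
  by (simp add: dot_def sum.distrib algebra_simps)

lemma dot_scale_right: "dot I a (\<lambda>i. t * b i) = t * dot I a b"
  by (simp add: dot_def sum_distrib_left algebra_simps)

lemma mv_add: "mv I S (\<lambda>i. a i + b i) = (\<lambda>i. mv I S a i + mv I S b i)"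
  by (simp add: mv_def fun_eq_iff sum.distrib algebra_simps)

lemma mv_scale: "mv I S (\<lambda>i. t * a i) = (\<lambda>i. t * mv I S a i)"
  by (simp add: mv_def fun_eq_iff sum_distrib_left algebra_simps)

lemma mv_cong: "(\<And>i. i \<in> I \<Longrightarrow> a i = b i) \<Longrightarrow> mv I S a = mv I S b"
  by (auto simp: mv_def intro!: ext sum.cong)

lemma dot_cong: "(\<And>i. i \<in> I \<Longrightarrow> a i = a' i) \<Longrightarrow> (\<And>i. i \<in> I \<Longrightarrow> b i = b' i) \<Longrightarrow> dot I a b = dot I a' b'"
  by (auto simp: dot_def intro!: sum.cong)

lemma bform_cong:
  assumes "\<And>i. i \<in> I \<Longrightarrow> a i = a' i" "\<And>i. i \<in> I \<Longrightarrow> b i = b' i"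
  shows "bform I S a b = bform I S a' b'"
  unfolding bform_def using mv_cong[of I b b' S] assms by (auto intro!: dot_cong)

lemma bform_add_right: "bform I S a (\<lambda>i. b i + c i) = bform I S a b + bform I S a c"
  by (simp add: bform_def mv_add dot_add_right)

lemma bform_commute:
  assumes "sym_on I S"
  shows "bform I S a b = bform I S b a"
proof -
  have "bform I S a b = (\<Sum>i\<in>I. \<Sum>j\<in>I. a i * S i j * b j)"
    by (simp add: bform_def dot_def mv_def sum_distrib_left algebra_simps)
  also have "\<dots> = (\<Sum>j\<in>I. \<Sum>i\<in>I. a i * S i j * b j)"
    by (rule sum.swap)
  also have "\<dots> = (\<Sum>j\<in>I. \<Sum>i\<in>I. b j * S j i * a i)"
    using assms by (intro sum.cong refl) (auto simp: sym_on_def algebra_simps)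
  also have "\<dots> = bform I S b a"
    by (simp add: bform_def dot_def mv_def sum_distrib_left algebra_simps)
  finally show ?thesis .
qed

lemma bform_add_left:
  assumes "sym_on I S"
  shows "bform I S (\<lambda>i. b i + c i) a = bform I S b a + bform I S c a"
  using assms by (metis bform_add_right bform_commute)

lemma mv_mv_inv:
  assumes "inv_on I Q S" "i \<in> I"
  shows "mv I Q (mv I S a) i = a i"
proof -
  have fin: "finite I" using assms by (simp add: inv_on_def)
  have "mv I Q (mv I S a) i = (\<Sum>l\<in>I. \<Sum>j\<in>I. Q i l * S l j * a j)"
    by (simp add: mv_def sum_distrib_left algebra_simps)
  also have "\<dots> = (\<Sum>j\<in>I. (\<Sum>l\<in>I. Q i l * S l j) * a j)"
    by (subst sum.swap) (simp add: sum_distrib_right)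
  also have "\<dots> = (\<Sum>j\<in>I. if i = j then a j else 0)"
    using assms by (intro sum.cong refl) (auto simp: inv_on_def)
  also have "\<dots> = a i" using fin assms(2) by simp
  finally show ?thesis .
qed

lemma inv_on_commute:
  assumes "inv_on I Q S"
  shows "inv_on I S Q"
proof -
  have fin: "finite I" and sQ: "sym_on I Q" and sS: "sym_on I S"
    using assms by (auto simp: inv_on_def)
  have "(\<Sum>l\<in>I. S i l * Q l j) = of_bool (i = j)" if "i \<in> I" "j \<in> I" for i j
  proof -
    have "(\<Sum>l\<in>I. S i l * Q l j) = (\<Sum>l\<in>I. Q j l * S l i)"
      using sQ sS that by (intro sum.cong refl) (auto simp: sym_on_def)
    also have "\<dots> = of_bool (j = i)" using assms that by (simp add: inv_on_def)
    finally show ?thesis by auto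
  qed
  then show ?thesis using fin sQ sS by (auto simp: inv_on_def)
qed

lemma inv_on_unique:
  assumes "inv_on I Q S" "inv_on I Q' S" "i \<in> I" "j \<in> I"
  shows "Q i j = Q' i j"
proof -
  define e where "e = (\<lambda>l. of_bool (l = j) :: real)"
  have col: "mv I R e l = R l j" for R l
    using assms by (simp add: mv_def e_def inv_on_def)
  have "mv I Q (mv I S (mv I Q' e)) i = mv I Q' e i"
    using assms by (intro mv_mv_inv) auto
  moreover have "mv I Q (mv I S (mv I Q' e)) = mv I Q e"
    by (rule mv_cong, rule mv_mv_inv[OF inv_on_commute[OF assms(2)]])
  ultimately show ?thesis by (simp add: col)
qed

section \<open>Normalised Gaussian densities and their linear functionals\<close>

definition gweight :: "nat set \<Rightarrow> (nat \<Rightarrow> nat \<Rightarrow> real) \<Rightarrow> (nat \<Rightarrow> real) \<Rightarrow> ennreal" where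
  "gweight I Q z = ennreal (exp (- bform I Q z z / 2))"

definition gmass :: "nat set \<Rightarrow> (nat \<Rightarrow> nat \<Rightarrow> real) \<Rightarrow> ennreal" where
  "gmass I Q = (\<integral>\<^sup>+z. gweight I Q z \<partial>(\<Pi>\<^sub>M i\<in>I. lborel))"

definition gauss :: "nat set \<Rightarrow> (nat \<Rightarrow> nat \<Rightarrow> real) \<Rightarrow> (nat \<Rightarrow> real) measure" where
  "gauss I Q = density (\<Pi>\<^sub>M i\<in>I. lborel) (\<lambda>z. gweight I Q z / gmass I Q)"

text \<open>A finite, nonzero mass encodes the positive definiteness of Q. The value of
  \<open>gmass\<close> is tracked from the identity matrix through its ratios under rank-one
  changes.\<close>

definition gpair :: "nat set \<Rightarrow> (nat \<Rightarrow> nat \<Rightarrow> real) \<Rightarrow> (nat \<Rightarrow> nat \<Rightarrow> real) \<Rightarrow> bool" where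
  "gpair I Q S \<longleftrightarrow> inv_on I Q S \<and> 0 < gmass I Q \<and> gmass I Q < \<infinity>"

lemma dot_measurable [measurable]: "dot I a \<in> borel_measurable (\<Pi>\<^sub>M i\<in>I. lborel)"
  unfolding dot_def[abs_def] by measurable

lemma bform_measurable [measurable]: "(\<lambda>z. bform I Q z z) \<in> borel_measurable (\<Pi>\<^sub>M i\<in>I. lborel)"
  unfolding bform_def dot_def mv_def by measurable

lemma gweight_measurable [measurable]: "gweight I Q \<in> borel_measurable (\<Pi>\<^sub>M i\<in>I. lborel)"
  unfolding gweight_def[abs_def] by measurable

lemma gauss_cong:
  assumes "\<And>i j. i \<in> I \<Longrightarrow> j \<in> I \<Longrightarrow> Q i j = Q' i j"
  shows "gauss I Q = gauss I Q'"
proof -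
  have "gweight I Q = gweight I Q'"
    using assms by (auto simp: gweight_def bform_def dot_def mv_def intro!: ext sum.cong arg_cong[where f=ennreal])
  then show ?thesis by (simp add: gauss_def gmass_def)
qed

lemma sets_gauss [simp, measurable_cong]: "sets (gauss I Q) = sets (\<Pi>\<^sub>M i\<in>I. lborel)"
  and space_gauss [simp]: "space (gauss I Q) = space (\<Pi>\<^sub>M i\<in>I. lborel)"
  by (simp_all add: gauss_def)

lemma nn_integral_gauss:
  assumes "f \<in> borel_measurable (\<Pi>\<^sub>M i\<in>I. lborel)"
  shows "(\<integral>\<^sup>+z. f z \<partial>gauss I Q) = (\<integral>\<^sup>+z. f z * gweight I Q z \<partial>(\<Pi>\<^sub>M i\<in>I. lborel)) / gmass I Q"
proof -
  note [measurable] = assms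
  have "(\<integral>\<^sup>+z. f z \<partial>gauss I Q) = (\<integral>\<^sup>+z. f z * gweight I Q z / gmass I Q \<partial>(\<Pi>\<^sub>M i\<in>I. lborel))"
    unfolding gauss_def by (subst nn_integral_density) (auto simp: ennreal_times_divide mult.commute)
  then show ?thesis by (simp add: nn_integral_divide)
qed

lemma gauss_prob_space:
  assumes "gpair I Q S"
  shows "prob_space (gauss I Q)"
proof (rule prob_spaceI)
  have "emeasure (gauss I Q) (space (gauss I Q)) = (\<integral>\<^sup>+z. 1 \<partial>gauss I Q)"
    by simp
  also have "\<dots> = gmass I Q / gmass I Q"
    by (subst nn_integral_gauss) (simp_all add: gmass_def)
  also have "\<dots> = 1"
    using assms by (intro ennreal_divide_self) (auto simp: gpair_def)
  finally show "emeasure (gauss I Q) (space (gauss I Q)) = 1" .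
qed

lemma lborel_PiM_translate:
  fixes I :: "nat set"
  assumes "finite I"
  shows "distr (\<Pi>\<^sub>M i\<in>I. lborel) (\<Pi>\<^sub>M i\<in>I. lborel) (\<lambda>z. \<lambda>i\<in>I. z i + v i) = (\<Pi>\<^sub>M i\<in>I. (lborel :: real measure))"
proof -
  interpret product_sigma_finite "\<lambda>i::nat. lborel :: real measure" ..
  show ?thesis
  proof (rule PiM_eqI)
    fix A :: "nat \<Rightarrow> real set" assume A: "\<And>i. i \<in> I \<Longrightarrow> A i \<in> sets lborel"
    have A': "Pi\<^sub>E I A \<in> sets (\<Pi>\<^sub>M i\<in>I. lborel)"
      using A assms by (intro sets_PiM_I_finite) auto
    have eq: "(\<lambda>z. \<lambda>i\<in>I. z i + v i) -` Pi\<^sub>E I A \<inter> space (\<Pi>\<^sub>M i\<in>I. (lborel :: real measure)) =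
        (\<Pi>\<^sub>E i\<in>I. (\<lambda>x. x + v i) -` A i)"
      by (auto simp: space_PiM PiE_iff)
    have m: "(\<lambda>x. x + v i) -` A i \<in> sets lborel" if "i \<in> I" for i
      using measurable_sets[of "\<lambda>x. x + v i" borel borel "A i"] A[OF that] by simp
    have tr: "emeasure lborel ((\<lambda>x. x + v i) -` A i) = emeasure lborel (A i)" if "i \<in> I" for i
    proof -
      have "emeasure lborel (A i) = emeasure (distr lborel borel ((+) (v i))) (A i)"
        by (simp add: lborel_distr_plus)
      also have "\<dots> = emeasure lborel ((+) (v i) -` A i)"
        using A[OF that] by (subst emeasure_distr) auto
      also have "(+) (v i) -` A i = (\<lambda>x. x + v i) -` A i"
        by (auto simp: add.commute)
      finally show ?thesis by simp
    qed
    show "emeasure (distr (\<Pi>\<^sub>M i\<in>I. lborel) (\<Pi>\<^sub>M i\<in>I. lborel) (\<lambda>z. \<lambda>i\<in>I. z i + v i)) (Pi\<^sub>E I A) =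
        (\<Prod>i\<in>I. emeasure lborel (A i))"
      using A' m assms by (subst emeasure_distr) (auto simp: eq emeasure_PiM tr)
  qed (use assms in auto)
qed

text \<open>Translation by t S a changes the quadratic form by terms in \<open>dot I a z\<close>
  alone, because Q (S a) = a. This is a Cameron-Martin identity; the moments and laws of linear
  functionals below all come from it.\<close>

lemma gauss_shift:
  assumes "gpair I Q S" and [measurable]: "g \<in> borel_measurable borel"
  shows "(\<integral>\<^sup>+z. g (dot I a z) \<partial>gauss I Q) =
    (\<integral>\<^sup>+z. g (dot I a z + t * bform I S a a) *
      ennreal (exp (- t * dot I a z - t\<^sup>2 * bform I S a a / 2)) \<partial>gauss I Q)"
proof -
  have inv: "inv_on I Q S" and fin: "finite I" and sQ: "sym_on I Q" and sS: "sym_on I S"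
    using assms by (auto simp: gpair_def inv_on_def)
  define v where "v = (\<lambda>i. t * mv I S a i)"
  let ?T = "\<lambda>z. \<lambda>i\<in>I. z i + v i"
  let ?M = "\<Pi>\<^sub>M i\<in>I. (lborel :: real measure)"
  have T [measurable]: "?T \<in> ?M \<rightarrow>\<^sub>M ?M" by measurable
  have dT: "dot I a (?T z) = dot I a z + t * bform I S a a" for z
  proof -
    have "dot I a (?T z) = dot I a (\<lambda>i. z i + v i)" by (rule dot_cong) auto
    then show ?thesis by (simp add: dot_add_right v_def dot_scale_right bform_def)
  qed
  have bT: "bform I Q (?T z) (?T z) = bform I Q z z + 2 * t * dot I a z + t\<^sup>2 * bform I S a a" for z
  proof -
    have Qv: "dot I b (mv I Q v) = t * dot I b a" for b
      unfolding v_def mv_scale dot_scale_right using mv_mv_inv[OF inv, of _ a]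
      by (auto simp: dot_def intro!: sum.cong)
    have "bform I Q (?T z) (?T z) = bform I Q (\<lambda>i. z i + v i) (\<lambda>i. z i + v i)"
      by (rule bform_cong) auto
    also have "\<dots> = bform I Q z z + 2 * bform I Q z v + bform I Q v v"
      by (simp add: bform_add_right bform_add_left[OF sQ] bform_commute[OF sQ, of v z])
    also have "bform I Q z v = t * dot I a z"
      by (simp add: bform_def Qv dot_commute)
    also have "bform I Q v v = t * (t * bform I S a a)"
      by (simp add: bform_def[of I Q] Qv) (simp add: v_def bform_def dot_commute[of I _ a] dot_scale_right)
    finally show ?thesis unfolding power2_eq_square by linarith
  qed
  have wT: "gweight I Q (?T z) = ennreal (exp (- t * dot I a z - t\<^sup>2 * bform I S a a / 2)) * gweight I Q z" for z
    unfolding gweight_def bT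
    by (subst ennreal_mult'[symmetric], simp, rule arg_cong[where f=ennreal], subst mult_exp_exp,
        rule arg_cong[where f=exp], simp add: field_simps)
  have "(\<integral>\<^sup>+z. g (dot I a z) * gweight I Q z \<partial>?M) =
      (\<integral>\<^sup>+z. g (dot I a z) * gweight I Q z \<partial>distr ?M ?M ?T)"
    by (simp add: lborel_PiM_translate[OF fin])
  also have "\<dots> = (\<integral>\<^sup>+z. g (dot I a (?T z)) * gweight I Q (?T z) \<partial>?M)"
    by (subst nn_integral_distr) auto
  also have "\<dots> = (\<integral>\<^sup>+z. (g (dot I a z + t * bform I S a a) *
      ennreal (exp (- t * dot I a z - t\<^sup>2 * bform I S a a / 2))) * gweight I Q z \<partial>?M)"
    by (simp only: dT wT mult.assoc)
  finally show ?thesis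
    by (subst (1 2) nn_integral_gauss) (auto)
qed

text \<open>The shift identity for the constant 1, with - t for t: the total mass equals the
  exponential moment times exp (- t^2 s / 2), where s is the variance
  \<open>bform I S a a\<close>.\<close>

lemma gauss_mgf:
  assumes "gpair I Q S"
  shows "(\<integral>\<^sup>+z. ennreal (exp (t * dot I a z)) \<partial>gauss I Q) = ennreal (exp (t\<^sup>2 * bform I S a a / 2))"
proof -
  interpret prob_space "gauss I Q" by (rule gauss_prob_space[OF assms])
  let ?s = "bform I S a a"
  have "1 = (\<integral>\<^sup>+z. 1 \<partial>gauss I Q)" using emeasure_space_1 by simp
  also have "\<dots> = (\<integral>\<^sup>+z. ennreal (exp (t * dot I a z)) * ennreal (exp (- t\<^sup>2 * ?s / 2)) \<partial>gauss I Q)"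
    by (subst gauss_shift[OF assms, of "\<lambda>_. 1" a "- t"])
      (auto simp: ennreal_mult'[symmetric] mult_exp_exp field_simps intro!: nn_integral_cong)
  also have "\<dots> = (\<integral>\<^sup>+z. ennreal (exp (t * dot I a z)) \<partial>gauss I Q) * ennreal (exp (- t\<^sup>2 * ?s / 2))"
    by (rule nn_integral_multc) measurable
  finally have *: "(\<integral>\<^sup>+z. ennreal (exp (t * dot I a z)) \<partial>gauss I Q) * ennreal (exp (- t\<^sup>2 * ?s / 2)) = 1" ..
  have "(\<integral>\<^sup>+z. ennreal (exp (t * dot I a z)) \<partial>gauss I Q) * (ennreal (exp (- t\<^sup>2 * ?s / 2)) * ennreal (exp (t\<^sup>2 * ?s / 2)))
      = ennreal (exp (t\<^sup>2 * ?s / 2))"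
    by (subst mult.assoc[symmetric], subst *) simp
  moreover have "ennreal (exp (- t\<^sup>2 * ?s / 2)) * ennreal (exp (t\<^sup>2 * ?s / 2)) = 1"
    by (simp add: ennreal_mult'[symmetric] mult_exp_exp)
  ultimately show ?thesis by simp
qed

lemma abs_le_one_plus_square:
  fixes x :: real
  shows "\<bar>x\<bar> \<le> 1 + x\<^sup>2"
proof -
  have "0 \<le> (\<bar>x\<bar> - 1)\<^sup>2 + \<bar>x\<bar>\<^sup>2 + 1" by simp
  then show ?thesis by (simp add: power2_eq_square algebra_simps)
qed

text \<open>Squaring 2 sinh u \<ge> 2 u at u = x / 2 and using 4 sinh^2 (x / 2) = 2 cosh x - 2. The
  bound lets exponential moments dominate a second moment.\<close>

lemma two_plus_square_le:
  fixes x :: real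
  shows "2 + x\<^sup>2 \<le> exp x + exp (- x)"
proof -
  have sq: "(exp (u/2) - exp (-(u/2)))\<^sup>2 = exp u + exp (-u) - 2" for u :: real
  proof -
    have "exp (u/2) * exp (u/2) = exp u" "exp (-(u/2)) * exp (-(u/2)) = exp (-u)"
      "exp (u/2) * exp (-(u/2)) = 1"
      by (simp_all only: mult_exp_exp) auto
    then show ?thesis by (simp add: power2_eq_square left_diff_distrib right_diff_distrib mult.commute)
  qed
  have *: "2 + y\<^sup>2 \<le> exp y + exp (-y)" if y: "0 \<le> y" for y :: real
  proof -
    let ?f = "\<lambda>y::real. exp y - exp (-y) - 2*y"
    have "?f 0 \<le> ?f (y/2)"
    proof (rule DERIV_nonneg_imp_nondecreasing[where f="?f"])
      show "0 \<le> y/2" using y by simp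
      fix u :: real
      have "(?f has_real_derivative (exp u + exp (-u) - 2)) (at u)"
        by (auto intro!: derivative_eq_intros)
      moreover have "0 \<le> exp u + exp (-u) - 2"
        unfolding sq[symmetric] by simp
      ultimately show "\<exists>z. (?f has_real_derivative z) (at u) \<and> 0 \<le> z"
        by blast
    qed
    then have "y\<^sup>2 \<le> (exp (y/2) - exp (-(y/2)))\<^sup>2"
      using y by (intro power_mono) auto
    then show ?thesis unfolding sq by simp
  qed
  show ?thesis using *[of x] *[of "-x"] by (cases "0 \<le> x") auto
qed

text \<open>Semidefiniteness of S is a consequence of \<open>gpair\<close>: the exponential moments
  at 1 and - 1 sum to 2 exp (s / 2), with s = \<open>bform I S a a\<close>, and exceed 2 by at least
  the second moment of the functional. For s = 0 no second moment is left.\<close>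

lemma gauss_bform_cases:
  assumes "gpair I Q S"
  shows "0 < bform I S a a \<or> (bform I S a a = 0 \<and> (AE z in gauss I Q. dot I a z = 0))"
proof -
  interpret prob_space "gauss I Q" by (rule gauss_prob_space[OF assms])
  let ?s = "bform I S a a"
  have ge: "ennreal 2 + ennreal (x\<^sup>2) \<le> ennreal (exp (1 * x)) + ennreal (exp ((-1) * x))" for x :: real
  proof -
    have "ennreal 2 + ennreal (x\<^sup>2) = ennreal (2 + x\<^sup>2)"
      by (rule ennreal_plus[symmetric]) auto
    also have "\<dots> \<le> ennreal (exp (1 * x) + exp ((-1) * x))"
      using two_plus_square_le[of x] by (intro ennreal_leI) auto
    also have "\<dots> = ennreal (exp (1 * x)) + ennreal (exp ((-1) * x))"
      by (rule ennreal_plus) auto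
    finally show ?thesis .
  qed
  have "ennreal 2 + (\<integral>\<^sup>+z. ennreal ((dot I a z)\<^sup>2) \<partial>gauss I Q) = (\<integral>\<^sup>+z. ennreal 2 + ennreal ((dot I a z)\<^sup>2) \<partial>gauss I Q)"
    using emeasure_space_1 by (subst nn_integral_add) auto
  also have "\<dots> \<le> (\<integral>\<^sup>+z. ennreal (exp (1 * dot I a z)) + ennreal (exp ((-1) * dot I a z)) \<partial>gauss I Q)"
    by (intro nn_integral_mono ge)
  also have "\<dots> = ennreal (exp (?s / 2)) + ennreal (exp (?s / 2))"
    using gauss_mgf[OF assms, of 1 a] gauss_mgf[OF assms, of "-1" a] by (subst nn_integral_add) auto
  also have "\<dots> = ennreal (2 * exp (?s/2))" by (simp add: ennreal_plus[symmetric] del: ennreal_plus)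
  finally have *: "ennreal 2 + (\<integral>\<^sup>+z. ennreal ((dot I a z)\<^sup>2) \<partial>gauss I Q) \<le> ennreal (2 * exp (?s/2))" .
  then have "ennreal 2 \<le> ennreal (2 * exp (?s/2))"
    by (rule order_trans[OF add_increasing2[OF zero_le order_refl]])
  then have "1 \<le> exp (?s/2)" by (subst (asm) ennreal_le_iff) auto
  then have "0 \<le> ?s" by simp
  moreover have "AE z in gauss I Q. dot I a z = 0" if "?s = 0"
  proof -
    obtain r where r: "(\<integral>\<^sup>+z. ennreal ((dot I a z)\<^sup>2) \<partial>gauss I Q) = ennreal r" "0 \<le> r"
      using * by (cases "(\<integral>\<^sup>+z. ennreal ((dot I a z)\<^sup>2) \<partial>gauss I Q)") (auto simp: top_unique)
    have "ennreal (2 + r) \<le> ennreal 2"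
      using * that r by (simp add: ennreal_plus)
    then have "r = 0" using r by (subst (asm) ennreal_le_iff) auto
    then have "(\<integral>\<^sup>+z. ennreal ((dot I a z)\<^sup>2) \<partial>gauss I Q) = 0" using r by simp
    then show ?thesis by (subst (asm) nn_integral_0_iff_AE) auto
  qed
  ultimately show ?thesis by linarith
qed

text \<open>Averaging the shift identity over t in [0,1] and substituting x for the shifted value of the functional
  exhibits its law as a multiple of the measure with Lebesgue density exp (- x^2 / 2s); the factor is determined
  by the total mass.\<close>

lemma gauss_nn_integral_dot:
  assumes gp: "gpair I Q S" and pos: "0 < bform I S a a" and g [measurable]: "g \<in> borel_measurable borel"
  shows "(\<integral>\<^sup>+z. g (dot I a z) \<partial>gauss I Q) =
    (\<integral>\<^sup>+x. g x * ennreal (normal_density 0 (sqrt (bform I S a a)) x) \<partial>lborel)"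
proof -
  interpret prob_space "gauss I Q" by (rule gauss_prob_space[OF gp])
  interpret lb: pair_sigma_finite "gauss I Q" "lborel :: real measure" ..
  define s where "s = bform I S a a"
  have s: "0 < s" using pos by (simp add: s_def)
  define w :: "real \<Rightarrow> ennreal" where "w = indicator {0..1}"
  have [measurable]: "w \<in> borel_measurable borel" by (simp add: w_def)
  have w1: "(\<integral>\<^sup>+t. w t \<partial>lborel) = 1" by (simp add: w_def)
  have [measurable]: "dot I a \<in> borel_measurable (gauss I Q)" by simp
  define b where "b x = (\<integral>\<^sup>+z. w ((x - dot I a z) / s) * ennreal (exp ((dot I a z)\<^sup>2 / (2 * s))) \<partial>gauss I Q)" for x
  \<comment> \<open>The shift identity with t = x / s moves the window w back to the origin, and its
    exponential factor is absorbed by the weight exp (y^2 / 2s). The window enters only through b,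
    so the factor in front of exp (- x^2 / 2s) is the same at every x.\<close>
  have b_const: "b x = b 0" for x
  proof -
    have ex: "(y + x)\<^sup>2 / (2 * s) + (- (x / s) * y - (x / s)\<^sup>2 * s / 2) = y\<^sup>2 / (2 * s)" for y
      using s by (simp add: field_simps power2_eq_square)
    have "b x = (\<integral>\<^sup>+z. w ((x - (dot I a z + x / s * s)) / s) * ennreal (exp ((dot I a z + x / s * s)\<^sup>2 / (2 * s))) *
        ennreal (exp (- (x / s) * dot I a z - (x / s)\<^sup>2 * s / 2)) \<partial>gauss I Q)"
      unfolding b_def
      using gauss_shift[OF gp, of "\<lambda>y. w ((x - y) / s) * ennreal (exp (y\<^sup>2 / (2 * s)))" a "x / s"]
      by (simp add: s_def)
    also have "\<dots> = b 0"
      unfolding b_def using s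
      by (intro nn_integral_cong, subst mult.assoc, subst ennreal_mult'[symmetric], simp, subst mult_exp_exp)
        (simp add: ex[simplified])
    finally show ?thesis .
  qed
  define c where "c = 1 / sqrt (2 * pi * s)"
  have c: "c > 0" using s by (simp add: c_def)
  have nd: "normal_density 0 (sqrt s) x = c * exp (- x\<^sup>2 / (2 * s))" for x
    using s by (simp add: normal_density_def c_def)
  have key: "(\<integral>\<^sup>+z. h (dot I a z) \<partial>gauss I Q) = b 0 * ennreal (1 / (s * c)) *
      (\<integral>\<^sup>+x. h x * ennreal (normal_density 0 (sqrt s) x) \<partial>lborel)"
    if [measurable]: "h \<in> borel_measurable borel" for h
  proof -
    define F where "F z x = w ((x - dot I a z) / s) * ennreal (exp ((dot I a z)\<^sup>2 / (2 * s))) *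
        (h x * ennreal (exp (- x\<^sup>2 / (2 * s))))" for z x
    have [measurable]: "(\<lambda>(z, x). F z x) \<in> borel_measurable (gauss I Q \<Otimes>\<^sub>M lborel)"
      unfolding F_def by measurable
    have [measurable]: "F z \<in> borel_measurable borel" for z
      unfolding F_def by measurable
    have m2: "(\<lambda>(z, t). F z (dot I a z + s * t)) \<in> borel_measurable (gauss I Q \<Otimes>\<^sub>M lborel)"
      unfolding F_def by measurable
    have m3: "(\<lambda>(z, x). ennreal (1 / s) * F z x) \<in> borel_measurable (gauss I Q \<Otimes>\<^sub>M lborel)"
      by measurable
    have ex: "y\<^sup>2 / (2 * s) + (- (y + s * t)\<^sup>2 / (2 * s)) = - t * y - t\<^sup>2 * s / 2" for y t
      using s by (simp add: field_simps power2_eq_square)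
    have Ft: "F z (dot I a z + s * t) = w t * (h (dot I a z + t * s) * ennreal (exp (- t * dot I a z - t\<^sup>2 * s / 2)))" for z t
    proof -
      have "F z (dot I a z + s * t) = w t * (h (dot I a z + s * t) *
          ennreal (exp ((dot I a z)\<^sup>2 / (2 * s)) * exp (- (dot I a z + s * t)\<^sup>2 / (2 * s))))"
        using s by (simp add: F_def ennreal_mult mult_ac)
      then show ?thesis unfolding mult_exp_exp ex by (simp add: mult.commute)
    qed
    have "(\<integral>\<^sup>+z. h (dot I a z) \<partial>gauss I Q) = (\<integral>\<^sup>+t. w t * (\<integral>\<^sup>+z. h (dot I a z) \<partial>gauss I Q) \<partial>lborel)"
      by (simp add: nn_integral_multc w1)
    also have "\<dots> = (\<integral>\<^sup>+t. (\<integral>\<^sup>+z. F z (dot I a z + s * t) \<partial>gauss I Q) \<partial>lborel)"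
    proof (rule nn_integral_cong)
      fix t
      have "(\<integral>\<^sup>+z. F z (dot I a z + s * t) \<partial>gauss I Q) = w t * (\<integral>\<^sup>+z. h (dot I a z + t * s) *
          ennreal (exp (- t * dot I a z - t\<^sup>2 * s / 2)) \<partial>gauss I Q)"
        unfolding Ft by (rule nn_integral_cmult) measurable
      then show "w t * (\<integral>\<^sup>+z. h (dot I a z) \<partial>gauss I Q) = (\<integral>\<^sup>+z. F z (dot I a z + s * t) \<partial>gauss I Q)"
        using gauss_shift[OF gp that, of a t] by (simp add: s_def)
    qed
    also have "\<dots> = (\<integral>\<^sup>+z. (\<integral>\<^sup>+t. F z (dot I a z + s * t) \<partial>lborel) \<partial>gauss I Q)"
      by (rule lb.Fubini'[OF m2])
    also have "\<dots> = (\<integral>\<^sup>+z. (\<integral>\<^sup>+x. ennreal (1 / s) * F z x \<partial>lborel) \<partial>gauss I Q)"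
    proof (rule nn_integral_cong)
      fix z
      have "(\<integral>\<^sup>+x. ennreal (1 / s) * F z x \<partial>lborel) = ennreal (1 / s) * (ennreal s * (\<integral>\<^sup>+t. F z (dot I a z + s * t) \<partial>lborel))"
        using s by (subst nn_integral_real_affine[of _ s "dot I a z"]) (simp_all add: nn_integral_cmult mult_ac)
      also have "\<dots> = (\<integral>\<^sup>+t. F z (dot I a z + s * t) \<partial>lborel)"
        using s by (simp add: mult.assoc[symmetric] ennreal_mult'[symmetric])
      finally show "(\<integral>\<^sup>+t. F z (dot I a z + s * t) \<partial>lborel) = (\<integral>\<^sup>+x. ennreal (1 / s) * F z x \<partial>lborel)" ..
    qed
    also have "\<dots> = (\<integral>\<^sup>+x. (\<integral>\<^sup>+z. ennreal (1 / s) * F z x \<partial>gauss I Q) \<partial>lborel)"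
      by (rule lb.Fubini'[OF m3, symmetric])
    also have "\<dots> = (\<integral>\<^sup>+x. (b 0 * ennreal (1 / (s * c))) * (h x * ennreal (normal_density 0 (sqrt s) x)) \<partial>lborel)"
    proof (rule nn_integral_cong)
      fix x
      have "(\<integral>\<^sup>+z. ennreal (1 / s) * F z x \<partial>gauss I Q) = ennreal (1 / s) * (b x * (h x * ennreal (exp (- x\<^sup>2 / (2 * s)))))"
        unfolding F_def b_def by (simp add: nn_integral_cmult nn_integral_multc)
      also have "ennreal (exp (- x\<^sup>2 / (2 * s))) = ennreal (1 / c) * ennreal (normal_density 0 (sqrt s) x)"
        using c by (simp add: nd ennreal_mult'[symmetric])
      also have "ennreal (1 / s) * (b x * (h x * (ennreal (1 / c) * ennreal (normal_density 0 (sqrt s) x)))) =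
          (b 0 * (ennreal (1 / s) * ennreal (1 / c))) * (h x * ennreal (normal_density 0 (sqrt s) x))"
        by (simp add: b_const[of x] mult_ac)
      also have "ennreal (1 / s) * ennreal (1 / c) = ennreal (1 / (s * c))"
        using s c by (simp add: ennreal_mult'[symmetric])
      finally show "(\<integral>\<^sup>+z. ennreal (1 / s) * F z x \<partial>gauss I Q) =
        (b 0 * ennreal (1 / (s * c))) * (h x * ennreal (normal_density 0 (sqrt s) x))" .
    qed
    also have "\<dots> = b 0 * ennreal (1 / (s * c)) * (\<integral>\<^sup>+x. h x * ennreal (normal_density 0 (sqrt s) x) \<partial>lborel)"
      by (rule nn_integral_cmult) measurable
    finally show ?thesis .
  qed
  have "(\<integral>\<^sup>+x. ennreal (normal_density 0 (sqrt s) x) \<partial>lborel) = 1"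
    using s by (subst nn_integral_eq_integral) auto
  then have "b 0 * ennreal (1 / (s * c)) = 1"
    using key[of "\<lambda>_. 1"] emeasure_space_1 by simp
  then show ?thesis using key[OF g] by (simp add: s_def)
qed

lemma gauss_dot_distributed:
  assumes gp: "gpair I Q S" and pos: "0 < bform I S a a"
  shows "distributed (gauss I Q) lborel (dot I a) (\<lambda>x. ennreal (normal_density 0 (sqrt (bform I S a a)) x))"
  unfolding distributed_def
proof (intro conjI)
  show "distr (gauss I Q) lborel (dot I a) = density lborel (\<lambda>x. ennreal (normal_density 0 (sqrt (bform I S a a)) x))"
  proof (rule measure_eqI)
    fix A :: "real set" assume "A \<in> sets (distr (gauss I Q) lborel (dot I a))"
    then have [measurable]: "A \<in> sets borel" by simp
    have "emeasure (distr (gauss I Q) lborel (dot I a)) A = (\<integral>\<^sup>+x. indicator A x \<partial>distr (gauss I Q) lborel (dot I a))"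
      by simp
    also have "\<dots> = (\<integral>\<^sup>+z. indicator A (dot I a z) \<partial>gauss I Q)"
      by (rule nn_integral_distr) simp_all
    also have "\<dots> = (\<integral>\<^sup>+x. indicator A x * ennreal (normal_density 0 (sqrt (bform I S a a)) x) \<partial>lborel)"
      by (rule gauss_nn_integral_dot[OF assms]) simp
    finally show "emeasure (distr (gauss I Q) lborel (dot I a)) A =
        emeasure (density lborel (\<lambda>x. ennreal (normal_density 0 (sqrt (bform I S a a)) x))) A"
      by (simp add: emeasure_density mult.commute)
  qed simp
qed simp_all

text \<open>The degenerate functional is treated apart, as a law concentrated at 0 has no Lebesgue
  density.\<close>

lemma gauss_dot_square:
  assumes gp: "gpair I Q S"
  shows "has_bochner_integral (gauss I Q) (\<lambda>z. (dot I a z)\<^sup>2) (bform I S a a)"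
proof (cases "0 < bform I S a a")
  case True
  interpret prob_space "gauss I Q" by (rule gauss_prob_space[OF gp])
  let ?s = "bform I S a a"
  have s: "0 < sqrt ?s" using True by simp
  have "has_bochner_integral lborel (\<lambda>x. normal_density 0 (sqrt ?s) x * (x - 0)^(2 * 1)) (fact (2 * 1) / ((2 / (sqrt ?s)\<^sup>2)^1 * fact 1))"
    by (rule normal_moment_even) fact
  then have *: "has_bochner_integral lborel (\<lambda>x. normal_density 0 (sqrt ?s) x * x\<^sup>2) ?s"
    using True by (simp add: fact_numeral)
  note d = gauss_dot_distributed[OF gp True]
  have "integrable (gauss I Q) (\<lambda>z. (dot I a z)\<^sup>2)"
    by (subst distributed_integrable[OF d, of "\<lambda>x. x\<^sup>2", symmetric]) (use * in \<open>auto simp: has_bochner_integral_iff\<close>)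
  moreover have "(\<integral>z. (dot I a z)\<^sup>2 \<partial>gauss I Q) = ?s"
    by (subst distributed_integral[OF d, of "\<lambda>x. x\<^sup>2", symmetric]) (use * in \<open>auto simp: has_bochner_integral_iff\<close>)
  ultimately show ?thesis by (simp add: has_bochner_integral_iff)
next
  case False
  then have s: "bform I S a a = 0" and ae: "AE z in gauss I Q. dot I a z = 0"
    using gauss_bform_cases[OF gp, of a] by auto
  have "has_bochner_integral (gauss I Q) (\<lambda>z. (dot I a z)\<^sup>2) 0 \<longleftrightarrow> has_bochner_integral (gauss I Q) (\<lambda>z. 0) (0::real)"
    using ae by (intro has_bochner_integral_cong_AE) auto
  then show ?thesis by (simp add: s has_bochner_integral_zero)
qed

text \<open>r may be negative, provided 1 + r s > 0 for the variance s: removing a square from the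
  precision is what \<open>add_corr\<close> does last. The integrand times the normal density is a
  multiple of the normal density with variance s / (1 + r s).\<close>

lemma gauss_exp_square:
  assumes gp: "gpair I Q S" and p: "0 < 1 + r * bform I S a a"
  shows "(\<integral>\<^sup>+z. ennreal (exp (- r * (dot I a z)\<^sup>2 / 2)) \<partial>gauss I Q) = ennreal (1 / sqrt (1 + r * bform I S a a))"
proof (cases "0 < bform I S a a")
  case True
  let ?s = "bform I S a a" and ?v = "1 + r * bform I S a a"
  have eq: "exp (- r * x\<^sup>2 / 2) * normal_density 0 (sqrt ?s) x = 1 / sqrt ?v * normal_density 0 (sqrt (?s / ?v)) x" for x
  proof -
    have nd: "normal_density 0 (sqrt v) x = 1 / sqrt (2 * pi * v) * exp (- x\<^sup>2 / (2 * v))" if "v > 0" for v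
      using that by (simp add: normal_density_def)
    have e: "- r * x\<^sup>2 / 2 + - x\<^sup>2 / (2 * ?s) = - x\<^sup>2 / (2 * (?s / ?v))"
      using True p by (simp add: field_simps)
    have c: "1 / sqrt (2 * pi * ?s) = 1 / sqrt ?v * (1 / sqrt (2 * pi * (?s / ?v)))"
      using True p by (simp add: real_sqrt_mult real_sqrt_divide)
    have "exp (- r * x\<^sup>2 / 2) * normal_density 0 (sqrt ?s) x =
        1 / sqrt (2 * pi * ?s) * (exp (- r * x\<^sup>2 / 2) * exp (- x\<^sup>2 / (2 * ?s)))"
      using True by (subst nd) auto
    also have "\<dots> = 1 / sqrt ?v * (1 / sqrt (2 * pi * (?s / ?v)) * exp (- x\<^sup>2 / (2 * (?s / ?v))))"
      unfolding mult_exp_exp e c by simp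
    also have "\<dots> = 1 / sqrt ?v * normal_density 0 (sqrt (?s / ?v)) x"
      using True p by (subst nd) auto
    finally show ?thesis .
  qed
  have "(\<integral>\<^sup>+z. ennreal (exp (- r * (dot I a z)\<^sup>2 / 2)) \<partial>gauss I Q) =
      (\<integral>\<^sup>+x. ennreal (exp (- r * x\<^sup>2 / 2)) * ennreal (normal_density 0 (sqrt ?s) x) \<partial>lborel)"
    by (rule gauss_nn_integral_dot[OF gp True]) measurable
  also have "\<dots> = (\<integral>\<^sup>+x. ennreal (1 / sqrt ?v) * ennreal (normal_density 0 (sqrt (?s / ?v)) x) \<partial>lborel)"
    using p by (simp only: ennreal_mult'[symmetric] eq normal_density_nonneg exp_ge_zero)
      (simp add: ennreal_mult'[symmetric])
  also have "\<dots> = ennreal (1 / sqrt ?v) * (\<integral>\<^sup>+x. ennreal (normal_density 0 (sqrt (?s / ?v)) x) \<partial>lborel)"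
    by (rule nn_integral_cmult) measurable
  also have "(\<integral>\<^sup>+x. ennreal (normal_density 0 (sqrt (?s / ?v)) x) \<partial>lborel) = 1"
    using True p by (subst nn_integral_eq_integral) auto
  finally show ?thesis by simp
next
  case False
  interpret prob_space "gauss I Q" by (rule gauss_prob_space[OF gp])
  have s: "bform I S a a = 0" and ae: "AE z in gauss I Q. dot I a z = 0"
    using gauss_bform_cases[OF gp, of a] False by auto
  have "(\<integral>\<^sup>+z. ennreal (exp (- r * (dot I a z)\<^sup>2 / 2)) \<partial>gauss I Q) = (\<integral>\<^sup>+z. 1 \<partial>gauss I Q)"
    using ae by (intro nn_integral_cong_AE) auto
  then show ?thesis using emeasure_space_1 by (simp add: s)
qed

section \<open>Rank-one changes of the precision matrix\<close>

definition rank1 :: "(nat \<Rightarrow> nat \<Rightarrow> real) \<Rightarrow> real \<Rightarrow> (nat \<Rightarrow> real) \<Rightarrow> nat \<Rightarrow> nat \<Rightarrow> real" where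
  "rank1 Q r a = (\<lambda>i j. Q i j + r * a i * a j)"

text \<open>The Sherman-Morrison formula for the inverse of \<open>rank1 Q r a\<close>, when S is
  the inverse of Q.\<close>

definition rank1_inv :: "nat set \<Rightarrow> (nat \<Rightarrow> nat \<Rightarrow> real) \<Rightarrow> real \<Rightarrow> (nat \<Rightarrow> real) \<Rightarrow> nat \<Rightarrow> nat \<Rightarrow> real" where
  "rank1_inv I S r a = rank1 S (- r / (1 + r * bform I S a a)) (mv I S a)"

lemma mv_rank1: "mv I (rank1 Q r a) b i = mv I Q b i + r * a i * dot I a b"
  by (simp add: mv_def rank1_def dot_def sum.distrib sum_distrib_left algebra_simps)

lemma bform_rank1: "bform I (rank1 Q r a) b c = bform I Q b c + r * dot I a b * dot I a c"
  by (simp add: bform_def mv_rank1[abs_def] dot_def sum.distrib sum_distrib_left sum_distrib_right algebra_simps)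

lemma bform_rank1_inv:
  "sym_on I S \<Longrightarrow> bform I (rank1_inv I S r a) b c =
    bform I S b c - r * bform I S b a * bform I S a c / (1 + r * bform I S a a)"
  unfolding rank1_inv_def bform_rank1 dot_commute[of I "mv I S a"]
  by (simp add: bform_def[symmetric] bform_commute[of I S a c])

lemma inv_on_rank1:
  assumes inv: "inv_on I Q S" and p: "1 + r * bform I S a a \<noteq> 0"
  shows "inv_on I (rank1 Q r a) (rank1_inv I S r a)"
proof -
  have fin: "finite I" and sQ: "sym_on I Q" and sS: "sym_on I S"
    using inv by (auto simp: inv_on_def)
  let ?v = "1 + r * bform I S a a"
  have "(\<Sum>l\<in>I. rank1 Q r a i l * rank1_inv I S r a l j) = of_bool (i = j)" if ij: "i \<in> I" "j \<in> I" for i j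
  proof -
    define x where "x = mv I S a j"
    define k where "k = - r / ?v * x"
    have "(\<Sum>l\<in>I. rank1 Q r a i l * rank1_inv I S r a l j) = mv I (rank1 Q r a) (\<lambda>l. S l j + k * mv I S a l) i"
      by (simp add: mv_def rank1_inv_def rank1_def[of S] x_def k_def mult_ac)
    also have "\<dots> = mv I Q (\<lambda>l. S l j) i + k * a i +
        r * a i * (dot I a (\<lambda>l. S l j) + k * bform I S a a)"
      using mv_mv_inv[OF inv ij(1), of a]
      by (simp add: mv_rank1 mv_add mv_scale dot_add_right dot_scale_right bform_def algebra_simps)
    also have "dot I a (\<lambda>l. S l j) = x"
      using sS ij by (auto simp: dot_def x_def mv_def sym_on_def mult.commute intro!: sum.cong)
    also have "mv I Q (\<lambda>l. S l j) i = of_bool (i = j)"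
      using inv ij by (simp add: mv_def inv_on_def)
    also have "of_bool (i = j) + k * a i + r * a i * (x + k * bform I S a a) = of_bool (i = j)"
    proof -
      have "k * ?v = - r * x" using p by (simp add: k_def)
      then have "a i * (k * ?v + r * x) = 0" by simp
      then show ?thesis by (simp add: algebra_simps)
    qed
    finally show ?thesis .
  qed
  then show ?thesis
    using fin sQ sS by (auto simp: inv_on_def sym_on_def rank1_def rank1_inv_def)
qed

text \<open>The new mass over the old one is the mean of exp (- r (dot I a z)^2 / 2) under the old
  law. This stands in for the matrix determinant lemma, and its being finite and positive is how
  definiteness passes to the new matrix.\<close>

lemma gpair_rank1:
  assumes gp: "gpair I Q S" and p: "0 < 1 + r * bform I S a a"
  shows "gpair I (rank1 Q r a) (rank1_inv I S r a)"
    and "gmass I (rank1 Q r a) = gmass I Q * ennreal (1 / sqrt (1 + r * bform I S a a))"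
proof -
  have Z: "0 < gmass I Q" "gmass I Q < \<infinity>" using gp by (auto simp: gpair_def)
  have "gmass I (rank1 Q r a) =
      (\<integral>\<^sup>+z. ennreal (exp (- r * (dot I a z)\<^sup>2 / 2)) * gweight I Q z \<partial>(\<Pi>\<^sub>M i\<in>I. lborel))"
    unfolding gmass_def gweight_def bform_rank1
    by (intro nn_integral_cong, subst ennreal_mult'[symmetric])
      (auto simp: mult_exp_exp power2_eq_square field_simps)
  also have "\<dots> = gmass I Q * (\<integral>\<^sup>+z. ennreal (exp (- r * (dot I a z)\<^sup>2 / 2)) \<partial>gauss I Q)"
    using Z by (subst nn_integral_gauss, measurable)
      (simp add: ennreal_times_divide mult.commute[of "gmass I Q"] ennreal_mult_divide_eq)
  also have "\<dots> = gmass I Q * ennreal (1 / sqrt (1 + r * bform I S a a))"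
    by (simp only: gauss_exp_square[OF assms])
  finally show eq: "gmass I (rank1 Q r a) = gmass I Q * ennreal (1 / sqrt (1 + r * bform I S a a))" .
  have "inv_on I (rank1 Q r a) (rank1_inv I S r a)"
    using gp p by (intro inv_on_rank1) (auto simp: gpair_def)
  then show "gpair I (rank1 Q r a) (rank1_inv I S r a)"
    using Z p by (auto simp: gpair_def eq ennreal_mult_less_top ennreal_zero_less_mult_iff)
qed

section \<open>Correlating one coordinate with the others\<close>

lemma gpair_cong:
  assumes "gpair I Q S" "\<And>i j. i \<in> I \<Longrightarrow> j \<in> I \<Longrightarrow> S i j = S' i j"
  shows "gpair I Q S'"
proof -
  have "(\<Sum>l\<in>I. Q i l * S l j) = (\<Sum>l\<in>I. Q i l * S' l j)" if "i \<in> I" "j \<in> I" for i j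
    using assms(2) that by (intro sum.cong) auto
  then show ?thesis
    using assms by (auto simp: gpair_def inv_on_def sym_on_def)
qed

definition unit_vec :: "nat \<Rightarrow> nat \<Rightarrow> real" where
  "unit_vec i = (\<lambda>l. of_bool (l = i))"

text \<open>Coefficients of the residual of coordinate i after regression on the other coordinates,
  for the cross-covariances c.\<close>

definition resid :: "nat set \<Rightarrow> (nat \<Rightarrow> nat \<Rightarrow> real) \<Rightarrow> nat \<Rightarrow> (nat \<Rightarrow> real) \<Rightarrow> nat \<Rightarrow> real" where
  "resid I Q i c = (\<lambda>l. unit_vec i l - mv I Q c l)"

text \<open>Let coordinate i be standard and uncorrelated with the other coordinates z. Giving it the cross-covariances c
  makes it N(<Qc, z>, 1 - cQc) conditionally on z, so in the exponent its square is replaced by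
  (z i - <Qc, z>)^2 / (1 - cQc): a rank-two change of the precision matrix Q.\<close>

definition add_corr :: "nat set \<Rightarrow> (nat \<Rightarrow> nat \<Rightarrow> real) \<Rightarrow> nat \<Rightarrow> (nat \<Rightarrow> real) \<Rightarrow> nat \<Rightarrow> nat \<Rightarrow> real" where
  "add_corr I Q i c = rank1 (rank1 Q (1 / (1 - bform I Q c c)) (resid I Q i c)) (-1) (unit_vec i)"

lemma dot_unit_vec: "finite I \<Longrightarrow> i \<in> I \<Longrightarrow> dot I (unit_vec i) a = a i"
  by (simp add: dot_def unit_vec_def)

lemma mv_unit_vec: "finite I \<Longrightarrow> i \<in> I \<Longrightarrow> mv I S (unit_vec i) l = S l i"
  by (simp add: mv_def unit_vec_def)

lemma dot_diff_right: "dot I a (\<lambda>i. b i - c i) = dot I a b - dot I a c"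
  by (simp add: dot_def sum_subtractf algebra_simps)

lemma mv_diff: "mv I S (\<lambda>i. a i - b i) l = mv I S a l - mv I S b l"
  by (simp add: mv_def sum_subtractf algebra_simps)

context
  fixes I Q S i
  assumes gp: "gpair I Q S" and iI: "i \<in> I"
    and row_unit: "\<And>j. j \<in> I \<Longrightarrow> S i j = of_bool (i = j)"
begin

lemma row_finite: "finite I" and row_inv: "inv_on I Q S" and row_symQ: "sym_on I Q" and row_symS: "sym_on I S"
  using gp by (auto simp: gpair_def inv_on_def)

lemma col_unit: "j \<in> I \<Longrightarrow> S j i = of_bool (j = i)"
proof -
  assume j: "j \<in> I"
  have "S j i = S i j" using row_symS j iI unfolding sym_on_def by blast
  then show ?thesis unfolding row_unit[OF j] by auto
qed

text \<open>A coordinate that is uncorrelated with the others is decoupled in the precision matrix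
  too.\<close>

lemma inverse_row_unit: "j \<in> I \<Longrightarrow> Q i j = of_bool (i = j)"
proof -
  assume j: "j \<in> I"
  have "(\<Sum>l\<in>I. Q j l * S l i) = (\<Sum>l\<in>I. if l = i then Q j i else 0)"
    by (intro sum.cong) (simp_all add: col_unit)
  also have "\<dots> = Q j i" using row_finite iI by simp
  finally have "Q j i = of_bool (j = i)"
    using row_inv j iI unfolding inv_on_def by simp
  moreover have "Q j i = Q i j" using row_symQ j iI unfolding sym_on_def by blast
  ultimately show ?thesis by auto
qed

lemma mv_inverse_row: "mv I Q c i = c i"
proof -
  have "mv I Q c i = (\<Sum>j\<in>I. if i = j then c j else 0)"
    unfolding mv_def by (intro sum.cong) (simp_all add: inverse_row_unit)
  then show ?thesis using row_finite iI by simp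
qed

lemma mv_S_resid: "l \<in> I \<Longrightarrow> mv I S (resid I Q i c) l = unit_vec i l - c l"
proof -
  assume l: "l \<in> I"
  have "S l i = unit_vec i l" using col_unit[OF l] by (simp add: unit_vec_def)
  then show ?thesis
    unfolding resid_def mv_diff using mv_mv_inv[OF inv_on_commute[OF row_inv] l, of c]
    by (simp add: mv_unit_vec row_finite iI)
qed

lemma bform_S_unit: "bform I S (unit_vec i) (unit_vec i) = 1"
  using row_unit[OF iI] by (simp add: bform_def dot_unit_vec row_finite iI mv_unit_vec)

lemma bform_S_unit_resid: "c i = 0 \<Longrightarrow> bform I S (unit_vec i) (resid I Q i c) = 1"
  by (simp add: bform_def dot_unit_vec row_finite iI mv_S_resid) (simp add: unit_vec_def)

text \<open>The covariance of two residuals under the law in which coordinate i is still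
  uncorrelated: the variance 1 of z i plus the covariance of <Qc, z> and <Qc', z>.\<close>

lemma bform_S_resid:
  assumes "c i = 0" "c' i = 0"
  shows "bform I S (resid I Q i c) (resid I Q i c') = 1 + bform I Q c c'"
proof -
  have "bform I S (resid I Q i c) (resid I Q i c') = dot I (resid I Q i c) (\<lambda>l. unit_vec i l - c' l)"
    unfolding bform_def by (rule dot_cong) (auto simp: mv_S_resid)
  also have "\<dots> = resid I Q i c i - dot I (resid I Q i c) c'"
    by (simp add: dot_diff_right dot_commute[of I _ "unit_vec i"] dot_unit_vec row_finite iI)
  also have "dot I (resid I Q i c) c' = c' i - bform I Q c c'"
    unfolding dot_commute[of I _ c'] resid_def dot_diff_right
    by (simp add: dot_commute[of I _ "unit_vec i"] dot_unit_vec row_finite iI bform_def[symmetric]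
        bform_commute[OF row_symQ, of c' c])
  finally show ?thesis
    using assms by (simp add: resid_def mv_inverse_row) (simp add: unit_vec_def)
qed

text \<open>The residual square is added first and the square of z i removed afterwards. In the
  opposite order the form would degenerate in direction i, since z i has variance 1 there; after the
  addition its variance is 1 / 2. The two changes multiply the mass by sqrt (p / 2) and by sqrt 2,
  where p = 1 - cQc.\<close>

lemma add_corr_gpair:
  assumes c: "c i = 0" and p: "bform I Q c c < 1"
  shows "gpair I (add_corr I Q i c) (\<lambda>j l. S j l + unit_vec i j * c l + c j * unit_vec i l)"
    and "gmass I (add_corr I Q i c) = gmass I Q * ennreal (sqrt (1 - bform I Q c c))"
proof -
  define u where "u = bform I Q c c"
  define p where "p = 1 - u"
  have p0: "0 < p" using p by (simp add: p_def u_def)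
  let ?f = "resid I Q i c" and ?e = "unit_vec i"
  have ff: "bform I S ?f ?f = 1 + u" and ef: "bform I S ?e ?f = 1" and ee: "bform I S ?e ?e = 1"
    and fe: "bform I S ?f ?e = 1"
    using c by (simp_all add: bform_S_resid bform_S_unit_resid bform_S_unit u_def bform_commute[OF row_symS, of ?f ?e])
  have v1: "1 + 1 / p * (1 + u) = 2 / p" using p0 by (simp add: p_def field_simps)
  let ?S1 = "rank1_inv I S (1 / p) ?f"
  have "0 < 1 + 1 / p * bform I S ?f ?f" using p0 by (simp add: ff v1 del: times_divide_eq_left)
  note g1 = gpair_rank1[OF gp this]
  have ee1: "bform I ?S1 ?e ?e = 1 / 2"
    unfolding bform_rank1_inv[OF row_symS] ff ef ee fe v1 using p0 by simp
  have "0 < 1 + (-1) * bform I ?S1 ?e ?e" by (simp add: ee1)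
  note g2 = gpair_rank1[OF g1(1) this]
  have acc: "add_corr I Q i c = rank1 (rank1 Q (1 / p) ?f) (-1) ?e"
    by (simp add: add_corr_def p_def u_def)
  have "gmass I (add_corr I Q i c) = gmass I Q * (ennreal (1 / sqrt (2 / p)) * ennreal (1 / sqrt (1 / 2)))"
    unfolding acc g2(2) g1(2) ff v1 ee1 by (simp add: mult.assoc)
  also have "ennreal (1 / sqrt (2 / p)) * ennreal (1 / sqrt (1 / 2)) = ennreal (sqrt p)"
    using p0 by (simp add: ennreal_mult'[symmetric] real_sqrt_divide)
  finally show "gmass I (add_corr I Q i c) = gmass I Q * ennreal (sqrt (1 - bform I Q c c))"
    by (simp add: p_def u_def)
  have S1: "?S1 j l = S j l - (?e j - c j) * (?e l - c l) / 2" if "j \<in> I" "l \<in> I" for j l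
  proof -
    have "- (1 / p) / (1 + 1 / p * bform I S ?f ?f) = - 1 / 2"
      unfolding ff v1 using p0 by simp
    then show ?thesis
      unfolding rank1_inv_def rank1_def using that by (simp add: mv_S_resid)
  qed
  have S1e: "mv I ?S1 ?e j = (?e j + c j) / 2" if "j \<in> I" for j
  proof -
    have "S j i = ?e j" using col_unit[OF that] by (simp add: unit_vec_def)
    moreover have "?e i = 1" by (simp add: unit_vec_def)
    ultimately show ?thesis
      using c that by (simp add: mv_unit_vec row_finite iI S1 field_simps)
  qed
  show "gpair I (add_corr I Q i c) (\<lambda>j l. S j l + ?e j * c l + c j * ?e l)"
    unfolding acc
  proof (rule gpair_cong[OF g2(1)])
    fix j l assume jl: "j \<in> I" "l \<in> I"
    have "- (- 1) / (1 + (-1) * bform I ?S1 ?e ?e) = 2"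
      unfolding ee1 by simp
    then have "rank1_inv I ?S1 (-1) ?e j l = ?S1 j l + 2 * mv I ?S1 ?e j * mv I ?S1 ?e l"
      unfolding rank1_inv_def[of I ?S1] rank1_def[of ?S1] by simp
    also have "\<dots> = S j l + ?e j * c l + c j * ?e l"
      unfolding S1[OF jl] S1e[OF jl(1)] S1e[OF jl(2)] by (simp add: field_simps)
    finally show "rank1_inv I ?S1 (-1) ?e j l = S j l + ?e j * c l + c j * ?e l" .
  qed
qed

text \<open>The likelihood ratio of the correlated law against the uncorrelated one.\<close>

definition corr_ratio :: "(nat \<Rightarrow> real) \<Rightarrow> (nat \<Rightarrow> real) \<Rightarrow> real" where
  "corr_ratio c z = exp ((bform I Q z z - bform I (add_corr I Q i c) z z) / 2) / sqrt (1 - bform I Q c c)"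

lemma corr_ratio_measurable [measurable]: "corr_ratio c \<in> borel_measurable (\<Pi>\<^sub>M i\<in>I. lborel)"
  unfolding corr_ratio_def[abs_def] by measurable

lemma corr_ratio_nonneg: "bform I Q c c < 1 \<Longrightarrow> 0 \<le> corr_ratio c z"
  by (simp add: corr_ratio_def)

lemma gweight_add_corr:
  assumes "bform I Q c c < 1"
  shows "gweight I (add_corr I Q i c) z = gweight I Q z * ennreal (corr_ratio c z) * ennreal (sqrt (1 - bform I Q c c))"
proof -
  have e: "exp (- bform I (add_corr I Q i c) z z / 2) =
      exp (- bform I Q z z / 2) * exp ((bform I Q z z - bform I (add_corr I Q i c) z z) / 2)"
    unfolding mult_exp_exp by (simp add: diff_divide_distrib)
  show ?thesis
    unfolding gweight_def e corr_ratio_def using assms by (simp add: ennreal_mult'[symmetric])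
qed

lemma gauss_add_corr:
  assumes c: "c i = 0" and p: "bform I Q c c < 1"
  shows "gauss I (add_corr I Q i c) = density (gauss I Q) (\<lambda>z. ennreal (corr_ratio c z))"
proof -
  define r where "r = sqrt (1 - bform I Q c c)"
  have r: "0 < r" using p by (simp add: r_def)
  obtain G where G: "gmass I Q = ennreal G" "0 < G"
    using gp by (cases "gmass I Q") (auto simp: gpair_def)
  have "gweight I (add_corr I Q i c) z / gmass I (add_corr I Q i c) =
      gweight I Q z / gmass I Q * ennreal (corr_ratio c z)" for z
  proof -
    define x y where "x = exp (- bform I Q z z / 2)" and "y = corr_ratio c z"
    have xy: "0 \<le> x" "0 \<le> y" using p by (simp_all add: x_def y_def corr_ratio_def)
    have "ennreal x * ennreal y * ennreal r / (ennreal G * ennreal r) = ennreal x / ennreal G * ennreal y"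
      using xy r G by (simp add: ennreal_mult[symmetric] divide_ennreal)
    then show ?thesis
      unfolding gweight_add_corr[OF p] add_corr_gpair(2)[OF c p] G(1)
      by (simp add: gweight_def x_def y_def r_def)
  qed
  then show ?thesis
    unfolding gauss_def by (subst density_density_eq) (simp_all, measurable)
qed

text \<open>Against the base law the product of the two ratios is again a Gaussian weight: both
  residual squares are added and the square of z i is removed twice, so three rank-one changes give
  its mass. The conditional variances p and q cancel against the normalisations of the ratios, and
  only the cross term cQc' survives.\<close>

lemma corr_ratio_cross:
  assumes c: "c i = 0" "c' i = 0" and p: "bform I Q c c < 1" "bform I Q c' c' < 1"
    and u: "\<bar>bform I Q c c'\<bar> < 1"
  shows "(\<integral>\<^sup>+z. ennreal (corr_ratio c z * corr_ratio c' z) \<partial>gauss I Q) = ennreal (1 / (1 - bform I Q c c'))"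
proof -
  define a where "a = bform I Q c c"
  define b where "b = bform I Q c' c'"
  define u where "u = bform I Q c c'"
  define p where "p = 1 - a"
  define q where "q = 1 - b"
  have p0: "0 < p" and q0: "0 < q" and u1: "\<bar>u\<bar> < 1" using assms by (simp_all add: p_def q_def a_def b_def u_def)
  let ?f = "resid I Q i c" and ?g = "resid I Q i c'" and ?e = "unit_vec i"
  have ff: "bform I S ?f ?f = 1 + a" and gg: "bform I S ?g ?g = 1 + b" and fg: "bform I S ?f ?g = 1 + u"
    and gf: "bform I S ?g ?f = 1 + u"
    and ef: "bform I S ?e ?f = 1" and ee: "bform I S ?e ?e = 1" and eg: "bform I S ?e ?g = 1"
    and fe: "bform I S ?f ?e = 1" and ge: "bform I S ?g ?e = 1"
    using c by (simp_all add: bform_S_resid bform_S_unit_resid bform_S_unit a_def b_def u_def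
        bform_commute[OF row_symS, of ?f ?e] bform_commute[OF row_symS, of ?g ?e] bform_commute[OF row_symQ, of c' c])
  have v1: "1 + 1 / p * (1 + a) = 2 / p" using p0 by (simp add: p_def field_simps)
  let ?S1 = "rank1_inv I S (1 / p) ?f"
  have "0 < 1 + 1 / p * bform I S ?f ?f" using p0 by (simp add: ff v1 del: times_divide_eq_left)
  note g1 = gpair_rank1[OF gp this]
  have sym1: "sym_on I ?S1" using g1(1) by (auto simp: gpair_def inv_on_def)
  have half: "1 / p * x * y / (2 / p) = x * y / 2" for x y using p0 by simp
  have gg1: "bform I ?S1 ?g ?g = 1 + b - (1 + u)\<^sup>2 / 2"
    and ee1: "bform I ?S1 ?e ?e = 1 / 2"
    and eg1: "bform I ?S1 ?e ?g = (1 - u) / 2"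
    and ge1: "bform I ?S1 ?g ?e = (1 - u) / 2"
    unfolding bform_rank1_inv[OF row_symS] ff gg fg gf ef ee eg fe ge v1 half
    by (simp_all add: power2_eq_square field_simps)
  define t where "t = (1 - u) * (3 + u) / 2"
  have t0: "0 < t" using u1 by (simp add: t_def)
  have v2: "1 + 1 / q * (1 + b - (1 + u)\<^sup>2 / 2) = t / q"
    using q0 by (simp add: q_def t_def field_simps power2_eq_square)
  let ?S2 = "rank1_inv I ?S1 (1 / q) ?g"
  have "0 < 1 + 1 / q * bform I ?S1 ?g ?g" unfolding gg1 v2 using q0 t0 by simp
  note g2 = gpair_rank1[OF g1(1) this]
  have ee2: "bform I ?S2 ?e ?e = (1 + u) / (3 + u)"
  proof -
    have "bform I ?S2 ?e ?e = 1 / 2 - 1 / q * ((1 - u) / 2) * ((1 - u) / 2) / (t / q)"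
      unfolding bform_rank1_inv[OF sym1] ee1 gg1 eg1 ge1 v2 ..
    also have "\<dots> = 1 / 2 - (1 - u) * (1 - u) / (4 * t)" using q0 t0 by (simp add: field_simps)
    also have "4 * t = (1 - u) * (2 * (3 + u))" by (simp add: t_def)
    also have "(1 - u) * (1 - u) / ((1 - u) * (2 * (3 + u))) = (1 - u) / (2 * (3 + u))"
      using u1 by simp
    also have "1 / 2 - (1 - u) / (2 * (3 + u)) = (1 + u) / (3 + u)"
      using u1 by (simp add: field_simps)
    finally show ?thesis .
  qed
  have v3: "1 + (-2) * ((1 + u) / (3 + u)) = (1 - u) / (3 + u)"
    using u1 by (simp add: field_simps)
  have "0 < 1 + (-2) * bform I ?S2 ?e ?e" unfolding ee2 v3 using u1 by simp
  note g3 = gpair_rank1[OF g2(1) this]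
  let ?Q3 = "rank1 (rank1 (rank1 Q (1 / p) ?f) (1 / q) ?g) (-2) ?e"
  have Z: "gmass I Q \<noteq> 0" "gmass I Q \<noteq> top" using gp by (auto simp: gpair_def)
  have m3: "gmass I ?Q3 = gmass I Q * (ennreal (1 / sqrt (2 / p)) * ennreal (1 / sqrt (t / q)) * ennreal (1 / sqrt ((1 - u) / (3 + u))))"
    unfolding g3(2) g2(2) g1(2) ff v1 gg1 v2 ee2 v3 by (simp add: mult.assoc)
  have w3: "ennreal (corr_ratio c z * corr_ratio c' z) * gweight I Q z =
      ennreal (1 / (sqrt p * sqrt q)) * gweight I ?Q3 z" for z
  proof -
    have "exp (- bform I ?Q3 z z / 2) = exp (- bform I Q z z / 2) *
       exp ((bform I Q z z - bform I (add_corr I Q i c) z z) / 2) *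
       exp ((bform I Q z z - bform I (add_corr I Q i c') z z) / 2)"
      unfolding mult_exp_exp add_corr_def bform_rank1 a_def[symmetric] b_def[symmetric]
        p_def[symmetric] q_def[symmetric] by (simp add: field_simps)
    then have "corr_ratio c z * corr_ratio c' z * exp (- bform I Q z z / 2) =
        1 / (sqrt p * sqrt q) * exp (- bform I ?Q3 z z / 2)"
      by (simp add: corr_ratio_def p_def q_def a_def b_def)
    then show ?thesis
      unfolding gweight_def by (subst (1 2) ennreal_mult''[symmetric]) (simp_all)
  qed
  have "(\<integral>\<^sup>+z. ennreal (corr_ratio c z * corr_ratio c' z) \<partial>gauss I Q) =
      ennreal (1 / (sqrt p * sqrt q)) * gmass I ?Q3 / gmass I Q"
    by (subst nn_integral_gauss, measurable) (simp only: w3, subst nn_integral_cmult, measurable, simp add: gmass_def)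
  also have "\<dots> = ennreal (1 / (sqrt p * sqrt q)) * (ennreal (1 / sqrt (2 / p)) * ennreal (1 / sqrt (t / q)) * ennreal (1 / sqrt ((1 - u) / (3 + u))))"
  proof -
    have "x * (gmass I Q * y) / gmass I Q = x * y" for x y
      using mult_divide_eq_ennreal[OF Z, of "x * y"] by (simp only: mult_ac)
    then show ?thesis unfolding m3 .
  qed
  also have "\<dots> = ennreal (1 / (sqrt p * sqrt q) * (1 / sqrt (2 / p) * (1 / sqrt (t / q)) * (1 / sqrt ((1 - u) / (3 + u)))))"
    using p0 q0 t0 u1
    by (simp only: ennreal_mult'[symmetric] divide_nonneg_nonneg mult_nonneg_nonneg real_sqrt_ge_zero zero_le_one)
  also have "1 / (sqrt p * sqrt q) * (1 / sqrt (2 / p) * (1 / sqrt (t / q)) * (1 / sqrt ((1 - u) / (3 + u)))) = 1 / (1 - u)"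
  proof -
    have "1 / (sqrt p * sqrt q) * (1 / sqrt (2 / p) * (1 / sqrt (t / q)) * (1 / sqrt ((1 - u) / (3 + u)))) =
       1 / sqrt (p * q * (2 / p) * (t / q) * ((1 - u) / (3 + u)))"
    proof -
      have "1 / (v * w) * (1 / x * (1 / y) * (1 / z)) = 1 / (v * w * x * y * z)" for v w x y z :: real
        by simp
      then show ?thesis unfolding real_sqrt_mult .
    qed
    also have "p * q * (2 / p) * (t / q) * ((1 - u) / (3 + u)) = (1 - u)\<^sup>2"
      using p0 q0 u1 by (simp add: t_def power2_eq_square)
    finally show ?thesis using u1 by simp
  qed
  finally show ?thesis by (simp add: u_def)
qed

end

section \<open>Covariances with sparse rows of correlations\<close>

definition cross_cov :: "(nat \<Rightarrow> nat \<Rightarrow> real) \<Rightarrow> nat \<Rightarrow> nat \<Rightarrow> real" where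
  "cross_cov D = (\<lambda>j l. of_bool (j = l) + D j l + D l j)"

lemma gpair_identity:
  assumes "finite I"
  shows "gpair I (\<lambda>i j. of_bool (i = j)) (\<lambda>i j. of_bool (i = j))"
proof -
  interpret product_sigma_finite "\<lambda>i::nat. lborel :: real measure" ..
  have "bform I (\<lambda>i j. of_bool (i = j)) z z = (\<Sum>i\<in>I. (z i)\<^sup>2)" for z
  proof -
    have "mv I (\<lambda>i j. of_bool (i = j)) z i = z i" if "i \<in> I" for i
    proof -
      have "mv I (\<lambda>i j. of_bool (i = j)) z i = (\<Sum>j\<in>I. if i = j then z j else 0)"
        unfolding mv_def by (intro sum.cong) auto
      then show ?thesis using assms that by simp
    qed
    then show ?thesis
      unfolding bform_def dot_def by (intro sum.cong) (auto simp: power2_eq_square)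
  qed
  then have w: "gweight I (\<lambda>i j. of_bool (i = j)) z = (\<Prod>i\<in>I. ennreal (exp (- (z i)\<^sup>2 / 2)))" for z
    unfolding gweight_def using assms
    by (simp add: prod_ennreal exp_sum[symmetric] sum_negf sum_divide_distrib)
  have "gmass I (\<lambda>i j. of_bool (i = j)) = (\<Prod>i\<in>I. \<integral>\<^sup>+x. ennreal (exp (- x\<^sup>2 / 2)) \<partial>lborel)"
    unfolding gmass_def w by (subst product_nn_integral_prod[OF assms, symmetric]) simp_all
  also have "(\<integral>\<^sup>+x. ennreal (exp (- x\<^sup>2 / 2)) \<partial>lborel) = ennreal (sqrt (2 * pi))"
  proof -
    have "(\<integral>\<^sup>+x. ennreal (exp (- x\<^sup>2 / 2)) \<partial>lborel) =
        (\<integral>\<^sup>+x. ennreal (sqrt (2 * pi)) * ennreal (normal_density 0 1 x) \<partial>lborel)"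
      by (intro nn_integral_cong) (simp add: ennreal_mult'[symmetric] normal_density_def)
    also have "\<dots> = ennreal (sqrt (2 * pi)) * (\<integral>\<^sup>+x. ennreal (normal_density 0 1 x) \<partial>lborel)"
      by (rule nn_integral_cmult) measurable
    also have "(\<integral>\<^sup>+x. ennreal (normal_density 0 1 x) \<partial>lborel) = 1"
      by (subst nn_integral_eq_integral) auto
    finally show ?thesis by simp
  qed
  also have "(\<Prod>i\<in>I. ennreal (sqrt (2 * pi))) = ennreal (sqrt (2 * pi) ^ card I)"
    by (simp add: ennreal_power)
  finally have "gmass I (\<lambda>i j. of_bool (i = j)) = ennreal (sqrt (2 * pi) ^ card I)" .
  moreover have "inv_on I (\<lambda>i j. of_bool (i = j)) (\<lambda>i j. of_bool (i = j))"
  proof -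
    have "(\<Sum>l\<in>I. of_bool (i = l) * of_bool (l = j) :: real) = (\<Sum>l\<in>I. if i = l then of_bool (i = j) else 0)" for i j
      by (intro sum.cong) auto
    then show ?thesis using assms by (auto simp: inv_on_def sym_on_def)
  qed
  ultimately show ?thesis by (simp add: gpair_def)
qed

text \<open>Eliminating the off-diagonal block of Q from Q S = 1 leaves Q_CC = 1 + Q_CC D^T D, and D^T D has row sums
  at most 1/2.\<close>

lemma inverse_col_weight:
  assumes inv: "inv_on I Q (cross_cov D)"
    and RC: "R \<subseteq> I" "C \<subseteq> I" "R \<inter> C = {}"
    and D0: "\<And>i l. D i l \<noteq> 0 \<Longrightarrow> i \<in> R \<and> l \<in> C" and Dpos: "\<And>i l. 0 \<le> D i l"
    and row: "\<And>i. i \<in> R \<Longrightarrow> (\<Sum>l\<in>C. D i l) \<le> \<alpha>" and col: "\<And>l. l \<in> C \<Longrightarrow> (\<Sum>i\<in>R. D i l) \<le> \<gamma>"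
    and ab: "\<alpha> * \<gamma> \<le> 1 / 2" "0 \<le> \<alpha>" and j: "j \<in> C"
  shows "(\<Sum>l\<in>C. \<bar>Q j l\<bar>) \<le> 2"
proof -
  have fin: "finite I" using inv by (simp add: inv_on_def)
  have finR: "finite R" and finC: "finite C" using RC fin by (auto intro: finite_subset)
  have QC: "Q j l + (\<Sum>i\<in>R. Q j i * D i l) = of_bool (j = l)" if l: "l \<in> C" for l
  proof -
    have "of_bool (j = l) = (\<Sum>m\<in>I. Q j m * cross_cov D m l)"
      using inv j l RC by (auto simp: inv_on_def subset_iff)
    also have "\<dots> = (\<Sum>m\<in>I. (if m = l then Q j l else 0) + Q j m * D m l)"
      using D0[of l] l RC by (intro sum.cong) (auto simp: cross_cov_def algebra_simps)
    also have "\<dots> = Q j l + (\<Sum>m\<in>I. Q j m * D m l)"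
      using fin l RC by (simp add: sum.distrib subset_iff)
    also have "(\<Sum>m\<in>I. Q j m * D m l) = (\<Sum>i\<in>R. Q j i * D i l)"
      using fin RC D0 by (intro sum.mono_neutral_right) auto
    finally show ?thesis by simp
  qed
  have QR: "Q j i = - (\<Sum>m\<in>C. Q j m * D i m)" if i: "i \<in> R" for i
  proof -
    have "0 = (\<Sum>m\<in>I. Q j m * cross_cov D m i)"
      using inv j i RC by (auto simp: inv_on_def subset_iff)
    also have "\<dots> = (\<Sum>m\<in>I. (if m = i then Q j i else 0) + Q j m * D i m)"
      using D0[of _ i] i RC by (intro sum.cong) (auto simp: cross_cov_def algebra_simps)
    also have "\<dots> = Q j i + (\<Sum>m\<in>I. Q j m * D i m)"
      using fin i RC by (simp add: sum.distrib subset_iff)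
    also have "(\<Sum>m\<in>I. Q j m * D i m) = (\<Sum>m\<in>C. Q j m * D i m)"
      using fin RC D0 by (intro sum.mono_neutral_right) auto
    finally show ?thesis by simp
  qed
  \<comment> \<open>T is finite, so an estimate T \<le> 1 + \<alpha> \<gamma> T with \<alpha>
    \<gamma> \<le> 1/2 can be solved for T.\<close>
  define T where "T = (\<Sum>m\<in>C. \<bar>Q j m\<bar>)"
  have T0: "0 \<le> T" by (simp add: T_def sum_nonneg)
  have QRa: "\<bar>Q j i\<bar> \<le> (\<Sum>m\<in>C. \<bar>Q j m\<bar> * D i m)" if "i \<in> R" for i
    unfolding QR[OF that] abs_minus_cancel
    by (rule order_trans[OF sum_abs]) (simp add: abs_mult Dpos)
  have "\<bar>Q j l\<bar> \<le> of_bool (j = l) + (\<Sum>i\<in>R. \<bar>Q j i\<bar> * D i l)" if "l \<in> C" for l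
  proof -
    have "\<bar>\<Sum>i\<in>R. Q j i * D i l\<bar> \<le> (\<Sum>i\<in>R. \<bar>Q j i\<bar> * D i l)"
      by (rule order_trans[OF sum_abs]) (simp add: abs_mult Dpos)
    then show ?thesis using QC[OF that] by (cases "j = l") auto
  qed
  then have "T \<le> (\<Sum>l\<in>C. of_bool (j = l) + (\<Sum>i\<in>R. \<bar>Q j i\<bar> * D i l))"
    unfolding T_def by (rule sum_mono)
  also have "\<dots> = 1 + (\<Sum>i\<in>R. \<bar>Q j i\<bar> * (\<Sum>l\<in>C. D i l))"
    using j finC by (simp add: sum.distrib of_bool_def sum.delta sum_distrib_left) (rule sum.swap)
  also have "\<dots> \<le> 1 + (\<Sum>i\<in>R. (\<Sum>m\<in>C. \<bar>Q j m\<bar> * D i m) * \<alpha>)"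
    by (intro add_left_mono sum_mono mult_mono QRa row sum_nonneg) (auto simp: Dpos)
  also have "(\<Sum>i\<in>R. (\<Sum>m\<in>C. \<bar>Q j m\<bar> * D i m) * \<alpha>) = (\<Sum>m\<in>C. \<bar>Q j m\<bar> * (\<alpha> * (\<Sum>i\<in>R. D i m)))"
    unfolding sum_distrib_left sum_distrib_right by (subst sum.swap) (simp add: mult_ac)
  also have "\<dots> \<le> (\<Sum>m\<in>C. \<bar>Q j m\<bar> * (1 / 2))"
  proof (intro sum_mono mult_left_mono)
    fix m assume "m \<in> C"
    then have "\<alpha> * (\<Sum>i\<in>R. D i m) \<le> \<alpha> * \<gamma>" using ab(2) by (intro mult_left_mono col)
    then show "\<alpha> * (\<Sum>i\<in>R. D i m) \<le> 1 / 2" using ab(1) by linarith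
  qed simp
  also have "(\<Sum>m\<in>C. \<bar>Q j m\<bar> * (1 / 2)) = T / 2"
    by (simp add: T_def sum_divide_distrib)
  finally have "T \<le> 1 + T / 2" by simp
  then show ?thesis by (simp add: T_def)
qed

text \<open>The nesting puts c inside and c' outside: for fixed c the inner sum is a function of the
  column m, which is later averaged over the random columns of c'.\<close>

lemma bform_abs_le:
  assumes "finite I" "C \<subseteq> I" "\<And>l. 0 \<le> c l" "\<And>l. 0 \<le> c' l"
    "\<And>l. l \<notin> C \<Longrightarrow> c l = 0" "\<And>l. l \<notin> C \<Longrightarrow> c' l = 0"
  shows "\<bar>bform I Q c c'\<bar> \<le> (\<Sum>m\<in>C. c' m * (\<Sum>l\<in>C. c l * \<bar>Q l m\<bar>))"
proof -
  have "bform I Q c c' = (\<Sum>l\<in>I. c l * (\<Sum>m\<in>I. Q l m * c' m))"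
    by (simp add: bform_def dot_def mv_def)
  also have "\<dots> = (\<Sum>l\<in>C. c l * (\<Sum>m\<in>I. Q l m * c' m))"
    using assms by (intro sum.mono_neutral_right) auto
  also have "\<dots> = (\<Sum>l\<in>C. c l * (\<Sum>m\<in>C. Q l m * c' m))"
    using assms by (intro sum.cong refl arg_cong2[where f="(*)"] sum.mono_neutral_right) auto
  also have "\<dots> = (\<Sum>m\<in>C. c' m * (\<Sum>l\<in>C. c l * Q l m))"
    unfolding sum_distrib_left by (subst sum.swap) (simp add: mult_ac)
  also have "\<bar>\<dots>\<bar> \<le> (\<Sum>m\<in>C. \<bar>c' m * (\<Sum>l\<in>C. c l * Q l m)\<bar>)"
    by (rule sum_abs)
  also have "\<dots> \<le> (\<Sum>m\<in>C. c' m * (\<Sum>l\<in>C. c l * \<bar>Q l m\<bar>))"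
  proof (rule sum_mono)
    fix m
    have "\<bar>\<Sum>l\<in>C. c l * Q l m\<bar> \<le> (\<Sum>l\<in>C. c l * \<bar>Q l m\<bar>)"
      by (rule order_trans[OF sum_abs]) (simp add: abs_mult assms)
    then show "\<bar>c' m * (\<Sum>l\<in>C. c l * Q l m)\<bar> \<le> c' m * (\<Sum>l\<in>C. c l * \<bar>Q l m\<bar>)"
      using assms by (simp add: abs_mult mult_left_mono)
  qed
  finally show ?thesis .
qed

text \<open>D holds the correlations of rows with columns. \<alpha> bounds its row sums and \<gamma>
  its column sums, so \<alpha> * \<gamma> \<le> 1/2 controls D^T D; 2 * \<alpha> * \<epsilon> < 1
  keeps the conditional variance 1 - cQc of a row positive.\<close>

locale sparse_rows =
  fixes I R C :: "nat set" and D :: "nat \<Rightarrow> nat \<Rightarrow> real" and \<epsilon> \<alpha> \<gamma> :: real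
  assumes finI: "finite I" and RC: "R \<subseteq> I" "C \<subseteq> I" "R \<inter> C = {}"
    and D0: "\<And>i l. D i l \<noteq> 0 \<Longrightarrow> i \<in> R \<and> l \<in> C" and Dpos: "\<And>i l. 0 \<le> D i l" and Deps: "\<And>i l. D i l \<le> \<epsilon>"
    and row: "\<And>i. i \<in> R \<Longrightarrow> (\<Sum>l\<in>C. D i l) \<le> \<alpha>" and col: "\<And>l. l \<in> C \<Longrightarrow> (\<Sum>i\<in>R. D i l) \<le> \<gamma>"
    and ab: "\<alpha> * \<gamma> \<le> 1 / 2" "0 \<le> \<alpha>" "0 \<le> \<epsilon>" "2 * \<alpha> * \<epsilon> < 1"
begin

text \<open>Nonnegative entries make all sums monotone under the deletion of rows, so the same
  constants serve at every stage of an induction over the rows.\<close>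

lemma restrict_rows: "R' \<subseteq> R \<Longrightarrow> sparse_rows I R C (\<lambda>i l. if i \<in> R' then D i l else 0) \<epsilon> \<alpha> \<gamma>"
proof (unfold_locales)
  assume R': "R' \<subseteq> R"
  show "(\<Sum>l\<in>C. if i \<in> R' then D i l else 0) \<le> \<alpha>" if "i \<in> R" for i
    using row[OF that] ab by (cases "i \<in> R'") simp_all
  show "(\<Sum>i\<in>R. if i \<in> R' then D i l else 0) \<le> \<gamma>" if "l \<in> C" for l
    by (rule order_trans[OF _ col[OF that]], rule sum_mono) (simp add: Dpos)
qed (use finI RC D0 Dpos Deps ab in \<open>auto split: if_splits\<close>)

lemma col_weight:
  assumes "inv_on I Q (cross_cov D)" "m \<in> C"
  shows "(\<Sum>l\<in>C. \<bar>Q l m\<bar>) \<le> 2"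
proof -
  have "(\<Sum>l\<in>C. \<bar>Q l m\<bar>) = (\<Sum>l\<in>C. \<bar>Q m l\<bar>)"
    using assms RC by (intro sum.cong) (auto simp: inv_on_def sym_on_def subset_iff)
  also have "\<dots> \<le> 2"
    by (rule inverse_col_weight[OF assms(1) RC _ Dpos row col ab(1,2) assms(2)]) (use D0 in auto)
  finally show ?thesis .
qed

lemma bform_le:
  assumes inv: "inv_on I Q (cross_cov D)"
    and c: "\<And>l. 0 \<le> c l" "\<And>l. c l \<le> \<epsilon>" "\<And>l. l \<notin> C \<Longrightarrow> c l = 0"
    and c': "\<And>l. 0 \<le> c' l" "\<And>l. l \<notin> C \<Longrightarrow> c' l = 0" "(\<Sum>l\<in>C. c' l) \<le> \<alpha>"
  shows "\<bar>bform I Q c c'\<bar> \<le> 2 * \<alpha> * \<epsilon>"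
proof -
  have "\<bar>bform I Q c c'\<bar> \<le> (\<Sum>m\<in>C. c' m * (\<Sum>l\<in>C. c l * \<bar>Q l m\<bar>))"
    using finI RC c c' by (intro bform_abs_le) auto
  also have "\<dots> \<le> (\<Sum>m\<in>C. c' m * (\<epsilon> * 2))"
  proof (intro sum_mono mult_left_mono c'(1))
    fix m assume m: "m \<in> C"
    have "(\<Sum>l\<in>C. c l * \<bar>Q l m\<bar>) \<le> (\<Sum>l\<in>C. \<epsilon> * \<bar>Q l m\<bar>)"
      using c by (intro sum_mono mult_right_mono) auto
    also have "\<dots> \<le> \<epsilon> * 2"
      unfolding sum_distrib_left[symmetric] using col_weight[OF inv m] ab by (intro mult_left_mono)
    finally show "(\<Sum>l\<in>C. c l * \<bar>Q l m\<bar>) \<le> \<epsilon> * 2" .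
  qed
  also have "\<dots> = (\<Sum>m\<in>C. c' m) * (\<epsilon> * 2)" by (simp add: sum_distrib_right)
  also have "\<dots> \<le> \<alpha> * (\<epsilon> * 2)" using c' ab by (intro mult_right_mono) auto
  finally show ?thesis by (simp add: mult_ac)
qed

end

text \<open>The matrix is built up from the identity one row at a time. The row to be added is still
  uncorrelated with all other cells, and \<open>bform_le\<close>, applied to the rows already
  present, keeps its conditional variance positive.\<close>

lemma (in sparse_rows) gpair_exists: "\<exists>Q. gpair I Q (cross_cov D)"
proof -
  have finR: "finite R" using finI RC by (auto intro: finite_subset)
  have "\<exists>Q. gpair I Q (cross_cov (\<lambda>i l. if i \<in> R' then D i l else 0))" if "finite R'" "R' \<subseteq> R" for R'
    using that
  proof (induction R' rule: finite_induct)
    case empty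
    show ?case using gpair_identity[OF finI] by (auto simp: cross_cov_def)
  next
    case (insert i R')
    then have iR: "i \<in> R" and R': "R' \<subseteq> R" and i: "i \<notin> R'" by auto
    have iC: "i \<notin> C" and iI: "i \<in> I" using iR RC by auto
    let ?D = "\<lambda>i l. if i \<in> R' then D i l else 0"
    interpret r: sparse_rows I R C ?D \<epsilon> \<alpha> \<gamma> by (rule restrict_rows[OF R'])
    obtain Q where gp: "gpair I Q (cross_cov ?D)" using insert by auto
    have Si: "cross_cov ?D i j = of_bool (i = j)" if "j \<in> I" for j
      using D0[of j i] i iC by (auto simp: cross_cov_def)
    have Di: "D i l = 0" if "l \<notin> C" for l using D0[of i l] that by auto
    have "\<bar>bform I Q (D i) (D i)\<bar> \<le> 2 * \<alpha> * \<epsilon>"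
      using gp Di row[OF iR] by (intro r.bform_le) (auto simp: gpair_def Dpos Deps)
    then have "bform I Q (D i) (D i) < 1" using ab by linarith
    note add_corr_gpair(1)[OF gp iI Si Di[OF iC] this]
    moreover have "(\<lambda>j l. cross_cov ?D j l + unit_vec i j * D i l + D i j * unit_vec i l) =
        cross_cov (\<lambda>j l. if j \<in> insert i R' then D j l else 0)"
      using i by (auto simp: cross_cov_def unit_vec_def fun_eq_iff)
    ultimately show ?case by auto
  qed
  from this[OF finR order_refl] obtain Q where "gpair I Q (cross_cov (\<lambda>i l. if i \<in> R then D i l else 0))"
    by auto
  moreover have "(\<lambda>i l. if i \<in> R then D i l else 0) = D"
    using D0 by (auto simp: fun_eq_iff)
  ultimately show ?thesis by auto
qed

text \<open>By uniqueness of the inverse the choice of Q does not affect the law, so a Gaussian law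
  can be named by its covariance alone.\<close>

definition gauss_cov :: "nat set \<Rightarrow> (nat \<Rightarrow> nat \<Rightarrow> real) \<Rightarrow> (nat \<Rightarrow> real) measure" where
  "gauss_cov I S = gauss I (SOME Q. gpair I Q S)"

lemma gauss_cov_eq:
  assumes "gpair I Q S"
  shows "gauss_cov I S = gauss I Q"
proof -
  have "gpair I (SOME Q. gpair I Q S) S" by (rule someI[of "\<lambda>Q. gpair I Q S", OF assms])
  then show ?thesis
    unfolding gauss_cov_def using assms by (intro gauss_cong) (auto simp: gpair_def intro: inv_on_unique)
qed

section \<open>Le Cam's bound for a mixture\<close>

lemma PiM_density:
  assumes "prob_space P" "finite J" and [measurable]: "f \<in> borel_measurable P" and "prob_space (density P f)"
  shows "(\<Pi>\<^sub>M n\<in>J. density P f) = density (\<Pi>\<^sub>M n\<in>J. P) (\<lambda>U. \<Prod>n\<in>J. f (U n))"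
proof -
  interpret P: prob_space P by fact
  interpret Pf: prob_space "density P f" by fact
  interpret p: product_sigma_finite "\<lambda>_. P" ..
  interpret q: product_sigma_finite "\<lambda>_. density P f" ..
  have m [measurable]: "(\<lambda>U. \<Prod>n\<in>J. f (U n)) \<in> borel_measurable (\<Pi>\<^sub>M n\<in>J. P)"
    by measurable
  show ?thesis
  proof (rule q.PiM_eqI[symmetric, OF assms(2)])
    show "sets (density (\<Pi>\<^sub>M n\<in>J. P) (\<lambda>U. \<Prod>n\<in>J. f (U n))) = sets (\<Pi>\<^sub>M n\<in>J. density P f)"
      by (simp cong: sets_PiM_cong)
    fix A assume A: "\<And>n. n \<in> J \<Longrightarrow> A n \<in> sets (density P f)"
    have AP: "A n \<in> sets P" if "n \<in> J" for n using A[OF that] by simp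
    have "emeasure (density (\<Pi>\<^sub>M n\<in>J. P) (\<lambda>U. \<Prod>n\<in>J. f (U n))) (Pi\<^sub>E J A) =
        (\<integral>\<^sup>+U. (\<Prod>n\<in>J. f (U n)) * indicator (Pi\<^sub>E J A) U \<partial>(\<Pi>\<^sub>M n\<in>J. P))"
      using AP assms(2) by (intro emeasure_density m sets_PiM_I_finite) auto
    also have "\<dots> = (\<integral>\<^sup>+U. (\<Prod>n\<in>J. f (U n) * indicator (A n) (U n)) \<partial>(\<Pi>\<^sub>M n\<in>J. P))"
    proof (rule nn_integral_cong)
      fix U assume U: "U \<in> space (\<Pi>\<^sub>M n\<in>J. P)"
      have "indicator (Pi\<^sub>E J A) U = (\<Prod>n\<in>J. indicator (A n) (U n) :: ennreal)"
      proof (cases "U \<in> Pi\<^sub>E J A")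
        case True
        then show ?thesis by (auto simp: PiE_iff intro!: prod.neutral[symmetric])
      next
        case False
        then obtain n where "n \<in> J" "U n \<notin> A n" using U by (auto simp: PiE_iff space_PiM)
        then have "(\<Prod>n\<in>J. indicator (A n) (U n) :: ennreal) = 0"
          using assms(2) by (intro prod_zero bexI[of _ n]) auto
        then show ?thesis using False by simp
      qed
      then show "(\<Prod>n\<in>J. f (U n)) * indicator (Pi\<^sub>E J A) U = (\<Prod>n\<in>J. f (U n) * indicator (A n) (U n))"
        by (simp add: prod.distrib)
    qed
    also have "\<dots> = (\<Prod>n\<in>J. \<integral>\<^sup>+u. f u * indicator (A n) u \<partial>P)"
      by (intro p.product_nn_integral_prod borel_measurable_times_ennreal borel_measurable_indicator AP assms)
    also have "\<dots> = (\<Prod>n\<in>J. emeasure (density P f) (A n))"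
      using AP by (intro prod.cong refl) (simp add: emeasure_density)
    finally show "emeasure (density (\<Pi>\<^sub>M n\<in>J. P) (\<lambda>U. \<Prod>n\<in>J. f (U n))) (Pi\<^sub>E J A) =
        (\<Prod>n\<in>J. emeasure (density P f) (A n))" .
  qed
qed

text \<open>In terms of the likelihood ratio G, the two errors |F| and G |F - a| add up to at least
  a min (1, G), and min (1, G) \<ge> 2 G - G^2 - 1 / 4 by completing a square in either case. So
  only two moments of G have to be known.\<close>

lemma two_point_pointwise:
  fixes F G a :: real
  assumes "0 \<le> G" "0 \<le> a"
  shows "2 * a * G \<le> \<bar>F\<bar> + G * \<bar>F - a\<bar> + a * (G\<^sup>2 + 1 / 4)"
proof (cases "G \<le> 1")
  case True
  have "G * a \<le> G * (\<bar>F\<bar> + \<bar>F - a\<bar>)" using assms by (intro mult_left_mono) auto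
  moreover have "G * \<bar>F\<bar> \<le> \<bar>F\<bar>" using True assms by (simp add: mult_left_le_one_le)
  moreover have "0 \<le> a * (G - 1 / 2)\<^sup>2" using assms by simp
  ultimately show ?thesis by (simp add: power2_eq_square algebra_simps)
next
  case False
  have "1 * \<bar>F - a\<bar> \<le> G * \<bar>F - a\<bar>" using False by (intro mult_right_mono) auto
  moreover have "a \<le> \<bar>F\<bar> + \<bar>F - a\<bar>" by auto
  moreover have "0 \<le> a * (G - 1)\<^sup>2" using assms by simp
  ultimately show ?thesis using assms by (simp add: power2_eq_square algebra_simps)
qed

text \<open>F estimates a number that is 0 under P and a under each of the alternatives. The average
  G of the N-fold likelihood ratios has mean 1 and, by \<open>cross\<close>, second moment at most 5
  / 4; the pointwise bound then leaves 2 - 5 / 4 - 1 / 4 = 1 / 2 of a.\<close>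

lemma le_cam_mixture:
  fixes l :: "'b \<Rightarrow> 'a \<Rightarrow> real" and a :: real
  assumes P: "prob_space P" and B: "finite B" "B \<noteq> {}"
    and lm: "\<And>b. b \<in> B \<Longrightarrow> l b \<in> borel_measurable P" and lpos: "\<And>b u. b \<in> B \<Longrightarrow> 0 \<le> l b u"
    and lP: "\<And>b. b \<in> B \<Longrightarrow> prob_space (density P (\<lambda>u. ennreal (l b u)))"
    and F [measurable]: "F \<in> borel_measurable (\<Pi>\<^sub>M n\<in>{..<N}. P)" and a: "0 \<le> a"
    and cross: "(\<Sum>b\<in>B. \<Sum>b'\<in>B. (\<integral>\<^sup>+u. ennreal (l b u * l b' u) \<partial>P) ^ N) \<le> ennreal (5 / 4 * (real (card B))\<^sup>2)"
  shows "ennreal (a / 2) \<le> (\<integral>\<^sup>+U. ennreal \<bar>F U\<bar> \<partial>(\<Pi>\<^sub>M n\<in>{..<N}. P)) +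
     (\<Sum>b\<in>B. \<integral>\<^sup>+U. ennreal \<bar>F U - a\<bar> \<partial>(\<Pi>\<^sub>M n\<in>{..<N}. density P (\<lambda>u. ennreal (l b u)))) * ennreal (1 / card B)"
proof -
  interpret P: prob_space P by fact
  interpret p: product_sigma_finite "\<lambda>_. P" ..
  interpret pp: product_prob_space "\<lambda>_::nat. P" "{..<N}" ..
  let ?M = "\<Pi>\<^sub>M n\<in>{..<N}. P"
  define c where "c = real (card B)"
  have c: "0 < c" using B by (simp add: c_def card_gt_0_iff)
  define L where "L b U = (\<Prod>n<N. l b (U n))" for b U
  have Lm [measurable]: "L b \<in> borel_measurable ?M" if "b \<in> B" for b
    unfolding L_def[abs_def] using lm[OF that] by measurable
  have Lpos: "0 \<le> L b U" if "b \<in> B" for b U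
    unfolding L_def using lpos that by (intro prod_nonneg) auto
  define G where "G U = (\<Sum>b\<in>B. L b U) / c" for U
  have Gpos: "0 \<le> G U" for U unfolding G_def using c Lpos by (intro divide_nonneg_nonneg sum_nonneg) auto
  have Gm [measurable]: "G \<in> borel_measurable ?M" unfolding G_def[abs_def] by measurable
  have dens: "(\<Pi>\<^sub>M n\<in>{..<N}. density P (\<lambda>u. ennreal (l b u))) = density ?M (\<lambda>U. ennreal (L b U))" if b: "b \<in> B" for b
    using PiM_density[OF P _ _ lP[OF b], of "{..<N}"] lm[OF b] lpos[OF b] by (simp add: L_def prod_ennreal)
  have L1: "(\<integral>\<^sup>+U. ennreal (L b U) \<partial>?M) = 1" if b: "b \<in> B" for b
  proof -
    interpret d: prob_space "density P (\<lambda>u. ennreal (l b u))" by (rule lP[OF b])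
    have "(\<integral>\<^sup>+u. ennreal (l b u) \<partial>P) = 1"
      using d.emeasure_space_1 lm[OF b] by (simp add: emeasure_density cong: nn_integral_cong)
    then have "(\<Prod>n<N. \<integral>\<^sup>+u. ennreal (l b u) \<partial>P) = 1" by simp
    moreover have "(\<integral>\<^sup>+U. (\<Prod>n<N. ennreal (l b (U n))) \<partial>?M) = (\<Prod>n<N. \<integral>\<^sup>+u. ennreal (l b u) \<partial>P)"
      using lm[OF b] by (intro p.product_nn_integral_prod) auto
    ultimately show ?thesis using lpos[OF b] by (simp add: L_def prod_ennreal)
  qed
  \<comment> \<open>Independence of the samples raises the cross moment of one sample to the power
    N.\<close>
  have LL: "(\<integral>\<^sup>+U. ennreal (L b U * L b' U) \<partial>?M) = (\<integral>\<^sup>+u. ennreal (l b u * l b' u) \<partial>P) ^ N" if b: "b \<in> B" "b' \<in> B" for b b'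
  proof -
    have "ennreal (L b U * L b' U) = (\<Prod>n<N. ennreal (l b (U n) * l b' (U n)))" for U
      using lpos b by (simp add: L_def prod.distrib[symmetric] prod_ennreal)
    moreover have "(\<integral>\<^sup>+U. (\<Prod>n<N. ennreal (l b (U n) * l b' (U n))) \<partial>?M) = (\<Prod>n<N. \<integral>\<^sup>+u. ennreal (l b u * l b' u) \<partial>P)"
      using lm[OF b(1)] lm[OF b(2)] by (intro p.product_nn_integral_prod) auto
    ultimately have "(\<integral>\<^sup>+U. ennreal (L b U * L b' U) \<partial>?M) = (\<Prod>n<N. \<integral>\<^sup>+u. ennreal (l b u * l b' u) \<partial>P)"
      by simp
    then show ?thesis by simp
  qed
  have G1: "(\<integral>\<^sup>+U. ennreal (G U) \<partial>?M) = 1"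
  proof -
    have "ennreal (G U) = (\<Sum>b\<in>B. ennreal (L b U)) * ennreal (1 / c)" for U
      unfolding G_def using c Lpos by (subst sum_ennreal) (auto simp: ennreal_mult'[symmetric] sum_nonneg)
    then have "(\<integral>\<^sup>+U. ennreal (G U) \<partial>?M) = (\<Sum>b\<in>B. \<integral>\<^sup>+U. ennreal (L b U) \<partial>?M) * ennreal (1 / c)"
      by (simp add: nn_integral_multc nn_integral_sum)
    also have "\<dots> = ennreal c * ennreal (1 / c)" by (simp add: L1 c_def ennreal_of_nat_eq_real_of_nat)
    also have "\<dots> = 1" using c by (simp add: ennreal_mult'[symmetric])
    finally show ?thesis .
  qed
  have G2: "(\<integral>\<^sup>+U. ennreal ((G U)\<^sup>2) \<partial>?M) \<le> ennreal (5 / 4)"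
  proof -
    have "ennreal ((G U)\<^sup>2) = (\<Sum>b\<in>B. \<Sum>b'\<in>B. ennreal (L b U * L b' U)) * ennreal (1 / c\<^sup>2)" for U
    proof -
      have "(G U)\<^sup>2 = (\<Sum>b\<in>B. \<Sum>b'\<in>B. L b U * L b' U) * (1 / c\<^sup>2)"
        by (simp add: G_def power2_eq_square sum_product)
      then have "ennreal ((G U)\<^sup>2) = ennreal (\<Sum>b\<in>B. \<Sum>b'\<in>B. L b U * L b' U) * ennreal (1 / c\<^sup>2)"
        by (simp only: ennreal_mult'' zero_le_divide_1_iff zero_le_power2)
      also have "ennreal (\<Sum>b\<in>B. \<Sum>b'\<in>B. L b U * L b' U) = (\<Sum>b\<in>B. ennreal (\<Sum>b'\<in>B. L b U * L b' U))"
        using Lpos by (intro sum_ennreal[symmetric] sum_nonneg) auto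
      also have "\<dots> = (\<Sum>b\<in>B. \<Sum>b'\<in>B. ennreal (L b U * L b' U))"
        using Lpos by (intro sum.cong refl sum_ennreal[symmetric]) auto
      finally show ?thesis .
    qed
    then have "(\<integral>\<^sup>+U. ennreal ((G U)\<^sup>2) \<partial>?M) =
        (\<Sum>b\<in>B. \<Sum>b'\<in>B. \<integral>\<^sup>+U. ennreal (L b U * L b' U) \<partial>?M) * ennreal (1 / c\<^sup>2)"
      by (simp add: nn_integral_multc nn_integral_sum)
    also have "\<dots> \<le> ennreal (5 / 4 * c\<^sup>2) * ennreal (1 / c\<^sup>2)"
      using cross by (intro mult_right_mono) (simp_all add: LL c_def)
    also have "\<dots> = ennreal (5 / 4)" using c by (simp add: ennreal_mult'[symmetric])
    finally show ?thesis .
  qed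
  \<comment> \<open>The averaged error under the alternatives is the error under the base law with
    weight G.\<close>
  have mix: "(\<Sum>b\<in>B. \<integral>\<^sup>+U. ennreal \<bar>F U - a\<bar> \<partial>(\<Pi>\<^sub>M n\<in>{..<N}. density P (\<lambda>u. ennreal (l b u)))) * ennreal (1 / card B)
      = (\<integral>\<^sup>+U. ennreal (G U * \<bar>F U - a\<bar>) \<partial>?M)"
  proof -
    have "ennreal (G U * \<bar>F U - a\<bar>) = (\<Sum>b\<in>B. ennreal (L b U) * ennreal \<bar>F U - a\<bar>) * ennreal (1 / c)" for U
    proof -
      have "G U * \<bar>F U - a\<bar> = (\<Sum>b\<in>B. L b U * \<bar>F U - a\<bar>) * (1 / c)"
        unfolding G_def by (simp add: sum_distrib_right[symmetric])
      then have "ennreal (G U * \<bar>F U - a\<bar>) = ennreal (\<Sum>b\<in>B. L b U * \<bar>F U - a\<bar>) * ennreal (1 / c)"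
        using c by (simp only: ennreal_mult'' zero_le_divide_1_iff less_imp_le)
      also have "ennreal (\<Sum>b\<in>B. L b U * \<bar>F U - a\<bar>) = (\<Sum>b\<in>B. ennreal (L b U * \<bar>F U - a\<bar>))"
        using Lpos by (intro sum_ennreal[symmetric]) auto
      also have "\<dots> = (\<Sum>b\<in>B. ennreal (L b U) * ennreal \<bar>F U - a\<bar>)"
        by (intro sum.cong refl ennreal_mult'') auto
      finally show ?thesis .
    qed
    then have "(\<integral>\<^sup>+U. ennreal (G U * \<bar>F U - a\<bar>) \<partial>?M) =
        (\<Sum>b\<in>B. \<integral>\<^sup>+U. ennreal (L b U) * ennreal \<bar>F U - a\<bar> \<partial>?M) * ennreal (1 / c)"
      by (simp add: nn_integral_multc nn_integral_sum)
    also have "(\<Sum>b\<in>B. \<integral>\<^sup>+U. ennreal (L b U) * ennreal \<bar>F U - a\<bar> \<partial>?M) =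
       (\<Sum>b\<in>B. \<integral>\<^sup>+U. ennreal \<bar>F U - a\<bar> \<partial>(\<Pi>\<^sub>M n\<in>{..<N}. density P (\<lambda>u. ennreal (l b u))))"
      by (intro sum.cong refl) (simp add: dens nn_integral_density)
    finally show ?thesis by (simp add: c_def)
  qed
  let ?X = "(\<integral>\<^sup>+U. ennreal \<bar>F U\<bar> \<partial>?M) + (\<integral>\<^sup>+U. ennreal (G U * \<bar>F U - a\<bar>) \<partial>?M)"
  have "ennreal (2 * a) = (\<integral>\<^sup>+U. ennreal (2 * a) * ennreal (G U) \<partial>?M)"
    by (simp add: nn_integral_cmult G1)
  also have "\<dots> \<le> (\<integral>\<^sup>+U. ennreal \<bar>F U\<bar> + ennreal (G U * \<bar>F U - a\<bar>) + ennreal a * (ennreal ((G U)\<^sup>2) + ennreal (1 / 4)) \<partial>?M)"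
  proof (rule nn_integral_mono)
    fix U
    have "ennreal (2 * a) * ennreal (G U) = ennreal (2 * a * G U)"
      using a Gpos by (simp add: ennreal_mult)
    also have "\<dots> \<le> ennreal (\<bar>F U\<bar> + G U * \<bar>F U - a\<bar> + a * ((G U)\<^sup>2 + 1 / 4))"
      using two_point_pointwise[OF Gpos a] by (rule ennreal_leI)
    also have "\<dots> = ennreal \<bar>F U\<bar> + ennreal (G U * \<bar>F U - a\<bar>) + ennreal a * (ennreal ((G U)\<^sup>2) + ennreal (1 / 4))"
      using a Gpos[of U] by (simp add: ennreal_plus ennreal_mult)
    finally show "ennreal (2 * a) * ennreal (G U) \<le> \<dots>" .
  qed
  also have "\<dots> = ?X + ennreal a * ((\<integral>\<^sup>+U. ennreal ((G U)\<^sup>2) \<partial>?M) + ennreal (1 / 4))"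
    using pp.emeasure_space_1 by (simp add: nn_integral_add nn_integral_cmult)
  also have "\<dots> \<le> ?X + ennreal a * (ennreal (5 / 4) + ennreal (1 / 4))"
    by (intro add_left_mono mult_left_mono add_right_mono G2) simp
  also have "ennreal a * (ennreal (5 / 4) + ennreal (1 / 4)) = ennreal (3 * a / 2)"
    using a by (simp add: ennreal_plus[symmetric] ennreal_mult[symmetric] del: ennreal_plus)
  \<comment> \<open>2 a is split so that the finite term 3 a / 2 can be cancelled in
    \<open>ennreal\<close>.\<close>
  finally have "ennreal (a / 2) + ennreal (3 * a / 2) \<le> ?X + ennreal (3 * a / 2)"
    using a by (simp add: ennreal_plus[symmetric] del: ennreal_plus)
  then have "ennreal (a / 2) \<le> ?X"
    by (simp add: add.commute[of _ "ennreal (3 * a / 2)"] ennreal_add_left_cancel_le)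
  then show ?thesis unfolding mix .
qed

section \<open>Exponential moments over product sets\<close>

text \<open>By convexity the exponential lies below its chord on [0, 2]. An average of exponentials
  is thereby bounded linearly in f, so that only the total of f will matter.\<close>

lemma exp_le_chord:
  fixes x y :: real
  assumes "0 \<le> x" "x \<le> 2"
  shows "exp (y * x) \<le> 1 + (exp (2 * y) - 1) / 2 * x"
proof -
  have "convex_on UNIV (exp :: real \<Rightarrow> real)" by (rule exp_convex)
  then have "exp ((1 - x / 2) *\<^sub>R 0 + (x / 2) *\<^sub>R (2 * y)) \<le> (1 - x / 2) * exp 0 + (x / 2) * exp (2 * y)"
    using assms by (intro convex_onD) auto
  then show ?thesis by (simp add: field_simps)
qed

lemma exp_fifth_le: "exp (1 / 5 :: real) \<le> 5 / 4"
proof -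
  have "1 - 1 / 5 \<le> exp (- (1 / 5 :: real))" using exp_ge_add_one_self[of "- (1 / 5 :: real)"] by simp
  then show ?thesis by (simp add: exp_minus field_simps)
qed

text \<open>The sum factors over the blocks. By the chord bound and 1 + v \<le> exp v, the average
  over a block is at most the exponential of a multiple of the sum of f there, and these sums add up
  in the exponent, where \<open>total\<close> applies. A factor 2 is lost because a block may have
  only w / 2 elements. The constant 1 / 5 is chosen for exp (1 / 5) \<le> 5 / 4.\<close>

lemma product_exp_average:
  fixes f :: "nat \<Rightarrow> real" and w :: real
  assumes A: "\<And>t. t < k \<Longrightarrow> finite (A t) \<and> w / 2 \<le> real (card (A t))" and w: "0 < w"
    and f: "\<And>t l. t < k \<Longrightarrow> l \<in> A t \<Longrightarrow> 0 \<le> f l \<and> f l \<le> 2"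
    and total: "(\<Sum>t<k. \<Sum>l\<in>A t. f l) \<le> 2 * real k" and y: "0 \<le> y"
    and small: "(exp (2 * y) - 1) * (2 * real k) / w \<le> 1 / 5"
  shows "(\<Sum>b\<in>Pi\<^sub>E {..<k} A. \<Prod>t<k. exp (y * f (b t))) \<le> 5 / 4 * real (card (Pi\<^sub>E {..<k} A))"
proof -
  define g where "g = (exp (2 * y) - 1) / 2"
  have g: "0 \<le> g" using y by (simp add: g_def)
  have "(\<Sum>b\<in>Pi\<^sub>E {..<k} A. \<Prod>t<k. exp (y * f (b t))) = (\<Prod>t<k. \<Sum>l\<in>A t. exp (y * f l))"
    using A by (intro prod_sum_PiE[symmetric]) auto
  also have "\<dots> \<le> (\<Prod>t<k. real (card (A t)) * exp (2 * g / w * (\<Sum>l\<in>A t. f l)))"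
  proof (intro prod_mono conjI sum_nonneg)
    fix t assume t: "t \<in> {..<k}"
    let ?s = "\<Sum>l\<in>A t. f l"
    have s: "0 \<le> ?s" using f t by (intro sum_nonneg) auto
    have c: "0 < real (card (A t))" using A[of t] t w by auto
    have "(\<Sum>l\<in>A t. exp (y * f l)) \<le> (\<Sum>l\<in>A t. 1 + g * f l)"
      unfolding g_def using f t by (intro sum_mono exp_le_chord) auto
    also have "\<dots> = real (card (A t)) * (1 + g * ?s / real (card (A t)))"
      using c by (simp add: sum.distrib sum_distrib_left field_simps)
    also have "\<dots> \<le> real (card (A t)) * (1 + 2 * g / w * ?s)"
    proof -
      have "g * ?s / real (card (A t)) \<le> g * ?s / (w / 2)"
        using A[of t] t w g s by (intro divide_left_mono) auto
      then show ?thesis using c by (simp add: mult_ac)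
    qed
    also have "\<dots> \<le> real (card (A t)) * exp (2 * g / w * ?s)"
      by (intro mult_left_mono exp_ge_add_one_self) simp
    finally show "(\<Sum>l\<in>A t. exp (y * f l)) \<le> real (card (A t)) * exp (2 * g / w * ?s)" .
  qed simp
  also have "\<dots> = real (card (Pi\<^sub>E {..<k} A)) * exp (2 * g / w * (\<Sum>t<k. \<Sum>l\<in>A t. f l))"
    by (simp add: prod.distrib exp_sum sum_distrib_left card_PiE)
  also have "\<dots> \<le> real (card (Pi\<^sub>E {..<k} A)) * (5 / 4)"
  proof (intro mult_left_mono)
    have "2 * g / w * (\<Sum>t<k. \<Sum>l\<in>A t. f l) \<le> 2 * g / w * (2 * real k)"
      using total g w by (intro mult_left_mono) auto
    also have "2 * g / w * (2 * real k) = (exp (2 * y) - 1) * (2 * real k) / w" by (simp add: g_def)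
    also have "\<dots> \<le> 1 / 5" by (rule small)
    finally show "exp (2 * g / w * (\<Sum>t<k. \<Sum>l\<in>A t. f l)) \<le> 5 / 4"
      using exp_fifth_le by (meson exp_le_cancel_iff order_trans)
  qed simp
  finally show ?thesis by (simp add: mult.commute)
qed

section \<open>Kernel operators\<close>

lemma prob_space_unit_interval: "prob_space (restrict_space lborel {0..1::real})"
  by (rule prob_spaceI) (simp add: emeasure_restrict_space space_restrict_space)

lemma prob_space_cube: "prob_space (cube d)"
  unfolding cube_def by (rule prob_space_PiM) (rule prob_space_unit_interval)

text \<open>The discriminant condition. Applied to integrals it is a weighted Cauchy-Schwarz
  inequality, free of square roots.\<close>

lemma square_le_of_quadratic_nonneg:
  fixes A B C :: real
  assumes "0 \<le> A" "\<And>s. 0 \<le> s\<^sup>2 * A - 2 * s * B + C"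
  shows "B\<^sup>2 \<le> A * C"
proof (cases "A = 0")
  case True
  have "B = 0"
  proof (rule ccontr)
    assume "B \<noteq> 0"
    \<comment> \<open>With A = 0 this choice of s makes the quadratic equal to - 1.\<close>
    then show False using assms(2)[of "(C + 1) / (2 * B)"] True by simp
  qed
  then show ?thesis using True by simp
next
  case False
  then have A: "0 < A" using assms by simp
  have "0 \<le> (B / A)\<^sup>2 * A - 2 * (B / A) * B + C" by (rule assms(2))
  also have "\<dots> = C - B\<^sup>2 / A" using A by (simp add: field_simps power2_eq_square)
  finally show ?thesis using A by (simp add: field_simps)
qed

text \<open>Schur's test for a symmetric kernel. Cauchy-Schwarz with the weight |k x y| costs one
  row sum \<rho>; after Fubini, symmetry turns the integral over x into a second one.\<close>

lemma op_norm_le_schur: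
  assumes km: "(\<lambda>(x, y). k x y) \<in> borel_measurable (cube d \<Otimes>\<^sub>M cube d)"
    and kb: "\<And>x y. x \<in> space (cube d) \<Longrightarrow> y \<in> space (cube d) \<Longrightarrow> \<bar>k x y\<bar> \<le> K"
    and sym: "\<And>x y. x \<in> space (cube d) \<Longrightarrow> y \<in> space (cube d) \<Longrightarrow> k x y = k y x"
    and row: "\<And>x. x \<in> space (cube d) \<Longrightarrow> (\<integral>y. \<bar>k x y\<bar> \<partial>cube d) \<le> \<rho>" and rho: "0 \<le> \<rho>"
  shows "op_norm d k \<le> ennreal \<rho>"
proof -
  interpret prob_space "cube d" by (rule prob_space_cube)
  interpret pair_sigma_finite "cube d" "cube d" ..
  let ?M = "cube d"
  have kx: "k x \<in> borel_measurable ?M" if "x \<in> space ?M" for x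
    using measurable_Pair2[OF km that] by simp
  have "(AE x in ?M. integrable ?M (\<lambda>y. k x y * \<psi> y)) \<and>
     (\<integral>\<^sup>+x. ennreal ((kernel_op d k \<psi> x)\<^sup>2) \<partial>?M) \<le> ennreal (\<rho>\<^sup>2 * (\<integral>x. (\<psi> x)\<^sup>2 \<partial>?M))"
    if psi: "\<psi> \<in> L2 d" for \<psi>
  proof
    have pm [measurable]: "\<psi> \<in> borel_measurable ?M" and p2: "integrable ?M (\<lambda>x. (\<psi> x)\<^sup>2)"
      using psi by (auto simp: L2_def)
    have i0: "integrable ?M (\<lambda>y. \<bar>k x y\<bar>)" if "x \<in> space ?M" for x
      using kx[OF that] kb[OF that] by (intro integrable_const_bound[where B=K] AE_I2) auto
    have i2: "integrable ?M (\<lambda>y. \<bar>k x y\<bar> * (\<psi> y)\<^sup>2)" if "x \<in> space ?M" for x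
    proof (rule Bochner_Integration.integrable_bound[OF integrable_mult_right[OF p2, of K]])
      show "AE y in ?M. norm (\<bar>k x y\<bar> * (\<psi> y)\<^sup>2) \<le> norm (K * (\<psi> y)\<^sup>2)"
        using kb[OF that] by (intro AE_I2) (auto simp: abs_mult intro!: mult_right_mono order_trans[OF _ abs_ge_self])
    qed (use kx[OF that] in measurable)
    have i1: "integrable ?M (\<lambda>y. k x y * \<psi> y)" if "x \<in> space ?M" for x
    proof (rule Bochner_Integration.integrable_bound[OF Bochner_Integration.integrable_add[OF i0[OF that] i2[OF that]]])
      have "\<bar>k x y\<bar> * \<bar>\<psi> y\<bar> \<le> \<bar>k x y\<bar> * (1 + (\<psi> y)\<^sup>2)" for y
        by (intro mult_left_mono abs_le_one_plus_square) auto
      then show "AE y in ?M. norm (k x y * \<psi> y) \<le> norm (\<bar>k x y\<bar> + \<bar>k x y\<bar> * (\<psi> y)\<^sup>2)"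
        by (intro AE_I2) (auto simp: abs_mult algebra_simps)
    qed (use kx[OF that] in measurable)
    show "AE x in ?M. integrable ?M (\<lambda>y. k x y * \<psi> y)" using i1 by (rule AE_I2)
    \<comment> \<open>The nonnegative quadratic in s is the integral over y of s^2 |k| - 2 s k
      \<psi> + |k| \<psi>^2, whose leading coefficient is the row sum.\<close>
    have pt: "(kernel_op d k \<psi> x)\<^sup>2 \<le> \<rho> * (\<integral>y. \<bar>k x y\<bar> * (\<psi> y)\<^sup>2 \<partial>?M)" if x: "x \<in> space ?M" for x
    proof (rule square_le_of_quadratic_nonneg[OF rho])
      fix s
      have ia: "integrable ?M (\<lambda>y. s\<^sup>2 * \<bar>k x y\<bar> + \<bar>k x y\<bar> * (\<psi> y)\<^sup>2 - 2 * s * (k x y * \<psi> y))"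
        by (intro Bochner_Integration.integrable_diff Bochner_Integration.integrable_add integrable_mult_right
            i0[OF x] i1[OF x] i2[OF x])
      have "0 \<le> (\<integral>y. s\<^sup>2 * \<bar>k x y\<bar> + \<bar>k x y\<bar> * (\<psi> y)\<^sup>2 - 2 * s * (k x y * \<psi> y) \<partial>?M)"
      proof (rule integral_nonneg_AE, rule AE_I2)
        fix y
        have "2 * s * (k x y * \<psi> y) \<le> \<bar>k x y\<bar> * (2 * \<bar>s\<bar> * \<bar>\<psi> y\<bar>)"
          using abs_ge_self[of "2 * s * (k x y * \<psi> y)"] by (simp add: abs_mult mult_ac)
        also have "\<dots> \<le> \<bar>k x y\<bar> * (s\<^sup>2 + (\<psi> y)\<^sup>2)"
          using sum_squares_bound[of "\<bar>s\<bar>" "\<bar>\<psi> y\<bar>"] by (intro mult_left_mono) auto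
        finally show "0 \<le> s\<^sup>2 * \<bar>k x y\<bar> + \<bar>k x y\<bar> * (\<psi> y)\<^sup>2 - 2 * s * (k x y * \<psi> y)"
          by (simp add: algebra_simps)
      qed
      also have "\<dots> = s\<^sup>2 * (\<integral>y. \<bar>k x y\<bar> \<partial>?M) + (\<integral>y. \<bar>k x y\<bar> * (\<psi> y)\<^sup>2 \<partial>?M) - 2 * s * kernel_op d k \<psi> x"
        unfolding kernel_op_def using i0[OF x] i1[OF x] i2[OF x]
        by simp
      also have "\<dots> \<le> s\<^sup>2 * \<rho> + (\<integral>y. \<bar>k x y\<bar> * (\<psi> y)\<^sup>2 \<partial>?M) - 2 * s * kernel_op d k \<psi> x"
        using row[OF x] by (simp add: mult_left_mono)
      finally show "0 \<le> s\<^sup>2 * \<rho> - 2 * s * kernel_op d k \<psi> x + (\<integral>y. \<bar>k x y\<bar> * (\<psi> y)\<^sup>2 \<partial>?M)" by simp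
    qed
    let ?f = "\<lambda>x y. ennreal \<bar>k x y\<bar> * ennreal ((\<psi> y)\<^sup>2)"
    have km' [measurable]: "(\<lambda>(x, y). ?f x y) \<in> borel_measurable (?M \<Otimes>\<^sub>M ?M)"
      using km by measurable
    have "(\<integral>\<^sup>+x. ennreal ((kernel_op d k \<psi> x)\<^sup>2) \<partial>?M) \<le> (\<integral>\<^sup>+x. ennreal \<rho> * (\<integral>\<^sup>+y. ?f x y \<partial>?M) \<partial>?M)"
    proof (rule nn_integral_mono)
      fix x assume x: "x \<in> space ?M"
      have "ennreal ((kernel_op d k \<psi> x)\<^sup>2) \<le> ennreal (\<rho> * (\<integral>y. \<bar>k x y\<bar> * (\<psi> y)\<^sup>2 \<partial>?M))"
        using pt[OF x] by (rule ennreal_leI)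
      also have "\<dots> = ennreal \<rho> * (\<integral>\<^sup>+y. ennreal (\<bar>k x y\<bar> * (\<psi> y)\<^sup>2) \<partial>?M)"
        using rho i2[OF x] by (subst nn_integral_eq_integral) (auto simp: ennreal_mult')
      finally show "ennreal ((kernel_op d k \<psi> x)\<^sup>2) \<le> ennreal \<rho> * (\<integral>\<^sup>+y. ?f x y \<partial>?M)"
        by (simp add: ennreal_mult)
    qed
    also have "\<dots> = ennreal \<rho> * (\<integral>\<^sup>+x. (\<integral>\<^sup>+y. ?f x y \<partial>?M) \<partial>?M)"
      by (rule nn_integral_cmult) measurable
    also have "(\<integral>\<^sup>+x. (\<integral>\<^sup>+y. ?f x y \<partial>?M) \<partial>?M) = (\<integral>\<^sup>+y. (\<integral>\<^sup>+x. ?f x y \<partial>?M) \<partial>?M)"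
      by (rule Fubini'[symmetric]) (rule km')
    also have "\<dots> \<le> (\<integral>\<^sup>+y. ennreal \<rho> * ennreal ((\<psi> y)\<^sup>2) \<partial>?M)"
    proof (rule nn_integral_mono)
      fix y assume y: "y \<in> space ?M"
      have "(\<integral>\<^sup>+x. ?f x y \<partial>?M) = (\<integral>\<^sup>+x. ennreal \<bar>k y x\<bar> * ennreal ((\<psi> y)\<^sup>2) \<partial>?M)"
        using sym y by (intro nn_integral_cong) auto
      also have "\<dots> = (\<integral>\<^sup>+x. ennreal \<bar>k y x\<bar> \<partial>?M) * ennreal ((\<psi> y)\<^sup>2)"
        using kx[OF y] by (intro nn_integral_multc) auto
      also have "\<dots> \<le> ennreal \<rho> * ennreal ((\<psi> y)\<^sup>2)"
      proof (rule mult_right_mono)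
        show "(\<integral>\<^sup>+x. ennreal \<bar>k y x\<bar> \<partial>?M) \<le> ennreal \<rho>"
          using i0[OF y] row[OF y] by (subst nn_integral_eq_integral) (auto intro: ennreal_leI)
      qed simp
      finally show "(\<integral>\<^sup>+x. ?f x y \<partial>?M) \<le> ennreal \<rho> * ennreal ((\<psi> y)\<^sup>2)" .
    qed
    also have "\<dots> = ennreal \<rho> * ennreal (\<integral>y. (\<psi> y)\<^sup>2 \<partial>?M)"
      using p2 by (simp add: nn_integral_cmult nn_integral_eq_integral)
    finally show "(\<integral>\<^sup>+x. ennreal ((kernel_op d k \<psi> x)\<^sup>2) \<partial>?M) \<le> ennreal (\<rho>\<^sup>2 * (\<integral>x. (\<psi> x)\<^sup>2 \<partial>?M))"
      using rho by (simp add: ennreal_mult power2_eq_square mult.assoc mult_left_mono)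
  qed
  then show ?thesis
    unfolding op_norm_def using rho by (intro Inf_lower) auto
qed

text \<open>K will be an estimate of which little more than measurability is known. The loss is
  tested on \<psi>, and Cauchy-Schwarz replaces the square integral by an integral over A; as A has
  at most the volume V, the norms of \<psi> and of the indicator of A contribute sqrt V each. If no
  finite bound exists, the norm is infinite and the claim trivial.\<close>

lemma op_norm_test:
  assumes psi: "\<psi> \<in> L2 d" and V: "(\<integral>x. (\<psi> x)\<^sup>2 \<partial>cube d) = V" "0 < V"
    and A [measurable]: "A \<in> sets (cube d)" "emeasure (cube d) A \<le> ennreal V"
    and C: "\<And>x. x \<in> space (cube d) \<Longrightarrow> integrable (cube d) (\<lambda>y. C x y * \<psi> y)"
    and Km [measurable]: "kernel_op d K \<psi> \<in> borel_measurable (cube d)"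
    and Cm [measurable]: "kernel_op d C \<psi> \<in> borel_measurable (cube d)"
  shows "(\<integral>\<^sup>+x. ennreal \<bar>kernel_op d K \<psi> x - kernel_op d C \<psi> x\<bar> * indicator A x \<partial>cube d)
    \<le> ennreal V * op_norm d (\<lambda>x y. K x y - C x y)"
proof -
  let ?X = "\<integral>\<^sup>+x. ennreal \<bar>kernel_op d K \<psi> x - kernel_op d C \<psi> x\<bar> * indicator A x \<partial>cube d"
  define g where "g x = kernel_op d K \<psi> x - kernel_op d C \<psi> x" for x
  have [measurable]: "g \<in> borel_measurable (cube d)" unfolding g_def[abs_def] by measurable
  have XB: "?X \<le> ennreal (V * B)"
    if B: "0 \<le> B" and int: "AE x in cube d. integrable (cube d) (\<lambda>y. (K x y - C x y) * \<psi> y)"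
      and le: "(\<integral>\<^sup>+x. ennreal ((kernel_op d (\<lambda>x y. K x y - C x y) \<psi> x)\<^sup>2) \<partial>cube d) \<le> ennreal (B\<^sup>2 * V)" for B
  proof -
    \<comment> \<open>A finite bound B comes with integrability for K - C; adding C \<psi> back
      gives it for K, so that the two operators can be separated.\<close>
    have "AE x in cube d. kernel_op d (\<lambda>x y. K x y - C x y) \<psi> x = g x"
      using int AE_space
    proof eventually_elim
      case (elim x)
      have "integrable (cube d) (\<lambda>y. (K x y - C x y) * \<psi> y + C x y * \<psi> y)"
        using elim C by (intro Bochner_Integration.integrable_add) auto
      then have "integrable (cube d) (\<lambda>y. K x y * \<psi> y)" by (simp add: algebra_simps)
      then show ?case using C[OF elim(2)] by (simp add: kernel_op_def g_def left_diff_distrib)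
    qed
    then have "(\<integral>\<^sup>+x. ennreal ((g x)\<^sup>2) \<partial>cube d) =
        (\<integral>\<^sup>+x. ennreal ((kernel_op d (\<lambda>x y. K x y - C x y) \<psi> x)\<^sup>2) \<partial>cube d)"
      by (intro nn_integral_cong_AE) auto
    then have g2: "(\<integral>\<^sup>+x. ennreal ((g x)\<^sup>2) \<partial>cube d) \<le> ennreal (B\<^sup>2 * V)" using le by simp
    \<comment> \<open>Cauchy-Schwarz in the form |g| \<le> g^2 / (2 s) + s / 2. B itself may be 0,
      hence s > B here and a limit at the end.\<close>
    have s: "?X \<le> ennreal (s * V)" if sB: "B < s" for s
    proof -
      have s0: "0 < s" using B sB by simp
      have "?X \<le> (\<integral>\<^sup>+x. ennreal (1 / (2 * s)) * ennreal ((g x)\<^sup>2) + ennreal (s / 2) * indicator A x \<partial>cube d)"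
      proof (rule nn_integral_mono)
        fix x
        have "2 * s * \<bar>g x\<bar> \<le> \<bar>g x\<bar>\<^sup>2 + s\<^sup>2" using sum_squares_bound[of s "\<bar>g x\<bar>"] by simp
        then have "\<bar>g x\<bar> \<le> 1 / (2 * s) * (g x)\<^sup>2 + s / 2"
          using s0 by (simp add: field_simps power2_eq_square)
        then have "ennreal \<bar>g x\<bar> \<le> ennreal (1 / (2 * s) * (g x)\<^sup>2 + s / 2)" by (rule ennreal_leI)
        also have "\<dots> = ennreal (1 / (2 * s)) * ennreal ((g x)\<^sup>2) + ennreal (s / 2)"
          using s0 by (subst ennreal_plus) (simp_all add: ennreal_mult'[symmetric])
        finally show "ennreal \<bar>kernel_op d K \<psi> x - kernel_op d C \<psi> x\<bar> * indicator A x
            \<le> ennreal (1 / (2 * s)) * ennreal ((g x)\<^sup>2) + ennreal (s / 2) * indicator A x"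
          by (auto simp: g_def[symmetric] split: split_indicator)
      qed
      also have "\<dots> = ennreal (1 / (2 * s)) * (\<integral>\<^sup>+x. ennreal ((g x)\<^sup>2) \<partial>cube d) + ennreal (s / 2) * emeasure (cube d) A"
        by (simp add: nn_integral_add nn_integral_cmult)
      also have "\<dots> \<le> ennreal (1 / (2 * s)) * ennreal (B\<^sup>2 * V) + ennreal (s / 2) * ennreal V"
        by (intro add_mono mult_left_mono g2 A(2)) auto
      also have "\<dots> = ennreal (1 / (2 * s) * (B\<^sup>2 * V) + s / 2 * V)"
        using s0 V by (simp add: ennreal_mult'[symmetric] ennreal_plus[symmetric] del: ennreal_plus)
      also have "\<dots> \<le> ennreal (s * V)"
      proof (rule ennreal_leI)
        have "B\<^sup>2 \<le> s\<^sup>2" using B sB by (intro power_mono) auto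
        then have "1 / (2 * s) * (B\<^sup>2 * V) \<le> 1 / (2 * s) * (s\<^sup>2 * V)"
          using s0 V by (intro mult_left_mono mult_right_mono) auto
        then show "1 / (2 * s) * (B\<^sup>2 * V) + s / 2 * V \<le> s * V"
          using s0 by (simp add: power2_eq_square)
      qed
      finally show ?thesis .
    qed
    show ?thesis
    proof (rule ennreal_le_epsilon)
      fix e :: real assume e: "0 < e"
      have "?X \<le> ennreal ((B + e / V) * V)" using e V by (intro s) simp
      also have "(B + e / V) * V = V * B + e" using V by (simp add: field_simps)
      finally show "?X \<le> ennreal (V * B) + ennreal e"
        using B V e by simp
    qed
  qed
  have "?X / ennreal V \<le> op_norm d (\<lambda>x y. K x y - C x y)"
    unfolding op_norm_def
  proof (rule Inf_greatest)
    fix b assume "b \<in> {ennreal B | B. 0 \<le> B \<and> (\<forall>\<psi>\<in>L2 d.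
        (AE x in cube d. integrable (cube d) (\<lambda>y. (K x y - C x y) * \<psi> y)) \<and>
        (\<integral>\<^sup>+x. ennreal ((kernel_op d (\<lambda>x y. K x y - C x y) \<psi> x)\<^sup>2) \<partial>cube d)
          \<le> ennreal (B\<^sup>2 * (\<integral>x. (\<psi> x)\<^sup>2 \<partial>cube d)))}"
    then obtain B where "b = ennreal B" "0 \<le> B" "?X \<le> ennreal (V * B)"
      using XB psi V by auto
    then show "?X / ennreal V \<le> b"
      using V by (intro divide_le_posI_ennreal) (auto simp: ennreal_mult mult.commute)
  qed
  then have "ennreal V * (?X / ennreal V) \<le> ennreal V * op_norm d (\<lambda>x y. K x y - C x y)"
    by (intro mult_left_mono) auto
  moreover have "ennreal V * (?X / ennreal V) = ?X"
    using V by (simp add: ennreal_times_divide mult.commute[of "ennreal V"] mult_divide_eq_ennreal)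
  ultimately show ?thesis by simp
qed

lemma op_norm_ge_test:
  assumes psi: "\<psi> \<in> L2 d" and V: "0 < (\<integral>x. (\<psi> x)\<^sup>2 \<partial>cube d)" and b: "0 \<le> b"
    and le: "ennreal (b\<^sup>2 * (\<integral>x. (\<psi> x)\<^sup>2 \<partial>cube d)) \<le> (\<integral>\<^sup>+x. ennreal ((kernel_op d k \<psi> x)\<^sup>2) \<partial>cube d)"
  shows "ennreal b \<le> op_norm d k"
  unfolding op_norm_def
proof (rule Inf_greatest, clarify)
  fix B :: real assume B: "0 \<le> B"
    and *: "\<forall>\<psi>\<in>L2 d. (AE x in cube d. integrable (cube d) (\<lambda>y. k x y * \<psi> y)) \<and>
        (\<integral>\<^sup>+x. ennreal ((kernel_op d k \<psi> x)\<^sup>2) \<partial>cube d) \<le> ennreal (B\<^sup>2 * (\<integral>x. (\<psi> x)\<^sup>2 \<partial>cube d))"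
  have "ennreal (b\<^sup>2 * (\<integral>x. (\<psi> x)\<^sup>2 \<partial>cube d)) \<le> ennreal (B\<^sup>2 * (\<integral>x. (\<psi> x)\<^sup>2 \<partial>cube d))"
    using le * psi by (meson order_trans)
  then have "b\<^sup>2 \<le> B\<^sup>2" using V by (subst (asm) ennreal_le_iff) auto
  then have "b \<le> B" using B by (rule power2_le_imp_le)
  then show "ennreal b \<le> ennreal B" by (rule ennreal_leI)
qed

lemma cov_measurable:
  assumes "gaussian_process d P"
  shows "(\<lambda>(x, y). cov P x y) \<in> borel_measurable (cube d \<Otimes>\<^sub>M cube d)"
proof -
  interpret prob_space P using assms by (simp add: gaussian_process_def)
  have [measurable]: "(\<lambda>p. fst p (snd p)) \<in> borel_measurable (P \<Otimes>\<^sub>M cube d)"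
    using assms by (simp add: gaussian_process_def case_prod_beta')
  have 1: "(\<lambda>q. (snd q, fst (fst q))) \<in> (cube d \<Otimes>\<^sub>M cube d) \<Otimes>\<^sub>M P \<rightarrow>\<^sub>M P \<Otimes>\<^sub>M cube d"
    and 2: "(\<lambda>q. (snd q, snd (fst q))) \<in> (cube d \<Otimes>\<^sub>M cube d) \<Otimes>\<^sub>M P \<rightarrow>\<^sub>M P \<Otimes>\<^sub>M cube d"
    by measurable
  have "(\<lambda>q. snd q (fst (fst q)) * snd q (snd (fst q))) \<in> borel_measurable ((cube d \<Otimes>\<^sub>M cube d) \<Otimes>\<^sub>M P)"
    using measurable_compose[OF 1, of "\<lambda>p. fst p (snd p)" borel] measurable_compose[OF 2, of "\<lambda>p. fst p (snd p)" borel]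
    by (intro borel_measurable_times) simp_all
  then have "(\<lambda>p. \<integral>u. u (fst p) * u (snd p) \<partial>P) \<in> borel_measurable (cube d \<Otimes>\<^sub>M cube d)"
    by (intro borel_measurable_lebesgue_integral) (simp add: case_prod_beta')
  then show ?thesis by (simp add: cov_def case_prod_beta')
qed

text \<open>The interpolation of |k| between |k|^q and \<open>sup_norm\<close> to the power 1 - q,
  inserted in Schur's test, bounds the operator norm by the numerator. A nonempty class thus has
  \<Gamma>1 \<ge> 1, which leaves room for the diagonal of the constructed kernels.\<close>

lemma sparsity_ge_one:
  assumes reg: "regular_process d P" and q: "0 \<le> q" "q \<le> 1"
  shows "1 \<le> sparsity d q P"
proof -
  interpret prob_space "cube d" by (rule prob_space_cube)
  let ?k = "cov P" and ?S = "sup_norm d (cov P)" and ?M = "cube d"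
  have gp: "gaussian_process d P" and nz: "op_norm d ?k \<noteq> 0" using reg by (auto simp: regular_process_def)
  obtain B where B: "\<And>x y. x \<in> space ?M \<Longrightarrow> y \<in> space ?M \<Longrightarrow> \<bar>?k x y\<bar> \<le> B"
    using reg by (auto simp: regular_process_def)
  note km = cov_measurable[OF gp]
  have kx [measurable]: "?k x \<in> borel_measurable ?M" if "x \<in> space ?M" for x
    using measurable_Pair2[OF km that] by simp
  obtain x0 where x0: "x0 \<in> space ?M" using not_empty by auto
  have B0: "0 \<le> B" using B[OF x0 x0] by simp
  have bdd: "bdd_above ((\<lambda>(x, y). \<bar>?k x y\<bar>) ` (space ?M \<times> space ?M))"
    using B by (intro bdd_aboveI[of _ B]) auto
  have kS: "\<bar>?k x y\<bar> \<le> ?S" if "x \<in> space ?M" "y \<in> space ?M" for x y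
    unfolding sup_norm_def using cSUP_upper[OF _ bdd, of "(x, y)"] that by auto
  have S0: "0 \<le> ?S" using kS[OF x0 x0] by simp
  have iq: "integrable ?M (\<lambda>y. \<bar>?k x y\<bar> powr q)" if "x \<in> space ?M" for x
    using kx[OF that] B[OF that] q
    by (intro integrable_const_bound[where B="B powr q"] AE_I2) (auto intro!: powr_mono2)
  have i1: "integrable ?M (\<lambda>y. \<bar>?k x y\<bar>)" if "x \<in> space ?M" for x
    using kx[OF that] B[OF that] by (intro integrable_const_bound[where B=B] AE_I2) auto
  have iqB: "(\<integral>y. \<bar>?k x y\<bar> powr q \<partial>?M) \<le> B powr q" if "x \<in> space ?M" for x
  proof -
    have "(\<integral>y. \<bar>?k x y\<bar> powr q \<partial>?M) \<le> (\<integral>y. B powr q \<partial>?M)"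
      using iq[OF that] B[OF that] q by (intro integral_mono) (auto intro!: powr_mono2)
    then show ?thesis by (simp add: prob_space)
  qed
  have qn: "(\<integral>y. \<bar>?k x y\<bar> powr q \<partial>?M) \<le> q_norm_q d q ?k" if "x \<in> space ?M" for x
    unfolding q_norm_q_def using iqB that by (intro cSUP_upper bdd_aboveI[of _ "B powr q"]) auto
  have q0: "0 \<le> q_norm_q d q ?k"
    by (rule order_trans[OF _ qn[OF x0]]) simp
  let ?r = "q_norm_q d q ?k * ?S powr (1 - q)"
  have pt: "\<bar>?k x y\<bar> \<le> \<bar>?k x y\<bar> powr q * ?S powr (1 - q)" if "x \<in> space ?M" "y \<in> space ?M" for x y
  proof (cases "?k x y = 0")
    case False
    have "\<bar>?k x y\<bar> = \<bar>?k x y\<bar> powr (q + (1 - q))" using False by simp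
    also have "\<dots> = \<bar>?k x y\<bar> powr q * \<bar>?k x y\<bar> powr (1 - q)" by (rule powr_add)
    also have "\<dots> \<le> \<bar>?k x y\<bar> powr q * ?S powr (1 - q)"
      using kS[OF that] q by (intro mult_left_mono powr_mono2) auto
    finally show ?thesis .
  qed simp
  have "op_norm d ?k \<le> ennreal ?r"
  proof (rule op_norm_le_schur[OF km])
    fix x assume x: "x \<in> space ?M"
    have "(\<integral>y. \<bar>?k x y\<bar> \<partial>?M) \<le> (\<integral>y. \<bar>?k x y\<bar> powr q * ?S powr (1 - q) \<partial>?M)"
      using i1[OF x] iq[OF x] pt[OF x] by (intro integral_mono) auto
    also have "\<dots> \<le> ?r" using qn[OF x] by (simp add: mult_right_mono)
    finally show "(\<integral>y. \<bar>?k x y\<bar> \<partial>?M) \<le> ?r" .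
  qed (use B q0 in \<open>auto simp: cov_def mult.commute\<close>)
  moreover have "0 \<le> ?r" using q0 by simp
  ultimately obtain p where p: "op_norm d ?k = ennreal p" "0 \<le> p" "p \<le> ?r"
    by (cases "op_norm d ?k") (auto simp: top_unique)
  then have "0 < p" using nz by (cases "p = 0") auto
  then show ?thesis using p by (simp add: sparsity_def)
qed

section \<open>Step processes on the cube\<close>

text \<open>The wide last cell stays uncorrelated with the others. It fixes the operator norm and the largest row sum of the
  kernel, so correlations between the other cells do not increase the sparsity.\<close>

definition cell :: "nat \<Rightarrow> point \<Rightarrow> nat" where
  "cell n x = min n (nat \<lfloor>real (n + 3) * x 0\<rfloor>)"

text \<open>In units of a narrow cell the row sums of |k| are at most 1 + 2 k \<epsilon> \<le> 3 for
  the kernels below, so a last cell of width 3 still has the largest one.\<close>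

definition cell_width :: "nat \<Rightarrow> nat \<Rightarrow> real" where
  "cell_width n c = (if c < n then 1 else 3) / real (n + 3)"

definition cell_point :: "nat \<Rightarrow> nat \<Rightarrow> nat \<Rightarrow> point" where
  "cell_point d n c = (\<lambda>i\<in>{..<d}. real c / real (n + 3))"

lemma space_cube: "space (cube d) = (\<Pi>\<^sub>E i\<in>{..<d}. {0..1})"
  by (simp add: cube_def space_PiM space_restrict_space)

lemma cell_le: "cell n x \<le> n"
  by (simp add: cell_def)

lemma cell_point:
  assumes "1 \<le> d" "c \<le> n"
  shows "cell_point d n c \<in> space (cube d)" "cell n (cell_point d n c) = c"
  using assms by (auto simp: cell_point_def space_cube cell_def)

lemma cell_measurable [measurable]:
  assumes "1 \<le> d"
  shows "cell n \<in> cube d \<rightarrow>\<^sub>M count_space UNIV"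
proof -
  have [measurable]: "(\<lambda>x. x 0) \<in> borel_measurable (cube d)"
  proof -
    have "(\<lambda>x. x 0) \<in> cube d \<rightarrow>\<^sub>M restrict_space lborel {0..1::real}"
      unfolding cube_def using assms by (intro measurable_component_singleton) auto
    then show ?thesis by (simp add: measurable_restrict_space2_iff)
  qed
  show ?thesis unfolding cell_def[abs_def] by measurable
qed

lemma emeasure_cell:
  assumes d: "1 \<le> d" and c: "c \<le> n"
  shows "emeasure (cube d) {x \<in> space (cube d). cell n x = c} = ennreal (cell_width n c)"
proof -
  interpret product_prob_space "\<lambda>_::nat. restrict_space lborel {0..1::real}" "{..<d}"
    by (intro product_prob_spaceI prob_space_unit_interval)
  define w where "w = real (n + 3)"
  have w: "0 < w" by (simp add: w_def)
  \<comment> \<open>The narrow cells are half-open; the last one is closed, as the minimum in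
    \<open>cell\<close> also absorbs x 0 = 1.\<close>
  define T where "T = (if c < n then {real c / w..<(real c + 1) / w} else {real n / w..1})"
  have "0 \<le> real c / w" "0 \<le> real n / w" using w by auto
  moreover have "(real c + 1) / w \<le> 1" using c w by (simp add: divide_le_eq w_def)
  ultimately have T: "T \<subseteq> {0..1}" "T \<in> sets borel"
    by (auto simp: T_def)
  have iff: "cell n x = c \<longleftrightarrow> x 0 \<in> T" if x: "x \<in> space (cube d)" for x
  proof -
    have x0: "0 \<le> x 0" "x 0 \<le> 1" using x d by (auto simp: space_cube PiE_iff)
    have fl: "0 \<le> \<lfloor>w * x 0\<rfloor>" using x0 w by simp
    show ?thesis
    proof (cases "c < n")
      case True
      then have "cell n x = c \<longleftrightarrow> \<lfloor>w * x 0\<rfloor> = int c" using fl by (auto simp: cell_def w_def min_def)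
      also have "\<dots> \<longleftrightarrow> real c \<le> w * x 0 \<and> w * x 0 < real c + 1" by (auto simp: floor_eq_iff)
      also have "\<dots> \<longleftrightarrow> x 0 \<in> T" using True w by (auto simp: T_def field_simps)
      finally show ?thesis .
    next
      case False
      then have "c = n" using c by simp
      then have "cell n x = c \<longleftrightarrow> n \<le> nat \<lfloor>w * x 0\<rfloor>" by (auto simp: cell_def w_def min_def)
      also have "\<dots> \<longleftrightarrow> int n \<le> \<lfloor>w * x 0\<rfloor>" using fl by (simp add: le_nat_iff)
      also have "\<dots> \<longleftrightarrow> real n \<le> w * x 0" by (simp add: le_floor_iff)
      also have "\<dots> \<longleftrightarrow> x 0 \<in> T" using \<open>c = n\<close> w x0 by (auto simp: T_def field_simps)
      finally show ?thesis .
    qed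
  qed
  have "emeasure (cube d) {x \<in> space (cube d). cell n x = c} =
      emeasure (cube d) ((\<lambda>x. x 0) -` T \<inter> space (cube d))"
    using iff by (intro arg_cong2[where f=emeasure]) auto
  also have "\<dots> = emeasure (distr (cube d) (restrict_space lborel {0..1}) (\<lambda>x. x 0)) T"
    using d T unfolding cube_def
    by (subst emeasure_distr) (auto simp: sets_restrict_space_iff intro!: measurable_component_singleton)
  also have "\<dots> = emeasure (restrict_space lborel {0..1}) T"
    using d unfolding cube_def by (subst PiM_component) auto
  also have "\<dots> = emeasure lborel T" using T by (simp add: emeasure_restrict_space)
  also have "\<dots> = ennreal (cell_width n c)"
    using c w by (auto simp: T_def cell_width_def w_def[symmetric] divide_right_mono diff_divide_distrib[symmetric])
      (auto simp: w_def field_simps)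
  finally show ?thesis .
qed

lemma cell_width_pos: "0 < cell_width n c"
  by (simp add: cell_width_def)

lemma cell_integral:
  fixes f :: "nat \<Rightarrow> real"
  assumes d: "1 \<le> d"
  shows "has_bochner_integral (cube d) (\<lambda>x. f (cell n x)) (\<Sum>c\<le>n. f c * cell_width n c)"
proof -
  let ?A = "\<lambda>c. {x \<in> space (cube d). cell n x = c}"
  have [measurable]: "?A c \<in> sets (cube d)" for c
    using cell_measurable[OF d] by measurable
  have "has_bochner_integral (cube d) (\<lambda>x. \<Sum>c\<le>n. f c * indicator (?A c) x) (\<Sum>c\<le>n. f c * cell_width n c)"
  proof (intro has_bochner_integral_sum has_bochner_integral_mult_right)
    fix c assume "c \<in> {..n}"
    then have e: "emeasure (cube d) (?A c) = ennreal (cell_width n c)" using emeasure_cell[OF d] by simp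
    then have "measure (cube d) (?A c) = cell_width n c"
      using cell_width_pos[of n c] by (simp add: measure_def)
    then show "has_bochner_integral (cube d) (indicator (?A c)) (cell_width n c)"
      using e has_bochner_integral_real_indicator[of "?A c" "cube d"] by simp
  qed
  moreover have "(\<Sum>c\<le>n. f c * indicator (?A c) x) = f (cell n x)" if "x \<in> space (cube d)" for x
  proof -
    have "(\<Sum>c\<le>n. f c * indicator (?A c) x) = (\<Sum>c\<le>n. if c = cell n x then f c else 0)"
      using that by (intro sum.cong) (auto split: split_indicator)
    then show ?thesis using cell_le by simp
  qed
  ultimately show ?thesis
    by (subst has_bochner_integral_cong[OF refl _ refl, where g="\<lambda>x. \<Sum>c\<le>n. f c * indicator (?A c) x"]) auto
qed

lemma cell_integral_eq: "1 \<le> d \<Longrightarrow> (\<integral>x. f (cell n x) \<partial>cube d) = (\<Sum>c\<le>n. f c * cell_width n c)"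
  for f :: "nat \<Rightarrow> real"
  using cell_integral by (simp add: has_bochner_integral_iff)

section \<open>Gaussian processes constant on the cells\<close>

definition step_path :: "nat \<Rightarrow> nat \<Rightarrow> (nat \<Rightarrow> real) \<Rightarrow> path" where
  "step_path d n z = (\<lambda>x\<in>space (cube d). z (cell n x))"

text \<open>Restricting the product sigma-algebra to step paths makes evaluation jointly measurable
  in path and point, because such a path is determined by its values at the finitely many cell
  points.\<close>

definition step_space :: "nat \<Rightarrow> nat \<Rightarrow> path measure" where
  "step_space d n = restrict_space (\<Pi>\<^sub>M x\<in>space (cube d). borel) (range (step_path d n))"

definition step_process :: "nat \<Rightarrow> nat \<Rightarrow> (nat \<Rightarrow> nat \<Rightarrow> real) \<Rightarrow> path measure" where
  "step_process d n S = distr (gauss_cov {..n} S) (step_space d n) (step_path d n)"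

lemma space_step_space: "space (step_space d n) = range (step_path d n)"
  by (auto simp: step_space_def space_restrict_space space_PiM step_path_def)

lemma space_step_process [simp]: "space (step_process d n S) = range (step_path d n)"
  by (simp add: step_process_def space_step_space)

lemma sets_step_process [simp, measurable_cong]: "sets (step_process d n S) = sets (step_space d n)"
  by (simp add: step_process_def)

lemma step_path_cell_point: "1 \<le> d \<Longrightarrow> c \<le> n \<Longrightarrow> step_path d n z (cell_point d n c) = z c"
  by (simp add: step_path_def cell_point)

lemma step_path_measurable:
  assumes d: "1 \<le> d"
  shows "step_path d n \<in> (\<Pi>\<^sub>M i\<in>{..n}. lborel) \<rightarrow>\<^sub>M step_space d n"
  unfolding step_space_def
proof (rule measurable_restrict_space2)
  show "step_path d n \<in> (\<Pi>\<^sub>M i\<in>{..n}. lborel) \<rightarrow>\<^sub>M (\<Pi>\<^sub>M x\<in>space (cube d). borel)"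
    unfolding step_path_def[abs_def]
  proof (rule measurable_restrict)
    fix x
    have "(\<lambda>z. z (cell n x)) \<in> (\<Pi>\<^sub>M i\<in>{..n}. lborel) \<rightarrow>\<^sub>M (lborel :: real measure)"
      by (rule measurable_component_singleton) (simp add: cell_le)
    then show "(\<lambda>z. z (cell n x)) \<in> (\<Pi>\<^sub>M i\<in>{..n}. lborel) \<rightarrow>\<^sub>M (borel :: real measure)" by simp
  qed
qed auto

lemma step_eval_measurable:
  assumes "x \<in> space (cube d)"
  shows "(\<lambda>u. u x) \<in> borel_measurable (step_space d n)"
  unfolding step_space_def
  by (rule measurable_restrict_space1, rule measurable_component_singleton[OF assms])

lemma step_joint_measurable:
  assumes d: "1 \<le> d" and s: "sets P = sets (step_space d n)"
  shows "(\<lambda>(u, x). u x) \<in> borel_measurable (P \<Otimes>\<^sub>M cube d)"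
proof -
  note [measurable] = cell_measurable[OF d]
  have sp: "space P = range (step_path d n)"
    using sets_eq_imp_space_eq[OF s] by (simp add: space_step_space)
  have [measurable]: "(\<lambda>u. u (cell_point d n c)) \<in> borel_measurable P" if "c \<le> n" for c
    using step_eval_measurable[OF cell_point(1)[OF d that], of n] measurable_cong_sets[OF s refl] by blast
  have "(\<lambda>(u, x). \<Sum>c\<le>n. of_bool (cell n x = c) * u (cell_point d n c)) \<in> borel_measurable (P \<Otimes>\<^sub>M cube d)"
    unfolding case_prod_beta' by measurable
  moreover have "(\<Sum>c\<le>n. of_bool (cell n x = c) * u (cell_point d n c)) = u x"
    if uP: "u \<in> space P" and xC: "x \<in> space (cube d)" for u x
  proof -
    obtain z where u: "u = step_path d n z" using uP unfolding sp by blast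
    have "(\<Sum>c\<le>n. of_bool (cell n x = c) * u (cell_point d n c)) = (\<Sum>c\<le>n. if cell n x = c then z c else 0)"
      unfolding u using d by (intro sum.cong) (auto simp: step_path_cell_point)
    also have "\<dots> = u x" using cell_le xC by (simp add: u step_path_def)
    finally show ?thesis .
  qed
  ultimately show ?thesis
    by (subst measurable_cong[where g="\<lambda>(u, x). \<Sum>c\<le>n. of_bool (cell n x = c) * u (cell_point d n c)"])
      (auto simp: space_pair_measure)
qed

lemma unit_vec_bform: "finite I \<Longrightarrow> i \<in> I \<Longrightarrow> j \<in> I \<Longrightarrow> bform I S (unit_vec i) (unit_vec j) = S i j"
  by (simp add: bform_def dot_unit_vec mv_unit_vec)

context
  fixes n :: nat and S Q :: "nat \<Rightarrow> nat \<Rightarrow> real"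
  assumes gp: "gpair {..n} Q S"
begin

lemma gauss_cov_prob_space: "prob_space (gauss_cov {..n} S)"
  using gauss_prob_space[OF gp] gauss_cov_eq[OF gp] by simp

lemma sets_gauss_cov: "sets (gauss_cov {..n} S) = sets (\<Pi>\<^sub>M i\<in>{..n}. lborel)"
  by (simp add: gauss_cov_eq[OF gp])

text \<open>Polarisation of \<open>gauss_dot_square\<close>.\<close>

lemma gauss_cov_cov:
  assumes "i \<le> n" "j \<le> n"
  shows "has_bochner_integral (gauss_cov {..n} S) (\<lambda>z. z i * z j) (S i j)"
proof -
  let ?I = "{..n}" and ?G = "gauss {..n} Q"
  have symS: "sym_on ?I S" using gp by (auto simp: gpair_def inv_on_def)
  let ?a = "\<lambda>l. unit_vec i l + unit_vec j l"
  have bf: "bform ?I S ?a ?a = S i i + 2 * S i j + S j j"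
    using assms symS by (simp add: bform_add_right bform_add_left[OF symS] unit_vec_bform sym_on_def)
  have da: "dot ?I ?a z = z i + z j" for z
    using assms by (simp add: dot_commute[of _ ?a] dot_add_right dot_commute[of _ z] dot_unit_vec)
  have "has_bochner_integral ?G (\<lambda>z. ((dot ?I ?a z)\<^sup>2 - (dot ?I (unit_vec i) z)\<^sup>2 - (dot ?I (unit_vec j) z)\<^sup>2) / 2)
      ((bform ?I S ?a ?a - bform ?I S (unit_vec i) (unit_vec i) - bform ?I S (unit_vec j) (unit_vec j)) / 2)"
    by (intro has_bochner_integral_divide has_bochner_integral_diff gauss_dot_square[OF gp])
  moreover have "((dot ?I ?a z)\<^sup>2 - (dot ?I (unit_vec i) z)\<^sup>2 - (dot ?I (unit_vec j) z)\<^sup>2) / 2 = z i * z j" for z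
    using assms by (simp add: da dot_unit_vec power2_eq_square algebra_simps)
  ultimately show ?thesis using assms by (simp add: gauss_cov_eq[OF gp] bf unit_vec_bform)
qed

end

context
  fixes d n :: nat and S Q :: "nat \<Rightarrow> nat \<Rightarrow> real"
  assumes d: "1 \<le> d" and gp: "gpair {..n} Q S"
begin

lemma step_path_measurable': "step_path d n \<in> gauss_cov {..n} S \<rightarrow>\<^sub>M step_space d n"
  using step_path_measurable[OF d, of n] measurable_cong_sets[OF sets_gauss_cov[OF gp] refl] by blast

lemma step_process_prob_space: "prob_space (step_process d n S)"
  unfolding step_process_def by (rule prob_space.prob_space_distr[OF gauss_cov_prob_space[OF gp] step_path_measurable'])

lemma cov_step_process:
  assumes "x \<in> space (cube d)" "y \<in> space (cube d)"
  shows "cov (step_process d n S) x y = S (cell n x) (cell n y)"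
proof -
  have "cov (step_process d n S) x y = (\<integral>z. step_path d n z x * step_path d n z y \<partial>gauss_cov {..n} S)"
    unfolding cov_def step_process_def
    by (intro integral_distr step_path_measurable' borel_measurable_times step_eval_measurable assms)
  also have "\<dots> = S (cell n x) (cell n y)"
    using gauss_cov_cov[OF gp cell_le cell_le, of x y] assms by (simp add: step_path_def has_bochner_integral_iff)
  finally show ?thesis .
qed

lemma gaussian_step_process: "gaussian_process d (step_process d n S)"
  unfolding gaussian_process_def
proof (intro conjI allI impI)
  show "prob_space (step_process d n S)" by (rule step_process_prob_space)
  show "space (step_process d n S) \<subseteq> extensional (space (cube d))" by (auto simp: step_path_def)
  show "(\<lambda>(u, x). u x) \<in> borel_measurable (step_process d n S \<Otimes>\<^sub>M cube d)"
    by (rule step_joint_measurable[OF d]) simp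
  fix J :: "point set" and a :: "point \<Rightarrow> real" assume J: "finite J" "J \<subseteq> space (cube d)"
  \<comment> \<open>A linear combination of values of a step path is one of cell values: the
    coefficients of the points in a common cell are added up.\<close>
  define b where "b c = (\<Sum>x\<in>{x\<in>J. cell n x = c}. a x)" for c
  have eq: "(\<Sum>x\<in>J. a x * step_path d n z x) = dot {..n} b z" for z
  proof -
    have "(\<Sum>x\<in>J. a x * step_path d n z x) = (\<Sum>x\<in>J. a x * z (cell n x))"
      using J by (intro sum.cong) (auto simp: step_path_def)
    also have "\<dots> = (\<Sum>c\<le>n. \<Sum>x\<in>{x\<in>J. cell n x = c}. a x * z (cell n x))"
      using J cell_le by (intro sum.group[symmetric]) auto
    also have "\<dots> = (\<Sum>c\<le>n. b c * z c)"
      unfolding b_def sum_distrib_right by (intro sum.cong refl) auto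
    finally show ?thesis by (simp add: dot_def)
  qed
  let ?X = "\<lambda>u. \<Sum>x\<in>J. a x * u x"
  have Xm: "?X \<in> borel_measurable (step_space d n)"
    using J by (intro borel_measurable_sum borel_measurable_times step_eval_measurable) auto
  show "centered_normal (step_process d n S) ?X"
    unfolding centered_normal_def
  proof (intro conjI)
    show "?X \<in> borel_measurable (step_process d n S)"
      using Xm measurable_cong_sets[OF sets_step_process refl] by blast
    show "(AE u in step_process d n S. ?X u = 0) \<or>
      (\<exists>\<sigma>>0. distributed (step_process d n S) lborel ?X (\<lambda>x. ennreal (normal_density 0 \<sigma> x)))"
      using gauss_bform_cases[OF gp, of b]
    proof
      assume s: "0 < bform {..n} S b b"
      have "distr (step_process d n S) lborel ?X = distr (gauss_cov {..n} S) lborel (?X \<circ> step_path d n)"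
        unfolding step_process_def using Xm by (intro distr_distr step_path_measurable') simp
      also have "?X \<circ> step_path d n = dot {..n} b" by (auto simp: eq)
      also have "distr (gauss_cov {..n} S) lborel (dot {..n} b) =
          density lborel (\<lambda>x. ennreal (normal_density 0 (sqrt (bform {..n} S b b)) x))"
        using gauss_dot_distributed[OF gp s] by (simp add: gauss_cov_eq[OF gp] distributed_def)
      finally have "distributed (step_process d n S) lborel ?X
          (\<lambda>x. ennreal (normal_density 0 (sqrt (bform {..n} S b b)) x))"
        using Xm measurable_cong_sets[OF sets_step_process refl] by (simp add: distributed_def)
      then show ?thesis using s by (intro disjI2 exI[of _ "sqrt (bform {..n} S b b)"]) simp
    next
      assume "bform {..n} S b b = 0 \<and> (AE z in gauss {..n} Q. dot {..n} b z = 0)"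
      then have "AE z in gauss_cov {..n} S. ?X (step_path d n z) = 0"
        unfolding gauss_cov_eq[OF gp] eq by blast
      then have "AE u in step_process d n S. ?X u = 0"
        unfolding step_process_def using Xm by (subst AE_distr_iff[OF step_path_measurable']) auto
      then show ?thesis ..
    qed
  qed
qed

lemma path_sup_step: "path_sup d (step_path d n z) = Max (z ` {..n})"
proof -
  have "step_path d n z ` space (cube d) = z ` {..n}"
  proof -
    have "cell n ` space (cube d) = {..n}"
      using cell_point[OF d, of _ n] cell_le by (auto intro!: image_eqI[of _ _ "cell_point d n _"] simp: image_iff)
    then show ?thesis by (auto simp: step_path_def image_iff) (metis atMost_iff cell_point d)
  qed
  then show ?thesis by (simp add: path_sup_def cSup_eq_Max)
qed

lemma bdd_above_step: "AE u in step_process d n S. bdd_above (u ` space (cube d))"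
proof (rule AE_I2)
  fix u assume "u \<in> space (step_process d n S)"
  then obtain z where "u = step_path d n z" by auto
  then have "u ` space (cube d) \<subseteq> z ` {..n}" using cell_le by (auto simp: step_path_def)
  then show "bdd_above (u ` space (cube d))" by (meson bdd_above_finite finite_atMost finite_imageI finite_subset)
qed

end

text \<open>A measurable left inverse of \<open>step_path\<close>, which transports likelihood
  ratios from cell values to paths.\<close>

definition read_cells :: "nat \<Rightarrow> nat \<Rightarrow> path \<Rightarrow> nat \<Rightarrow> real" where
  "read_cells d n u = (\<lambda>j\<in>{..n}. u (cell_point d n j))"

lemma read_cells_measurable:
  assumes "1 \<le> d"
  shows "read_cells d n \<in> step_space d n \<rightarrow>\<^sub>M (\<Pi>\<^sub>M i\<in>{..n}. lborel)"
  unfolding read_cells_def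
proof (rule measurable_restrict)
  fix j assume "j \<in> {..n}"
  then show "(\<lambda>u. u (cell_point d n j)) \<in> step_space d n \<rightarrow>\<^sub>M lborel"
    using step_eval_measurable[OF cell_point(1)[OF assms], of j n n] by simp
qed

lemma read_step_path:
  assumes "1 \<le> d" "z \<in> space (\<Pi>\<^sub>M i\<in>{..n}. (lborel :: real measure))"
  shows "read_cells d n (step_path d n z) = z"
  using assms by (auto simp: read_cells_def step_path_cell_point space_PiM PiE_iff extensional_def fun_eq_iff)

lemma nn_integral_read_cells:
  assumes d: "1 \<le> d" and gp: "gpair {..n} Q S" and f: "f \<in> borel_measurable (\<Pi>\<^sub>M i\<in>{..n}. lborel)"
  shows "(\<integral>\<^sup>+u. f (read_cells d n u) \<partial>step_process d n S) = (\<integral>\<^sup>+z. f z \<partial>gauss_cov {..n} S)"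
proof -
  have "(\<integral>\<^sup>+u. f (read_cells d n u) \<partial>step_process d n S) =
      (\<integral>\<^sup>+z. f (read_cells d n (step_path d n z)) \<partial>gauss_cov {..n} S)"
    unfolding step_process_def
    using measurable_compose[OF read_cells_measurable[OF d] f]
    by (intro nn_integral_distr step_path_measurable'[OF d gp]) simp
  also have "\<dots> = (\<integral>\<^sup>+z. f z \<partial>gauss_cov {..n} S)"
    using read_step_path[OF d] sets_eq_imp_space_eq[OF sets_gauss_cov[OF gp]] by (intro nn_integral_cong) simp
  finally show ?thesis .
qed

lemma step_process_density:
  assumes d: "1 \<le> d" and gp: "gpair {..n} Q S"
    and r: "r \<in> borel_measurable (\<Pi>\<^sub>M i\<in>{..n}. lborel)"
    and dens: "gauss_cov {..n} S' = density (gauss_cov {..n} S) r"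
  shows "step_process d n S' = density (step_process d n S) (\<lambda>u. r (read_cells d n u))"
proof -
  have m: "(\<lambda>u. r (read_cells d n u)) \<in> borel_measurable (step_space d n)"
    by (rule measurable_compose[OF read_cells_measurable[OF d] r])
  have "density (step_process d n S) (\<lambda>u. r (read_cells d n u)) =
      distr (density (gauss_cov {..n} S) (\<lambda>z. r (read_cells d n (step_path d n z)))) (step_space d n) (step_path d n)"
    unfolding step_process_def by (rule density_distr[OF m step_path_measurable'[OF d gp]])
  also have "density (gauss_cov {..n} S) (\<lambda>z. r (read_cells d n (step_path d n z))) = density (gauss_cov {..n} S) r"
  proof (rule density_cong)
    show "(\<lambda>z. r (read_cells d n (step_path d n z))) \<in> borel_measurable (gauss_cov {..n} S)"
      by (rule measurable_compose[OF step_path_measurable'[OF d gp] m])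
    show "r \<in> borel_measurable (gauss_cov {..n} S)"
      using r measurable_cong_sets[OF sets_gauss_cov[OF gp] refl] by blast
    show "AE z in gauss_cov {..n} S. r (read_cells d n (step_path d n z)) = r z"
      using read_step_path[OF d] sets_eq_imp_space_eq[OF sets_gauss_cov[OF gp]] by (intro AE_I2) simp
  qed
  finally show ?thesis unfolding step_process_def dens by simp
qed

text \<open>The maximum is bounded by the logarithm of the sum of exponentials, whatever the
  correlations are. The value of \<theta> used later is \<Gamma>2.\<close>

lemma path_sup_expectation:
  assumes d: "1 \<le> d" and gp: "gpair {..n} Q S" and S1: "\<And>c. c \<le> n \<Longrightarrow> S c c = 1" and lam: "0 < \<theta>"
  shows "integrable (step_process d n S) (path_sup d)"
    and "(\<integral>u. path_sup d u \<partial>step_process d n S) \<le> ln (real (n + 1)) / \<theta> + \<theta> / 2"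
proof -
  let ?G = "gauss_cov {..n} S" and ?M = "\<Pi>\<^sub>M i\<in>{..n}. (lborel :: real measure)"
  interpret prob_space ?G by (rule gauss_cov_prob_space[OF gp])
  have zm: "(\<lambda>z. z c) \<in> borel_measurable ?M" if "c \<le> n" for c
  proof -
    have "(\<lambda>z. z c) \<in> ?M \<rightarrow>\<^sub>M (lborel :: real measure)"
      by (rule measurable_component_singleton) (use that in simp)
    then show ?thesis by simp
  qed
  then have zG [measurable]: "(\<lambda>z. z c) \<in> borel_measurable ?G" if "c \<le> n" for c
    using that measurable_cong_sets[OF sets_gauss_cov[OF gp] refl] by blast
  have MaxM: "(\<lambda>z. Max (z ` {..n})) \<in> borel_measurable ?M"
    by (intro borel_measurable_Max) (auto intro!: zm)
  have ps: "path_sup d (step_path d n z) = Max (z ` {..n})" for z by (rule path_sup_step[OF d gp])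
  have psm: "path_sup d \<in> borel_measurable (step_space d n)"
  proof -
    have "path_sup d u = Max (read_cells d n u ` {..n})" if uP: "u \<in> space (step_space d n)" for u
    proof -
      obtain z where u: "u = step_path d n z" using uP unfolding space_step_space by blast
      have "read_cells d n u ` {..n} = z ` {..n}"
        by (rule image_cong) (auto simp: read_cells_def u step_path_cell_point[OF d])
      then show ?thesis using ps by (simp add: u)
    qed
    moreover have "(\<lambda>u. Max (read_cells d n u ` {..n})) \<in> borel_measurable (step_space d n)"
      by (rule measurable_compose[OF read_cells_measurable[OF d] MaxM])
    ultimately show ?thesis by (subst measurable_cong) auto
  qed
  have sq: "has_bochner_integral ?G (\<lambda>z. z c * z c) 1" if "c \<le> n" for c
    using gauss_cov_cov[OF gp that that] S1[OF that] by simp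
  have zi: "integrable ?G (\<lambda>z. \<bar>z c\<bar>)" if c: "c \<le> n" for c
  proof (rule Bochner_Integration.integrable_bound[of _ "\<lambda>z. 1 + z c * z c"])
    show "integrable ?G (\<lambda>z. 1 + z c * z c)" using sq[OF c] by (simp add: has_bochner_integral_iff)
    have "\<bar>x\<bar> \<le> 1 + x * x" for x :: real
      using abs_le_one_plus_square[of x] by (simp add: power2_eq_square)
    then show "AE z in ?G. norm \<bar>z c\<bar> \<le> norm (1 + z c * z c)" by (intro AE_I2) auto
    show "(\<lambda>z. \<bar>z c\<bar>) \<in> borel_measurable ?G" using zG[OF c] by measurable
  qed
  have MaxG: "(\<lambda>z. Max (z ` {..n})) \<in> borel_measurable ?G"
    using MaxM measurable_cong_sets[OF sets_gauss_cov[OF gp] refl] by blast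
  have Mi: "integrable ?G (\<lambda>z. Max (z ` {..n}))"
  proof (rule Bochner_Integration.integrable_bound[of _ "\<lambda>z. \<Sum>c\<le>n. \<bar>z c\<bar>"])
    show "integrable ?G (\<lambda>z. \<Sum>c\<le>n. \<bar>z c\<bar>)" using zi by (intro Bochner_Integration.integrable_sum) auto
    have "\<bar>Max (z ` {..n})\<bar> \<le> (\<Sum>c\<le>n. \<bar>z c\<bar>)" for z :: "nat \<Rightarrow> real"
    proof -
      have "Max (z ` {..n}) \<in> z ` {..n}" by (intro Max_in) auto
      then obtain c where "Max (z ` {..n}) = z c" "c \<in> {..n}" by (rule imageE)
      then show ?thesis using member_le_sum[of c "{..n}" "\<lambda>c. \<bar>z c\<bar>"] by simp
    qed
    then show "AE z in ?G. norm (Max (z ` {..n})) \<le> norm (\<Sum>c\<le>n. \<bar>z c\<bar>)"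
      by (intro AE_I2) (auto simp: abs_of_nonneg sum_nonneg)
  qed (rule MaxG)
  note T = step_path_measurable'[OF d gp]
  show "integrable (step_process d n S) (path_sup d)"
    unfolding step_process_def using Mi by (subst integrable_distr_eq[OF T psm]) (simp add: ps)
  have ev: "(\<integral>u. path_sup d u \<partial>step_process d n S) = (\<integral>z. Max (z ` {..n}) \<partial>?G)"
    unfolding step_process_def by (subst integral_distr[OF T psm]) (simp add: ps)
  define y where "y = exp (\<theta>\<^sup>2 / 2)"
  have y: "0 < y" by (simp add: y_def)
  have mgf: "has_bochner_integral ?G (\<lambda>z. exp (\<theta> * z c)) y" if c: "c \<le> n" for c
  proof (rule has_bochner_integral_nn_integral)
    show "(\<lambda>z. exp (\<theta> * z c)) \<in> borel_measurable ?G" using zG[OF c] by measurable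
    have "(\<integral>\<^sup>+z. ennreal (exp (\<theta> * dot {..n} (unit_vec c) z)) \<partial>gauss {..n} Q) =
        ennreal (exp (\<theta>\<^sup>2 * bform {..n} S (unit_vec c) (unit_vec c) / 2))"
      by (rule gauss_mgf[OF gp])
    then show "(\<integral>\<^sup>+z. ennreal (exp (\<theta> * z c)) \<partial>?G) = ennreal y"
      using c S1[OF c] by (simp add: gauss_cov_eq[OF gp] dot_unit_vec unit_vec_bform y_def)
  qed (use y in auto)
  \<comment> \<open>Y is the mean of the sum of exponentials. The tangent of the logarithm at this
    point, ln v \<le> v / Y - 1 + ln Y, takes the place of Jensen's inequality.\<close>
  define Y where "Y = real (n + 1) * y"
  have Y: "0 < Y" using y by (simp add: Y_def)
  have "(\<integral>z. \<theta> * Max (z ` {..n}) \<partial>?G) \<le> (\<integral>z. (\<Sum>c\<le>n. exp (\<theta> * z c)) / Y - 1 + ln Y \<partial>?G)"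
  proof (rule integral_mono)
    show "integrable ?G (\<lambda>z. \<theta> * Max (z ` {..n}))" using Mi by simp
    show "integrable ?G (\<lambda>z. (\<Sum>c\<le>n. exp (\<theta> * z c)) / Y - 1 + ln Y)"
    proof -
      have "integrable ?G (\<lambda>z. \<Sum>c\<le>n. exp (\<theta> * z c))"
        using mgf by (intro Bochner_Integration.integrable_sum) (auto simp: has_bochner_integral_iff)
      then show ?thesis by simp
    qed
    fix z :: "nat \<Rightarrow> real"
    have "Max (z ` {..n}) \<in> z ` {..n}" by (intro Max_in) auto
    then obtain c where c: "Max (z ` {..n}) = z c" "c \<in> {..n}" by (rule imageE)
    have pos: "0 < (\<Sum>c\<le>n. exp (\<theta> * z c))" by (intro sum_pos) auto
    have "exp (\<theta> * z c) \<le> (\<Sum>c\<le>n. exp (\<theta> * z c))"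
      using c member_le_sum[of c "{..n}" "\<lambda>c. exp (\<theta> * z c)"] by simp
    then have "\<theta> * z c \<le> ln (\<Sum>c\<le>n. exp (\<theta> * z c))"
      using pos by (simp add: ln_ge_iff)
    also have "\<dots> = ln ((\<Sum>c\<le>n. exp (\<theta> * z c)) / Y) + ln Y"
      using pos Y by (simp add: ln_div)
    also have "\<dots> \<le> (\<Sum>c\<le>n. exp (\<theta> * z c)) / Y - 1 + ln Y"
      using pos Y ln_le_minus_one[of "(\<Sum>c\<le>n. exp (\<theta> * z c)) / Y"] by simp
    finally show "\<theta> * Max (z ` {..n}) \<le> (\<Sum>c\<le>n. exp (\<theta> * z c)) / Y - 1 + ln Y" by (simp add: c)
  qed
  also have "\<dots> = (\<Sum>c\<le>n. y) / Y - 1 + ln Y"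
  proof -
    have "has_bochner_integral ?G (\<lambda>z. (\<Sum>c\<le>n. exp (\<theta> * z c)) / Y - 1 + ln Y) ((\<Sum>c\<le>n. y) / Y - 1 + ln Y)"
    proof -
      have 1: "has_bochner_integral ?G (\<lambda>z. (\<Sum>c\<le>n. exp (\<theta> * z c)) / Y) ((\<Sum>c\<le>n. y) / Y)"
        by (intro has_bochner_integral_divide_zero has_bochner_integral_sum mgf) auto
      have 2: "has_bochner_integral ?G (\<lambda>z. ln Y - 1) (ln Y - 1)"
        by (simp add: has_bochner_integral_iff prob_space)
      show ?thesis using has_bochner_integral_add[OF 1 2] by (simp add: algebra_simps)
    qed
    then show ?thesis by (simp add: has_bochner_integral_iff)
  qed
  also have "\<dots> = ln Y" using y by (simp add: Y_def)
  also have "ln Y = ln (real (n + 1)) + \<theta>\<^sup>2 / 2" using y by (simp add: Y_def ln_mult y_def)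
  finally have "\<theta> * (\<integral>z. Max (z ` {..n}) \<partial>?G) \<le> ln (real (n + 1)) + \<theta>\<^sup>2 / 2" by simp
  then show "(\<integral>u. path_sup d u \<partial>step_process d n S) \<le> ln (real (n + 1)) / \<theta> + \<theta> / 2"
    using lam unfolding ev by (simp add: field_simps power2_eq_square)
qed

lemma cell_width_eq: "cell_width n c = (if c < n then 1 else 3) * cell_width n n / 3"
  by (simp add: cell_width_def field_simps)

text \<open>The normalisations become explicit: the sup norm is 1 and the operator norm is the width
  w of the last cell, so the sparsity is the largest integral of |k|^q divided by w.\<close>

lemma step_process_class:
  fixes E :: "nat \<Rightarrow> nat \<Rightarrow> bool" and \<epsilon> q :: real and k :: nat
  assumes d: "1 \<le> d" and q: "0 \<le> q" "q \<le> 1" and eps: "0 < \<epsilon>" "\<epsilon> \<le> 1"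
    and RC: "R \<subseteq> {..<n}" "C \<subseteq> {..<n}" "R \<inter> C = {}"
    and E: "\<And>i l. E i l \<Longrightarrow> i \<in> R \<and> l \<in> C"
    and row: "\<And>i. card {l. E i l} \<le> 2 * k" and col: "\<And>l. card {i. E i l} \<le> 2 * k"
    and k: "real k * \<epsilon> \<le> 1" and gp: "gpair {..n} Q (cross_cov (\<lambda>i l. \<epsilon> * of_bool (E i l)))"
    and G1: "1 \<le> \<Gamma>1" "1 + 2 * real k * \<epsilon> powr q \<le> 3 * \<Gamma>1"
    and G2: "0 < \<Gamma>2" "ln (real (n + 1)) \<le> \<Gamma>2\<^sup>2 / 2"
  shows "step_process d n (cross_cov (\<lambda>i l. \<epsilon> * of_bool (E i l))) \<in> cov_class d q \<Gamma>1 \<Gamma>2"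
    and "op_norm d (cov (step_process d n (cross_cov (\<lambda>i l. \<epsilon> * of_bool (E i l))))) = ennreal (cell_width n n)"
proof -
  let ?S = "cross_cov (\<lambda>i l. \<epsilon> * of_bool (E i l))"
  let ?P = "step_process d n ?S"
  define w where "w = cell_width n n"
  have w: "0 < w" by (simp add: w_def cell_width_pos)
  interpret cube: prob_space "cube d" by (rule prob_space_cube)
  note gauss = gaussian_step_process[OF d gp]
  note cv = cov_step_process[OF d gp]
  have nE: "\<not> E j j" "E j l \<Longrightarrow> \<not> E l j" "\<not> E n j" "\<not> E j n" for j l
    using E[of j j] E[of j l] E[of l j] E[of n j] E[of j n] RC by auto
  have S_eq: "?S j l = (if j = l then 1 else if E j l \<or> E l j then \<epsilon> else 0)" for j l
    using nE(1)[of j] nE(2)[of j l] nE(2)[of l j] by (auto simp: cross_cov_def)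
  have S_le: "\<bar>?S j l\<bar> \<le> 1" and S_nonneg: "0 \<le> ?S j l" for j l using eps by (auto simp: S_eq)
  \<comment> \<open>A cell is never both a row and a column, so its neighbours obey one of the two
    degree bounds and not only their sum.\<close>
  have deg: "card {l. E j l \<or> E l j} \<le> 2 * k" and fin: "finite {l. E j l \<or> E l j}" for j
  proof -
    show f: "finite {l. E j l \<or> E l j}"
      by (rule finite_subset[of _ "{..<n}"]) (use E RC in auto)
    have "{l. E j l \<or> E l j} = {l. E j l} \<or> {l. E j l \<or> E l j} = {l. E l j}"
    proof (cases "j \<in> R")
      case True
      then have "\<not> E l j" for l using E[of l j] RC by auto
      then show ?thesis by auto
    next
      case False
      then have "\<not> E j l" for l using E[of j l] by auto
      then show ?thesis by auto
    qed
    then show "card {l. E j l \<or> E l j} \<le> 2 * k" using row[of j] col[of j] by auto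
  qed
  \<comment> \<open>One estimate for two exponents: r = 1 gives the operator norm and r = q the
    sparsity. Zero entries contribute nothing even for r = 0, since 0 powr 0 = 0.\<close>
  have bound: "(\<Sum>l\<le>n. \<bar>?S j l\<bar> powr r * cell_width n l) \<le> w * max 1 ((1 + 2 * real k * \<epsilon> powr r) / 3)"
    if j: "j \<le> n" for j r
  proof (cases "j = n")
    case True
    have "(\<Sum>l\<le>n. \<bar>?S j l\<bar> powr r * cell_width n l) = (\<Sum>l\<le>n. if l = n then w else 0)"
      using nE(3,4) by (intro sum.cong) (auto simp: S_eq True w_def)
    also have "\<dots> \<le> w * max 1 ((1 + 2 * real k * \<epsilon> powr r) / 3)" using w by simp
    finally show ?thesis .
  next
    case False
    have "(\<Sum>l\<le>n. \<bar>?S j l\<bar> powr r * cell_width n l) =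
        (\<Sum>l\<le>n. (if l = j then w / 3 else 0) + (if l \<in> {l. E j l \<or> E l j} then w / 3 * \<epsilon> powr r else 0))"
    proof (intro sum.cong refl)
      fix l assume l: "l \<in> {..n}"
      have "E j l \<or> E l j \<Longrightarrow> cell_width n l = w / 3" using nE l by (subst cell_width_eq) (auto simp: w_def nat_less_le)
      moreover have "cell_width n j = w / 3" using False j by (subst cell_width_eq) (auto simp: w_def)
      ultimately show "\<bar>?S j l\<bar> powr r * cell_width n l =
          (if l = j then w / 3 else 0) + (if l \<in> {l. E j l \<or> E l j} then w / 3 * \<epsilon> powr r else 0)"
        using nE(1)[of j] eps by (auto simp: S_eq)
    qed
    also have "\<dots> = w / 3 + (\<Sum>l\<in>{..n} \<inter> {l. E j l \<or> E l j}. w / 3 * \<epsilon> powr r)"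
      using j unfolding sum.distrib by (subst sum.inter_restrict[symmetric]) simp_all
    also have "\<dots> \<le> w / 3 + real (2 * k) * (w / 3 * \<epsilon> powr r)"
    proof -
      have "card ({..n} \<inter> {l. E j l \<or> E l j}) \<le> 2 * k"
        by (rule order_trans[OF card_mono[OF fin[of j]] deg]) auto
      then have "real (card ({..n} \<inter> {l. E j l \<or> E l j})) \<le> real (2 * k)" by simp
      then show ?thesis using w by (simp only: sum_constant) (intro add_left_mono mult_right_mono, auto)
    qed
    also have "\<dots> = w * ((1 + 2 * real k * \<epsilon> powr r) / 3)" by (simp add: field_simps)
    also have "\<dots> \<le> w * max 1 ((1 + 2 * real k * \<epsilon> powr r) / 3)" using w by (intro mult_left_mono) auto
    finally show ?thesis .
  qed
  have int: "(\<integral>y. \<bar>cov ?P x y\<bar> powr r \<partial>cube d) \<le> w * max 1 ((1 + 2 * real k * \<epsilon> powr r) / 3)"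
    if x: "x \<in> space (cube d)" for x r
  proof -
    have "(\<integral>y. \<bar>cov ?P x y\<bar> powr r \<partial>cube d) = (\<integral>y. \<bar>?S (cell n x) (cell n y)\<bar> powr r \<partial>cube d)"
      using cv[OF x] by (intro Bochner_Integration.integral_cong) auto
    also have "\<dots> = (\<Sum>l\<le>n. \<bar>?S (cell n x) l\<bar> powr r * cell_width n l)"
      by (rule cell_integral_eq[OF d])
    also have "\<dots> \<le> w * max 1 ((1 + 2 * real k * \<epsilon> powr r) / 3)" by (rule bound[OF cell_le])
    finally show ?thesis .
  qed
  have up: "op_norm d (cov ?P) \<le> ennreal w"
  proof (rule op_norm_le_schur[OF cov_measurable[OF gauss]])
    show "\<bar>cov ?P x y\<bar> \<le> 1" if "x \<in> space (cube d)" "y \<in> space (cube d)" for x y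
      using cv[OF that] S_le by simp
    show "cov ?P x y = cov ?P y x" for x y by (simp add: cov_def mult.commute)
    show "(\<integral>y. \<bar>cov ?P x y\<bar> \<partial>cube d) \<le> w" if "x \<in> space (cube d)" for x
    proof -
      have m: "max 1 ((1 + 2 * real k * \<epsilon> powr 1) / 3) = 1" using k eps by simp
      show ?thesis using int[OF that, of 1] unfolding m by simp
    qed
  qed (use w in simp)
  \<comment> \<open>The last cell is uncorrelated with all others, so its indicator is an
    eigenfunction with eigenvalue w.\<close>
  have low: "ennreal w \<le> op_norm d (cov ?P)"
  proof -
    let ?\<psi> = "\<lambda>x. of_bool (cell n x = n) :: real"
    note [measurable] = cell_measurable[OF d]
    have sq: "(\<lambda>x. (?\<psi> x)\<^sup>2) = ?\<psi>" by (auto simp: fun_eq_iff)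
    have hb: "has_bochner_integral (cube d) ?\<psi> w"
    proof -
      have "(\<Sum>c\<le>n. of_bool (c = n) * cell_width n c) = w" by (simp add: w_def)
      then show ?thesis using cell_integral[OF d, of "\<lambda>c. of_bool (c = n)" n] by simp
    qed
    have L: "?\<psi> \<in> L2 d" using hb unfolding L2_def mem_Collect_eq sq by (auto simp: has_bochner_integral_iff)
    have V: "(\<integral>x. (?\<psi> x)\<^sup>2 \<partial>cube d) = w" unfolding sq using hb by (simp add: has_bochner_integral_iff)
    have kop: "kernel_op d (cov ?P) ?\<psi> x = w" if x: "x \<in> space (cube d)" "cell n x = n" for x
    proof -
      have "kernel_op d (cov ?P) ?\<psi> x = (\<integral>y. ?S n (cell n y) * of_bool (cell n y = n) \<partial>cube d)"
        unfolding kernel_op_def using cv[OF x(1)] x(2) by (intro Bochner_Integration.integral_cong) auto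
      also have "\<dots> = (\<Sum>c\<le>n. ?S n c * of_bool (c = n) * cell_width n c)"
        by (rule cell_integral_eq[OF d])
      also have "\<dots> = (\<Sum>c\<le>n. if c = n then w else 0)"
        by (intro sum.cong) (auto simp: S_eq w_def)
      finally show ?thesis by simp
    qed
    have "ennreal (w\<^sup>2 * w) = (\<integral>\<^sup>+x. ennreal (w\<^sup>2 * ?\<psi> x) \<partial>cube d)"
      using hb w by (subst nn_integral_eq_integral) (auto simp: has_bochner_integral_iff)
    also have "\<dots> \<le> (\<integral>\<^sup>+x. ennreal ((kernel_op d (cov ?P) ?\<psi> x)\<^sup>2) \<partial>cube d)"
      using kop by (intro nn_integral_mono ennreal_leI) auto
    finally show ?thesis
      using L V w by (intro op_norm_ge_test[OF L]) auto
  qed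
  show opn: "op_norm d (cov ?P) = ennreal (cell_width n n)"
    using up low by (simp add: w_def)
  obtain x0 where x0: "x0 \<in> space (cube d)" using cube.not_empty by auto
  have sup1: "sup_norm d (cov ?P) = 1"
    unfolding sup_norm_def
  proof (rule cSup_eq_maximum)
    show "1 \<in> (\<lambda>(x, y). \<bar>cov ?P x y\<bar>) ` (space (cube d) \<times> space (cube d))"
      using x0 cv[OF x0 x0] by (intro image_eqI[of _ _ "(x0, x0)"]) (auto simp: S_eq)
    show "y \<le> 1" if "y \<in> (\<lambda>(x, y). \<bar>cov ?P x y\<bar>) ` (space (cube d) \<times> space (cube d))" for y
      using that cv S_le by auto
  qed
  have qn: "q_norm_q d q (cov ?P) \<le> w * \<Gamma>1"
    unfolding q_norm_q_def
  proof (rule cSUP_least)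
    fix x assume "x \<in> space (cube d)"
    then have "(\<integral>y. \<bar>cov ?P x y\<bar> powr q \<partial>cube d) \<le> w * max 1 ((1 + 2 * real k * \<epsilon> powr q) / 3)" by (rule int)
    also have "\<dots> \<le> w * \<Gamma>1" using G1 w by (intro mult_left_mono) auto
    finally show "(\<integral>y. \<bar>cov ?P x y\<bar> powr q \<partial>cube d) \<le> w * \<Gamma>1" .
  qed (use x0 in auto)
  have S1: "?S c c = 1" for c by (simp add: S_eq)
  \<comment> \<open>\<theta> = \<Gamma>2 balances the two terms: ln (n + 1) \<le> \<Gamma>2^2 / 2
    makes each of them at most \<Gamma>2 / 2.\<close>
  note ps = path_sup_expectation[OF d gp S1 G2(1)]
  have "ln (real (n + 1)) / \<Gamma>2 + \<Gamma>2 / 2 \<le> \<Gamma>2"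
    using G2 by (simp add: field_simps power2_eq_square)
  then have "capacity d ?P \<le> \<Gamma>2" using ps(2) by (simp add: capacity_def sup1)
  moreover have "sparsity d q ?P \<le> \<Gamma>1"
    using qn w by (simp add: sparsity_def sup1 opn w_def[symmetric] divide_le_eq mult.commute)
  moreover have "regular_process d ?P"
    unfolding regular_process_def
  proof (intro conjI gauss ps(1) bdd_above_step[OF d gp])
    show "op_norm d (cov ?P) \<noteq> 0" using w by (simp add: opn w_def)
    show "\<exists>B. \<forall>x\<in>space (cube d). \<forall>y\<in>space (cube d). \<bar>cov ?P x y\<bar> \<le> B"
      using cv S_le by (intro exI[of _ 1]) auto
  qed
  ultimately show "?P \<in> cov_class d q \<Gamma>1 \<Gamma>2" by (simp add: cov_class_def)
qed

section \<open>Random sparse designs\<close>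

text \<open>Each row takes its t-th column from block t. Its k columns are then distinct, and they
  range over a product set, over which exponential sums factor.\<close>

definition col_block :: "nat \<Rightarrow> nat \<Rightarrow> nat \<Rightarrow> nat set" where
  "col_block k L t = {k * L + t * L ..< k * L + (t + 1) * L}"

definition hits :: "nat \<Rightarrow> (nat \<Rightarrow> nat) \<Rightarrow> nat \<Rightarrow> bool" where
  "hits k f l \<longleftrightarrow> (\<exists>t<k. f t = l)"

definition col_degree :: "nat \<Rightarrow> nat set \<Rightarrow> (nat \<Rightarrow> nat \<Rightarrow> nat) \<Rightarrow> nat \<Rightarrow> nat" where
  "col_degree k R b l = card {i\<in>R. hits k (b i) l}"

text \<open>The average column degree is k, as k L rows choose k columns each among k L. A cap at
  twice the average can exclude at most half of every block.\<close>

definition designs :: "nat \<Rightarrow> nat \<Rightarrow> (nat \<Rightarrow> nat \<Rightarrow> nat) set" where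
  "designs k L = {b \<in> Pi\<^sub>E {..<k * L} (\<lambda>_. Pi\<^sub>E {..<k} (col_block k L)).
     \<forall>l. col_degree k {..<k * L} b l \<le> 2 * k}"

definition open_cols :: "nat \<Rightarrow> nat \<Rightarrow> (nat \<Rightarrow> nat \<Rightarrow> nat) \<Rightarrow> nat \<Rightarrow> nat \<Rightarrow> nat set" where
  "open_cols k L b i t = {l \<in> col_block k L t. col_degree k ({..<k * L} - {i}) b l < 2 * k}"

definition row_choices :: "nat \<Rightarrow> nat \<Rightarrow> (nat \<Rightarrow> nat \<Rightarrow> nat) \<Rightarrow> nat \<Rightarrow> (nat \<Rightarrow> nat) set" where
  "row_choices k L b i = Pi\<^sub>E {..<k} (open_cols k L b i)"

lemma col_block_disjoint: "l \<in> col_block k L t \<Longrightarrow> l \<in> col_block k L t' \<Longrightarrow> t = t'"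
proof -
  have "l \<in> col_block k L t \<Longrightarrow> (l - k * L) div L = t" for t
  proof -
    assume "l \<in> col_block k L t"
    then have "t * L \<le> l - k * L" "l - k * L < Suc t * L" by (auto simp: col_block_def)
    then show ?thesis by (intro div_nat_eqI) (simp_all add: mult.commute)
  qed
  then show "l \<in> col_block k L t \<Longrightarrow> l \<in> col_block k L t' \<Longrightarrow> t = t'" by metis
qed

lemma card_col_block: "card (col_block k L t) = L"
  by (simp add: col_block_def)

lemma col_block_subset: "t < k \<Longrightarrow> col_block k L t \<subseteq> {k * L..<2 * (k * L)}"
proof -
  assume "t < k"
  then have "(t + 1) * L \<le> k * L" by (intro mult_right_mono) auto
  then have "k * L + (t + 1) * L \<le> 2 * (k * L)" by linarith
  then show ?thesis by (auto simp: col_block_def)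
qed

lemma hits_image: "{l. hits k f l} = f ` {..<k}"
  by (auto simp: hits_def)

lemma block_choice_inj: "f \<in> Pi\<^sub>E {..<k} (col_block k L) \<Longrightarrow> inj_on f {..<k}"
  by (intro inj_onI) (metis PiE_mem col_block_disjoint)

lemma finite_designs: "finite (designs k L)"
proof (rule finite_subset)
  show "designs k L \<subseteq> Pi\<^sub>E {..<k * L} (\<lambda>_. Pi\<^sub>E {..<k} (col_block k L))" by (auto simp: designs_def)
qed (intro finite_PiE; simp add: col_block_def finite_PiE)

lemma finite_row_choices: "finite (row_choices k L b i)"
  unfolding row_choices_def by (intro finite_PiE) (auto simp: open_cols_def col_block_def)

text \<open>In the design where row i takes the entry i mod L of every block, no column is used more
  than k times.\<close>

lemma designs_nonempty:
  assumes "1 \<le> k" "1 \<le> L"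
  shows "designs k L \<noteq> {}"
proof -
  define b where "b = (\<lambda>i\<in>{..<k * L}. \<lambda>t\<in>{..<k}. k * L + t * L + i mod L)"
  have "b \<in> Pi\<^sub>E {..<k * L} (\<lambda>_. Pi\<^sub>E {..<k} (col_block k L))"
    using assms by (auto simp: b_def col_block_def)
  moreover have "col_degree k {..<k * L} b l \<le> 2 * k" for l
  proof -
    have "{i\<in>{..<k * L}. hits k (b i) l} \<subseteq> (\<lambda>s. s * L + (l - k * L) mod L) ` {..<k}"
    proof
      fix i assume "i \<in> {i\<in>{..<k * L}. hits k (b i) l}"
      then obtain t where i: "i < k * L" "t < k" "k * L + t * L + i mod L = l"
        by (auto simp: hits_def b_def)
      then have "(l - k * L) mod L = i mod L" using assms by (simp add: i(3)[symmetric])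
      moreover have "i div L < k" using i by (simp add: less_mult_imp_div_less)
      moreover have "i = i div L * L + i mod L" by simp
      ultimately show "i \<in> (\<lambda>s. s * L + (l - k * L) mod L) ` {..<k}" by (metis imageI lessThan_iff)
    qed
    then have "col_degree k {..<k * L} b l \<le> card ((\<lambda>s. s * L + (l - k * L) mod L) ` {..<k})"
      unfolding col_degree_def by (intro card_mono) auto
    also have "\<dots> \<le> k" by (rule order_trans[OF card_image_le]) auto
    finally show ?thesis by simp
  qed
  ultimately show ?thesis by (auto simp: designs_def)
qed

lemma col_degree_cong:
  "(\<And>i. i \<in> R \<Longrightarrow> b i = b' i) \<Longrightarrow> col_degree k R b l = col_degree k R b' l"
  unfolding col_degree_def by (intro arg_cong[where f=card]) auto

lemma row_choices_update: "row_choices k L (b(i := c)) i = row_choices k L b i"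
  unfolding row_choices_def open_cols_def
  using col_degree_cong[of "{..<k * L} - {i}" "b(i := c)" b] by simp

lemma col_degree_split:
  assumes "i < m"
  shows "col_degree k {..<m} b l = col_degree k ({..<m} - {i}) b l + of_bool (hits k (b i) l)"
proof -
  have "{j\<in>{..<m}. hits k (b j) l} =
      (if hits k (b i) l then insert i {j\<in>{..<m} - {i}. hits k (b j) l} else {j\<in>{..<m} - {i}. hits k (b j) l})"
    using assms by auto
  then show ?thesis unfolding col_degree_def by (simp only: if_split) auto
qed

text \<open>Together with \<open>design_row_in_choices\<close> this shows that the designs agreeing
  with b off row i are exactly its updates by \<open>row_choices\<close>.\<close>

lemma design_update:
  assumes b: "b \<in> designs k L" and i: "i < k * L" and c: "c \<in> row_choices k L b i"
  shows "b(i := c) \<in> designs k L"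
proof -
  have "c \<in> Pi\<^sub>E {..<k} (col_block k L)"
    using c unfolding row_choices_def by (rule PiE_mono[THEN subsetD, rotated]) (auto simp: open_cols_def)
  then have "b(i := c) \<in> Pi\<^sub>E {..<k * L} (\<lambda>_. Pi\<^sub>E {..<k} (col_block k L))"
    using b i unfolding designs_def by (auto simp: PiE_iff extensional_def)
  moreover have "col_degree k {..<k * L} (b(i := c)) l \<le> 2 * k" for l
  proof -
    have eq: "col_degree k ({..<k * L} - {i}) (b(i := c)) l = col_degree k ({..<k * L} - {i}) b l"
      by (rule col_degree_cong) auto
    have upd: "col_degree k {..<k * L} (b(i := c)) l = col_degree k ({..<k * L} - {i}) b l + of_bool (hits k c l)"
      by (simp only: col_degree_split[OF i] eq fun_upd_same)
    show ?thesis
    proof (cases "hits k c l")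
      case True
      then have "col_degree k ({..<k * L} - {i}) b l < 2 * k"
        using c by (auto simp: hits_def row_choices_def open_cols_def PiE_iff)
      then show ?thesis by (simp add: upd)
    next
      case False
      have "col_degree k ({..<k * L} - {i}) b l \<le> 2 * k"
        using b col_degree_split[OF i, of k b l] by (auto simp: designs_def dest!: spec[of _ l])
      then show ?thesis using False by (simp add: upd)
    qed
  qed
  ultimately show ?thesis by (auto simp: designs_def)
qed

lemma design_row_in_choices:
  assumes b: "b \<in> designs k L" and i: "i < k * L"
  shows "b i \<in> row_choices k L b i"
proof -
  have bi: "b i \<in> Pi\<^sub>E {..<k} (col_block k L)" using b i by (auto simp: designs_def)
  have "b i t \<in> open_cols k L b i t" if t: "t < k" for t
  proof -
    have "hits k (b i) (b i t)" using t by (auto simp: hits_def)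
    moreover have "col_degree k {..<k * L} b (b i t) \<le> 2 * k" using b by (auto simp: designs_def)
    ultimately have "col_degree k ({..<k * L} - {i}) b (b i t) < 2 * k"
      using col_degree_split[OF i, of k b "b i t"] by simp
    then show ?thesis using bi t by (auto simp: open_cols_def)
  qed
  then show ?thesis using bi by (auto simp: row_choices_def PiE_iff)
qed

text \<open>Double counting in block t: a column excluded by the cap is hit at least 2 k times by
  the other rows, and each of these fewer than k L rows hits the block at most once. So at most L /
  2 columns are excluded.\<close>

lemma card_open_cols:
  assumes b: "b \<in> designs k L" and i: "i < k * L" and t: "t < k"
  shows "real L / 2 \<le> real (card (open_cols k L b i t))"
proof -
  let ?B = "col_block k L t" and ?R = "{..<k * L} - {i}"
  have fB: "finite ?B" by (simp add: col_block_def)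
  define F where "F = ?B - open_cols k L b i t"
  have one: "card {l\<in>?B. hits k (b j) l} \<le> 1" if "j \<in> ?R" for j
  proof -
    have bj: "b j \<in> Pi\<^sub>E {..<k} (col_block k L)" using b that by (auto simp: designs_def)
    have "{l\<in>?B. hits k (b j) l} \<subseteq> {b j t}"
    proof
      fix l assume l: "l \<in> {l\<in>?B. hits k (b j) l}"
      then obtain s where s: "s < k" "b j s = l" by (auto simp: hits_def)
      then have "l \<in> col_block k L s" using bj by auto
      then have "s = t" using l col_block_disjoint by blast
      then show "l \<in> {b j t}" using s by simp
    qed
    then show ?thesis using card_mono[of "{b j t}"] by auto
  qed
  have "card F * (2 * k) = (\<Sum>l\<in>F. 2 * k)" by simp
  also have "\<dots> \<le> (\<Sum>l\<in>F. col_degree k ?R b l)"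
    by (intro sum_mono) (auto simp: F_def open_cols_def)
  also have "\<dots> \<le> (\<Sum>l\<in>?B. col_degree k ?R b l)"
    using fB by (intro sum_mono2) (auto simp: F_def)
  also have "\<dots> = (\<Sum>l\<in>?B. \<Sum>j\<in>?R. of_bool (hits k (b j) l))"
    by (intro sum.cong refl) (simp add: col_degree_def of_bool_def sum.If_cases Int_def)
  also have "\<dots> = (\<Sum>j\<in>?R. \<Sum>l\<in>?B. of_bool (hits k (b j) l))" by (rule sum.swap)
  also have "\<dots> = (\<Sum>j\<in>?R. card {l\<in>?B. hits k (b j) l})"
    using fB by (intro sum.cong refl) (simp add: of_bool_def sum.If_cases Int_def)
  also have "\<dots> \<le> (\<Sum>j\<in>?R. 1)" by (intro sum_mono one)
  also have "\<dots> \<le> k * L" using i by simp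
  finally have "k * (2 * card F) \<le> k * L" by (simp add: mult_ac)
  then have "2 * card F \<le> L" using t by simp
  moreover have "card F = L - card (open_cols k L b i t)"
    unfolding F_def using fB by (subst card_Diff_subset) (auto simp: open_cols_def card_col_block intro: finite_subset)
  moreover have "card (open_cols k L b i t) \<le> L"
    using card_mono[OF fB, of "open_cols k L b i t"] by (auto simp: open_cols_def card_col_block)
  ultimately show ?thesis by simp
qed

text \<open>Conditionally on the other rows of a uniformly chosen design, row i is uniform on a product set.\<close>

lemma design_average:
  fixes h :: "(nat \<Rightarrow> nat \<Rightarrow> nat) \<Rightarrow> ennreal"
  assumes i: "i < k * L"
  shows "(\<Sum>b\<in>designs k L. h b) =
    (\<Sum>b\<in>designs k L. (\<Sum>c\<in>row_choices k L b i. h (b(i := c))) * ennreal (1 / card (row_choices k L b i)))"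
proof -
  let ?D = "designs k L" and ?O = "\<lambda>b. row_choices k L b i"
  \<comment> \<open>Designs that agree off row i form a class whose size is the number of row
    choices, and this number is constant on the class. Summing the class averages over all designs
    therefore counts every h b' exactly once.\<close>
  define rel where "rel b b' \<longleftrightarrow> (\<forall>j. j \<noteq> i \<longrightarrow> b' j = b j)" for b b' :: "nat \<Rightarrow> nat \<Rightarrow> nat"
  have rel_O: "?O b' = ?O b" if "rel b b'" for b b'
  proof -
    have "b' = b(i := b' i)" using that by (auto simp: rel_def)
    then show ?thesis using row_choices_update by metis
  qed
  have cls: "{b'\<in>?D. rel b b'} = (\<lambda>c. b(i := c)) ` ?O b" if b: "b \<in> ?D" for b
  proof safe
    fix b' assume b': "b' \<in> ?D" "rel b b'"
    have "b' = b(i := b' i)" using b' by (auto simp: rel_def)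
    moreover have "b' i \<in> ?O b" using design_row_in_choices[OF b'(1) i] rel_O[OF b'(2)] by simp
    ultimately show "b' \<in> (\<lambda>c. b(i := c)) ` ?O b" by blast
  qed (auto simp: design_update[OF b i] rel_def)
  have inj: "inj_on (\<lambda>c. b(i := c)) (?O b)" for b by (rule inj_onI) (metis fun_upd_same)
  have card: "card {b'\<in>?D. rel b b'} = card (?O b)" if "b \<in> ?D" for b
    unfolding cls[OF that] by (rule card_image[OF inj])
  have pos: "0 < card (?O b)" if "b \<in> ?D" for b
    using design_row_in_choices[OF that i] finite_row_choices by (auto simp: card_gt_0_iff)
  have "(\<Sum>b\<in>?D. (\<Sum>c\<in>?O b. h (b(i := c))) * ennreal (1 / card (?O b))) =
      (\<Sum>b\<in>?D. \<Sum>b'\<in>?D. if rel b b' then h b' * ennreal (1 / card (?O b')) else 0)"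
  proof (rule sum.cong[OF refl])
    fix b assume b: "b \<in> ?D"
    have "(\<Sum>c\<in>?O b. h (b(i := c))) = (\<Sum>b'\<in>{b'\<in>?D. rel b b'}. h b')"
      unfolding cls[OF b] by (subst sum.reindex[OF inj]) simp
    then have "(\<Sum>c\<in>?O b. h (b(i := c))) * ennreal (1 / card (?O b)) =
        (\<Sum>b'\<in>{b'\<in>?D. rel b b'}. h b' * ennreal (1 / card (?O b)))"
      by (simp only: sum_distrib_right)
    also have "\<dots> = (\<Sum>b'\<in>{b'\<in>?D. rel b b'}. h b' * ennreal (1 / card (?O b')))"
      by (intro sum.cong refl) (auto simp: rel_O)
    also have "\<dots> = (\<Sum>b'\<in>?D. if rel b b' then h b' * ennreal (1 / card (?O b')) else 0)"
      using finite_designs by (simp add: sum.If_cases Int_def)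
    finally show "(\<Sum>c\<in>?O b. h (b(i := c))) * ennreal (1 / card (?O b)) = \<dots>" .
  qed
  also have "\<dots> = (\<Sum>b'\<in>?D. \<Sum>b\<in>?D. if rel b b' then h b' * ennreal (1 / card (?O b')) else 0)"
    by (rule sum.swap)
  also have "\<dots> = (\<Sum>b'\<in>?D. h b')"
  proof (rule sum.cong[OF refl])
    fix b' assume b': "b' \<in> ?D"
    have "{b\<in>?D. rel b b'} = {b\<in>?D. rel b' b}" by (auto simp: rel_def)
    then have "(\<Sum>b\<in>?D. if rel b b' then h b' * ennreal (1 / card (?O b')) else 0) =
        of_nat (card (?O b')) * (h b' * ennreal (1 / card (?O b')))"
      using finite_designs card[OF b'] by (simp add: sum.If_cases Int_def)
    also have "\<dots> = h b' * (ennreal (card (?O b')) * ennreal (1 / card (?O b')))"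
      by (simp add: ennreal_of_nat_eq_real_of_nat mult_ac)
    also have "ennreal (card (?O b')) * ennreal (1 / card (?O b')) = 1"
      using pos[OF b'] by (simp add: ennreal_mult'[symmetric])
    finally show "(\<Sum>b\<in>?D. if rel b b' then h b' * ennreal (1 / card (?O b')) else 0) = h b'" by simp
  qed
  finally show ?thesis by simp
qed

section \<open>Covariances of the designs\<close>

text \<open>g is the set of rows that are switched on. A design lists columns also for the rows that
  are off, so g and b can be varied independently.\<close>

definition edges :: "nat \<Rightarrow> nat set \<Rightarrow> (nat \<Rightarrow> nat \<Rightarrow> nat) \<Rightarrow> nat \<Rightarrow> nat \<Rightarrow> bool" where
  "edges k g b i l \<longleftrightarrow> i \<in> g \<and> hits k (b i) l"

definition design_cov :: "nat \<Rightarrow> real \<Rightarrow> nat set \<Rightarrow> (nat \<Rightarrow> nat \<Rightarrow> nat) \<Rightarrow> nat \<Rightarrow> nat \<Rightarrow> real" where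
  "design_cov k \<epsilon> g b = cross_cov (\<lambda>i l. \<epsilon> * of_bool (edges k g b i l))"

locale design_params =
  fixes k L :: nat and \<epsilon> :: real
  assumes kL: "1 \<le> k" "1 \<le> L" and eps: "0 < \<epsilon>" "\<epsilon> \<le> 1 / 2" "real k * \<epsilon> \<le> 1 / 2"
begin

abbreviation "row_ix \<equiv> {..<k * L}"
abbreviation "col_ix \<equiv> {k * L..<2 * (k * L)}"
abbreviation "cell_ix \<equiv> {..2 * (k * L)}"

lemma edges_row_col: "b \<in> designs k L \<Longrightarrow> g \<subseteq> row_ix \<Longrightarrow> edges k g b i l \<Longrightarrow> i \<in> row_ix \<and> l \<in> col_ix"
proof -
  assume *: "b \<in> designs k L" "g \<subseteq> row_ix" "edges k g b i l"
  then obtain t where t: "t < k" "b i t = l" and i: "i \<in> row_ix" by (auto simp: edges_def hits_def)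
  have "b i \<in> Pi\<^sub>E {..<k} (col_block k L)" using * i by (auto simp: designs_def)
  then have "l \<in> col_block k L t" using t by auto
  then show ?thesis using i col_block_subset[OF t(1), of L] by auto
qed

lemma edges_row_card: "card {l. edges k g b i l} \<le> k"
proof -
  have "{l. edges k g b i l} \<subseteq> b i ` {..<k}" by (auto simp: edges_def hits_def)
  then have "card {l. edges k g b i l} \<le> card (b i ` {..<k})" by (intro card_mono) auto
  then show ?thesis using card_image_le[of "{..<k}" "b i"] by simp
qed

lemma edges_col_card: "b \<in> designs k L \<Longrightarrow> g \<subseteq> row_ix \<Longrightarrow> card {i. edges k g b i l} \<le> 2 * k"
proof -
  assume *: "b \<in> designs k L" "g \<subseteq> row_ix"
  have "{i. edges k g b i l} \<subseteq> {i\<in>row_ix. hits k (b i) l}" using * by (auto simp: edges_def)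
  then have "card {i. edges k g b i l} \<le> col_degree k row_ix b l"
    unfolding col_degree_def by (intro card_mono) auto
  also have "\<dots> \<le> 2 * k" using * by (auto simp: designs_def)
  finally show ?thesis .
qed

text \<open>The k columns of a row give \<alpha> = k \<epsilon> and the cap gives \<gamma> = 2 k
  \<epsilon>. Then k \<epsilon> \<le> 1/2 yields \<alpha> * \<gamma> \<le> 1/2, and with \<epsilon>
  \<le> 1/2 also 2 * \<alpha> * \<epsilon> \<le> 1/2.\<close>

lemma sparse_rows_edges:
  assumes b: "b \<in> designs k L" and g: "g \<subseteq> row_ix"
  shows "sparse_rows cell_ix row_ix col_ix (\<lambda>i l. \<epsilon> * of_bool (edges k g b i l)) \<epsilon> (real k * \<epsilon>) (2 * real k * \<epsilon>)"
proof
  have s: "(\<Sum>x\<in>A. \<epsilon> * of_bool (Q x)) = \<epsilon> * real (card {x\<in>A. Q x})" if "finite A" for A :: "nat set" and Q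
    using that by (simp add: sum_distrib_left[symmetric] of_bool_def sum.If_cases Int_def)
  show "(\<Sum>l\<in>col_ix. \<epsilon> * of_bool (edges k g b i l)) \<le> real k * \<epsilon>" if "i \<in> row_ix" for i
  proof -
    have "card {l\<in>col_ix. edges k g b i l} \<le> card {l. edges k g b i l}"
      by (rule card_mono) (auto simp: edges_def hits_image intro: finite_subset[of _ "b i ` {..<k}"] simp: hits_def)
    then have "real (card {l\<in>col_ix. edges k g b i l}) \<le> real k" using edges_row_card[of g b i] by linarith
    then show ?thesis using eps unfolding s[OF finite_atLeastLessThan] by (simp only: mult.commute[of \<epsilon>] mult_right_mono)
  qed
  show "(\<Sum>i\<in>row_ix. \<epsilon> * of_bool (edges k g b i l)) \<le> 2 * real k * \<epsilon>" if "l \<in> col_ix" for l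
  proof -
    have "{i\<in>row_ix. edges k g b i l} = {i. edges k g b i l}" using g by (auto simp: edges_def)
    then have "real (card {i\<in>row_ix. edges k g b i l}) \<le> real (2 * k)"
      using edges_col_card[OF b g, of l] by (simp only: of_nat_le_iff)
    then have "real (card {i\<in>row_ix. edges k g b i l}) \<le> 2 * real k" by simp
    then show ?thesis using eps unfolding s[OF finite_lessThan] by (simp only: mult.commute[of \<epsilon>] mult_right_mono)
  qed
  have "(real k * \<epsilon>) * (real k * \<epsilon>) \<le> 1 / 2 * (1 / 2)" using eps by (intro mult_mono) auto
  then show "real k * \<epsilon> * (2 * real k * \<epsilon>) \<le> 1 / 2" by (simp add: mult_ac)
  have "(real k * \<epsilon>) * \<epsilon> \<le> 1 / 2 * (1 / 2)" using eps by (intro mult_mono) auto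
  then show "2 * (real k * \<epsilon>) * \<epsilon> < 1" by simp
  show "i \<in> row_ix \<and> l \<in> col_ix" if "\<epsilon> * of_bool (edges k g b i l) \<noteq> 0" for i l
    using that edges_row_col[OF b g, of i l] by (auto split: if_splits)
qed (use eps in auto)

lemma design_gpair: "b \<in> designs k L \<Longrightarrow> g \<subseteq> row_ix \<Longrightarrow> \<exists>Q. gpair cell_ix Q (design_cov k \<epsilon> g b)"
  unfolding design_cov_def by (rule sparse_rows.gpair_exists[OF sparse_rows_edges])

end

section \<open>The lower bound\<close>

text \<open>In exponential form the N-th power of a cross moment can be factored over the
  columns.\<close>

lemma inverse_one_minus_le_exp:
  fixes u v :: real
  assumes "u \<le> v" "0 \<le> v" "v \<le> 1 / 2"
  shows "1 / (1 - u) \<le> exp (2 * v)"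
proof -
  have "1 / (1 - u) \<le> 1 / (1 - v)" using assms by (intro divide_left_mono mult_pos_pos) auto
  also have "\<dots> \<le> 1 + 2 * v"
  proof -
    have "0 \<le> v * (1 - 2 * v)" using assms by simp
    then have "1 \<le> (1 + 2 * v) * (1 - v)" by (simp add: algebra_simps)
    then show ?thesis using assms by (simp add: divide_le_eq)
  qed
  also have "\<dots> \<le> exp (2 * v)" by (rule exp_ge_add_one_self)
  finally show ?thesis .
qed

text \<open>The condition \<open>small\<close> is the one that \<open>product_exp_average\<close>
  requires for y = 2 N \<epsilon>^2 and w = L.\<close>

locale design_model = design_params +
  fixes d N :: nat
  assumes d: "1 \<le> d" and small: "(exp (4 * real N * \<epsilon>\<^sup>2) - 1) * (2 * real k) / real L \<le> 1 / 5"
begin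

definition law :: "nat set \<Rightarrow> (nat \<Rightarrow> nat \<Rightarrow> nat) \<Rightarrow> path measure" where
  "law g b = step_process d (2 * (k * L)) (design_cov k \<epsilon> g b)"

definition row_vec :: "(nat \<Rightarrow> nat) \<Rightarrow> nat \<Rightarrow> real" where
  "row_vec c l = \<epsilon> * of_bool (hits k c l)"

lemma row_vec_bounds:
  assumes c: "c \<in> Pi\<^sub>E {..<k} (col_block k L)"
  shows "0 \<le> row_vec c l" "row_vec c l \<le> \<epsilon>" "l \<notin> col_ix \<Longrightarrow> row_vec c l = 0"
    and "(\<Sum>l\<in>col_ix. row_vec c l * w l) = \<epsilon> * (\<Sum>t<k. w (c t))"
proof -
  show "0 \<le> row_vec c l" "row_vec c l \<le> \<epsilon>" using eps by (auto simp: row_vec_def)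
  have ct: "c t \<in> col_ix" if "t < k" for t
    using c col_block_subset[OF that, of L] that by (auto simp: PiE_iff)
  then have col: "hits k c l \<Longrightarrow> l \<in> col_ix" for l by (auto simp: hits_def)
  show "l \<notin> col_ix \<Longrightarrow> row_vec c l = 0" using col by (auto simp: row_vec_def)
  have "(\<Sum>l\<in>col_ix. row_vec c l * w l) = (\<Sum>l\<in>c ` {..<k}. \<epsilon> * w l)"
  proof (rule sum.mono_neutral_cong_right)
    show "c ` {..<k} \<subseteq> col_ix" using ct by blast
  qed (auto simp: row_vec_def hits_def)
  also have "\<dots> = (\<Sum>t<k. \<epsilon> * w (c t))" by (subst sum.reindex[OF block_choice_inj[OF c]]) simp
  finally show "(\<Sum>l\<in>col_ix. row_vec c l * w l) = \<epsilon> * (\<Sum>t<k. w (c t))" by (simp add: sum_distrib_left)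
qed

text \<open>Row i is off under the base law and on, with random columns c, under the alternatives;
  all other rows are fixed by g and b. The inverse Q is therefore one fixed matrix
  throughout.\<close>

lemma row_le_cam:
  assumes b: "b \<in> designs k L" and g: "g \<subseteq> row_ix" and i: "i \<in> row_ix" "i \<notin> g"
    and Fm: "F \<in> borel_measurable (samples N (law g b))" and a: "0 \<le> a"
  shows "ennreal (a / 2) \<le> (\<integral>\<^sup>+U. ennreal \<bar>F U\<bar> \<partial>samples N (law g b)) +
    (\<Sum>c\<in>row_choices k L b i. \<integral>\<^sup>+U. ennreal \<bar>F U - a\<bar> \<partial>samples N (law (insert i g) (b(i := c)))) *
      ennreal (1 / card (row_choices k L b i))"
proof -
  let ?D = "\<lambda>i l. \<epsilon> * of_bool (edges k g b i l)" and ?S = "design_cov k \<epsilon> g b" and ?n = "2 * (k * L)"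
  let ?O = "row_choices k L b i"
  interpret sr: sparse_rows cell_ix row_ix col_ix ?D \<epsilon> "real k * \<epsilon>" "2 * real k * \<epsilon>"
    by (rule sparse_rows_edges[OF b g])
  obtain Q where gp: "gpair cell_ix Q ?S" using design_gpair[OF b g] by auto
  have inv: "inv_on cell_ix Q (cross_cov ?D)" using gp by (simp add: gpair_def design_cov_def)
  have iI: "i \<in> cell_ix" and iC: "i \<notin> col_ix" using i by auto
  have Si: "?S i j = of_bool (i = j)" if "j \<in> cell_ix" for j
    using i iC edges_row_col[OF b g, of j i] by (auto simp: design_cov_def cross_cov_def edges_def)
  have Oc: "c \<in> Pi\<^sub>E {..<k} (col_block k L)" if "c \<in> ?O" for c
    using that unfolding row_choices_def by (rule PiE_mono[THEN subsetD, rotated]) (auto simp: open_cols_def)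
  have row_sum: "(\<Sum>l\<in>col_ix. row_vec c l) = real k * \<epsilon>" if "c \<in> ?O" for c
    using row_vec_bounds(4)[OF Oc[OF that], of "\<lambda>_. 1"] by (simp add: mult.commute)
  have half: "2 * (real k * \<epsilon>) * \<epsilon> \<le> 1 / 2"
  proof -
    have "(real k * \<epsilon>) * \<epsilon> \<le> 1 / 2 * (1 / 2)" using eps by (intro mult_mono) auto
    then show ?thesis by simp
  qed
  have bf: "\<bar>bform cell_ix Q (row_vec c) (row_vec c')\<bar> \<le> 2 * (real k * \<epsilon>) * \<epsilon>" if "c \<in> ?O" "c' \<in> ?O" for c c'
    using row_vec_bounds[OF Oc[OF that(1)]] row_vec_bounds[OF Oc[OF that(2)]] row_sum[OF that(2)]
    by (intro sr.bform_le[OF inv]) auto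
  have bf1: "bform cell_ix Q (row_vec c) (row_vec c) < 1" if "c \<in> ?O" for c
    using bf[OF that that] half by linarith
  have c0: "row_vec c i = 0" if "c \<in> ?O" for c
    using row_vec_bounds(3)[OF Oc[OF that] iC] .
  define r where "r c = corr_ratio cell_ix Q i (row_vec c)" for c
  have rm: "r c \<in> borel_measurable (\<Pi>\<^sub>M i\<in>cell_ix. lborel)" for c
    unfolding r_def by (rule corr_ratio_measurable[OF gp iI Si])
  have rpos: "0 \<le> r c z" if "c \<in> ?O" for c z
    unfolding r_def by (rule corr_ratio_nonneg[OF gp iI Si bf1[OF that]])
  \<comment> \<open>Row i is off in g, so switching it on changes the covariance by its
    cross-covariances alone, which is the change that \<open>add_corr\<close> realises.\<close>
  have cov_upd: "design_cov k \<epsilon> (insert i g) (b(i := c)) =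
      (\<lambda>j l. ?S j l + unit_vec i j * row_vec c l + row_vec c j * unit_vec i l)" for c
    using i by (auto simp: design_cov_def cross_cov_def edges_def unit_vec_def row_vec_def fun_eq_iff)
  have law_upd: "law (insert i g) (b(i := c)) = density (law g b) (\<lambda>u. ennreal (r c (read_cells d ?n u)))"
    if c: "c \<in> ?O" for c
    unfolding law_def
  proof (rule step_process_density[OF d gp])
    show "(\<lambda>z. ennreal (r c z)) \<in> borel_measurable (\<Pi>\<^sub>M i\<in>cell_ix. lborel)" using rm by simp
    have "gauss_cov cell_ix (design_cov k \<epsilon> (insert i g) (b(i := c))) = gauss cell_ix (add_corr cell_ix Q i (row_vec c))"
      unfolding cov_upd by (rule gauss_cov_eq[OF add_corr_gpair(1)[OF gp iI Si c0[OF c] bf1[OF c]]])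
    also have "\<dots> = density (gauss cell_ix Q) (\<lambda>z. ennreal (r c z))"
      unfolding r_def by (rule gauss_add_corr[OF gp iI Si c0[OF c] bf1[OF c]])
    finally show "gauss_cov cell_ix (design_cov k \<epsilon> (insert i g) (b(i := c))) =
        density (gauss_cov cell_ix ?S) (\<lambda>z. ennreal (r c z))"
      by (simp only: gauss_cov_eq[OF gp])
  qed
  have P: "prob_space (law g b)" unfolding law_def by (rule step_process_prob_space[OF d gp])
  have upd_prob: "prob_space (law (insert i g) (b(i := c)))" if c: "c \<in> ?O" for c
  proof -
    obtain Q' where "gpair cell_ix Q' (design_cov k \<epsilon> (insert i g) (b(i := c)))"
      using design_gpair[OF design_update[OF b _ c], of "insert i g"] i g by auto
    then show ?thesis unfolding law_def by (rule step_process_prob_space[OF d])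
  qed
  have finO: "finite ?O" by (rule finite_row_choices)
  have neO: "?O \<noteq> {}" using design_row_in_choices[OF b] i by auto
  have pair: "(\<integral>\<^sup>+u. ennreal (r c (read_cells d ?n u) * r c' (read_cells d ?n u)) \<partial>law g b) =
      ennreal (1 / (1 - bform cell_ix Q (row_vec c) (row_vec c')))" if c: "c \<in> ?O" "c' \<in> ?O" for c c'
  proof -
    have "(\<integral>\<^sup>+u. ennreal (r c (read_cells d ?n u) * r c' (read_cells d ?n u)) \<partial>law g b) =
        (\<integral>\<^sup>+z. ennreal (r c z * r c' z) \<partial>gauss_cov cell_ix ?S)"
      unfolding law_def
      using nn_integral_read_cells[OF d gp, of "\<lambda>z. ennreal (r c z * r c' z)"] rm by simp
    also have "\<dots> = ennreal (1 / (1 - bform cell_ix Q (row_vec c) (row_vec c')))"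
      unfolding gauss_cov_eq[OF gp] r_def
      using bf[OF c] half c0 c bf1 by (intro corr_ratio_cross[OF gp iI Si]) auto
    finally show ?thesis .
  qed
  \<comment> \<open>The weight that column m of |Q| puts on the columns of c. The column sums of |Q|
    are at most 2, which bounds f by 2 pointwise and, by the symmetry of Q, by 2 k in total: the two
    facts about f that \<open>product_exp_average\<close> takes.\<close>
  define f where "f c m = (\<Sum>l\<in>col_ix. of_bool (hits k c l) * \<bar>Q l m\<bar>)" for c m
  have f_eq: "(\<Sum>l\<in>col_ix. row_vec c l * \<bar>Q l m\<bar>) = \<epsilon> * f c m" for c m
    unfolding f_def row_vec_def sum_distrib_left by (simp only: mult.assoc)
  have f_pos: "0 \<le> f c m" for c m unfolding f_def by (intro sum_nonneg) auto
  have f_le: "f c m \<le> 2" if "m \<in> col_ix" for c m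
  proof -
    have "f c m \<le> (\<Sum>l\<in>col_ix. \<bar>Q l m\<bar>)" unfolding f_def by (intro sum_mono) auto
    also have "\<dots> \<le> 2" by (rule sr.col_weight[OF inv that])
    finally show ?thesis .
  qed
  have f_total: "(\<Sum>m\<in>col_ix. f c m) \<le> 2 * real k" if c: "c \<in> ?O" for c
  proof -
    have "(\<Sum>m\<in>col_ix. f c m) = (\<Sum>l\<in>col_ix. of_bool (hits k c l) * (\<Sum>m\<in>col_ix. \<bar>Q l m\<bar>))"
      unfolding f_def sum_distrib_left by (rule sum.swap)
    also have "\<dots> \<le> (\<Sum>l\<in>col_ix. of_bool (hits k c l) * 2)"
    proof (intro sum_mono mult_left_mono)
      fix l assume l: "l \<in> col_ix"
      have "(\<Sum>m\<in>col_ix. \<bar>Q l m\<bar>) = (\<Sum>m\<in>col_ix. \<bar>Q m l\<bar>)"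
        using inv l by (intro sum.cong) (auto simp: inv_on_def sym_on_def)
      then show "(\<Sum>m\<in>col_ix. \<bar>Q l m\<bar>) \<le> 2" using sr.col_weight[OF inv l] by simp
    qed simp
    also have "\<dots> = 2 * real k"
    proof -
      have "\<epsilon> * (\<Sum>l\<in>col_ix. of_bool (hits k c l) * 2) = \<epsilon> * (2 * real k)"
        using row_vec_bounds(4)[OF Oc[OF c], of "\<lambda>_. 2"]
        unfolding row_vec_def sum_distrib_left by (simp only: mult.assoc) (simp add: mult.commute)
      then show ?thesis using eps by simp
    qed
    finally show ?thesis .
  qed
  \<comment> \<open>cQc' is at most \<epsilon>^2 times the sum of f over the columns of c'. Being
    additive in these, the bound turns the N-th power of the cross moment into a product over
    t.\<close>
  have pair_le: "ennreal (1 / (1 - bform cell_ix Q (row_vec c) (row_vec c'))) ^ N \<le>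
      ennreal (\<Prod>t<k. exp (2 * real N * \<epsilon>\<^sup>2 * f c (c' t)))" if c: "c \<in> ?O" "c' \<in> ?O" for c c'
  proof -
    let ?u = "bform cell_ix Q (row_vec c) (row_vec c')"
    define v where "v = \<epsilon>\<^sup>2 * (\<Sum>t<k. f c (c' t))"
    have ct: "c' t \<in> col_ix" if "t < k" for t
      using Oc[OF c(2)] col_block_subset[OF that, of L] that by (auto simp: PiE_iff)
    have "\<bar>?u\<bar> \<le> (\<Sum>m\<in>col_ix. row_vec c' m * (\<Sum>l\<in>col_ix. row_vec c l * \<bar>Q l m\<bar>))"
      using row_vec_bounds[OF Oc[OF c(1)]] row_vec_bounds[OF Oc[OF c(2)]]
      by (intro bform_abs_le) auto
    also have "\<dots> = v"
      unfolding f_eq row_vec_bounds(4)[OF Oc[OF c(2)]] v_def by (simp add: sum_distrib_left power2_eq_square mult_ac)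
    finally have uv: "?u \<le> v" by linarith
    have v0: "0 \<le> v" unfolding v_def using f_pos by (intro mult_nonneg_nonneg sum_nonneg) auto
    have "(\<Sum>t<k. f c (c' t)) \<le> (\<Sum>t<k. 2)" using f_le ct by (intro sum_mono) auto
    then have "v \<le> \<epsilon>\<^sup>2 * (2 * real k)" unfolding v_def by (intro mult_left_mono) auto
    also have "\<dots> \<le> 1 / 2" using half by (simp add: power2_eq_square mult_ac)
    finally have v1: "v \<le> 1 / 2" .
    have "ennreal (1 / (1 - ?u)) ^ N \<le> ennreal (exp (2 * v)) ^ N"
      by (intro power_mono ennreal_leI inverse_one_minus_le_exp uv v0 v1) simp
    also have "\<dots> = ennreal (exp (real N * (2 * v)))"
      by (simp add: ennreal_power exp_of_nat_mult)
    also have "exp (real N * (2 * v)) = (\<Prod>t<k. exp (2 * real N * \<epsilon>\<^sup>2 * f c (c' t)))"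
      by (simp add: v_def exp_sum[symmetric] sum_distrib_left mult_ac)
    finally show ?thesis .
  qed
  \<comment> \<open>c is held fixed and only c' is averaged; the resulting bound is uniform in
    c.\<close>
  have cross: "(\<Sum>c\<in>?O. \<Sum>c'\<in>?O. (\<integral>\<^sup>+u. ennreal (r c (read_cells d ?n u) * r c' (read_cells d ?n u)) \<partial>law g b) ^ N)
      \<le> ennreal (5 / 4 * (real (card ?O))\<^sup>2)"
  proof -
    have "(\<Sum>c\<in>?O. \<Sum>c'\<in>?O. (\<integral>\<^sup>+u. ennreal (r c (read_cells d ?n u) * r c' (read_cells d ?n u)) \<partial>law g b) ^ N)
        \<le> (\<Sum>c\<in>?O. \<Sum>c'\<in>?O. ennreal (\<Prod>t<k. exp (2 * real N * \<epsilon>\<^sup>2 * f c (c' t))))"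
      using pair_le by (intro sum_mono) (simp add: pair)
    also have "\<dots> = (\<Sum>c\<in>?O. ennreal (\<Sum>c'\<in>?O. \<Prod>t<k. exp (2 * real N * \<epsilon>\<^sup>2 * f c (c' t))))"
      by (intro sum.cong refl sum_ennreal prod_nonneg) auto
    also have "\<dots> \<le> (\<Sum>c\<in>?O. ennreal (5 / 4 * real (card ?O)))"
    proof (intro sum_mono ennreal_leI)
      fix c assume c: "c \<in> ?O"
      have sub: "open_cols k L b i t \<subseteq> col_ix" if "t < k" for t
        using col_block_subset[OF that, of L] by (auto simp: open_cols_def)
      have disj: "(\<Sum>t<k. \<Sum>l\<in>open_cols k L b i t. f c l) = (\<Sum>l\<in>(\<Union>t\<in>{..<k}. open_cols k L b i t). f c l)"
      proof (intro sum.UNION_disjoint[symmetric] ballI impI)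
        show "finite (open_cols k L b i t)" for t by (simp add: open_cols_def col_block_def)
        show "open_cols k L b i t \<inter> open_cols k L b i s = {}" if "t \<noteq> s" for t s
          using that col_block_disjoint by (auto simp: open_cols_def)
      qed simp
      show "(\<Sum>c'\<in>?O. \<Prod>t<k. exp (2 * real N * \<epsilon>\<^sup>2 * f c (c' t))) \<le> 5 / 4 * real (card ?O)"
        unfolding row_choices_def
      proof (rule product_exp_average[where w="real L"])
        show "finite (open_cols k L b i t) \<and> real L / 2 \<le> real (card (open_cols k L b i t))" if "t < k" for t
          using card_open_cols[OF b _ that, of i] i by (auto simp: open_cols_def col_block_def)
        show "0 < real L" using kL by simp
        show "0 \<le> f c l \<and> f c l \<le> 2" if "t < k" "l \<in> open_cols k L b i t" for t l
          using f_pos f_le sub that by blast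
        have "(\<Sum>l\<in>(\<Union>t\<in>{..<k}. open_cols k L b i t). f c l) \<le> (\<Sum>m\<in>col_ix. f c m)"
          using sub f_pos by (intro sum_mono2) auto
        then show "(\<Sum>t<k. \<Sum>l\<in>open_cols k L b i t. f c l) \<le> 2 * real k"
          unfolding disj using f_total[OF c] by linarith
        show "(exp (2 * (2 * real N * \<epsilon>\<^sup>2)) - 1) * (2 * real k) / real L \<le> 1 / 5"
          using small by (simp add: mult.assoc)
      qed simp
    qed
    also have "\<dots> = ennreal (5 / 4 * (real (card ?O))\<^sup>2)"
      by (simp add: ennreal_of_nat_eq_real_of_nat ennreal_mult'[symmetric] power2_eq_square mult_ac)
    finally show ?thesis .
  qed
  have rd: "(\<lambda>u. r c (read_cells d ?n u)) \<in> borel_measurable (law g b)" for c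
    using measurable_compose[OF read_cells_measurable[OF d] rm] by (simp add: law_def cong: measurable_cong_sets)
  have "ennreal (a / 2) \<le> (\<integral>\<^sup>+U. ennreal \<bar>F U\<bar> \<partial>(\<Pi>\<^sub>M n\<in>{..<N}. law g b)) +
    (\<Sum>c\<in>?O. \<integral>\<^sup>+U. ennreal \<bar>F U - a\<bar> \<partial>(\<Pi>\<^sub>M n\<in>{..<N}. density (law g b) (\<lambda>u. ennreal (r c (read_cells d ?n u))))) *
      ennreal (1 / card ?O)"
    using Fm[unfolded samples_def] upd_prob[unfolded law_upd] rpos
    by (intro le_cam_mixture[OF P finO neO rd _ _ _ a cross]) (auto simp: law_upd[symmetric] upd_prob)
  then show ?thesis unfolding samples_def by (simp add: law_upd)
qed

end

lemma sum_Pow_split: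
  fixes f :: "nat set \<Rightarrow> 'a :: comm_monoid_add"
  assumes "finite R" "i \<in> R"
  shows "(\<Sum>g\<in>Pow R. f g) = (\<Sum>g\<in>Pow (R - {i}). f g + f (insert i g))"
proof -
  have R: "R = insert i (R - {i})" using assms by auto
  have "Pow R = Pow (R - {i}) \<union> insert i ` Pow (R - {i})"
    by (subst R) (rule Pow_insert)
  moreover have "Pow (R - {i}) \<inter> insert i ` Pow (R - {i}) = {}" by auto
  moreover have "inj_on (insert i) (Pow (R - {i}))" by (auto intro!: inj_onI)
  ultimately show ?thesis
    using assms by (simp add: sum.union_disjoint sum.reindex sum.distrib)
qed

section \<open>From single rows to the operator norm\<close>

context design_model
begin

abbreviation "ncells \<equiv> 2 * (k * L)"

definition cell_weight :: real where
  "cell_weight = 1 / real (ncells + 3)"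

text \<open>The value at a switched-on row of the covariance operator applied to the probe: k
  columns of width \<open>cell_weight\<close> and covariance \<epsilon>.\<close>

definition signal :: real where
  "signal = real k * \<epsilon> * cell_weight"

definition probe :: "point \<Rightarrow> real" where
  "probe x = of_bool (cell ncells x \<in> col_ix)"

definition row_region :: "point set" where
  "row_region = {x \<in> space (cube d). cell ncells x \<in> row_ix}"

text \<open>Rows and columns are equally many narrow cells, so this is both the squared norm of the
  probe and the volume of the row region, as \<open>op_norm_test\<close> demands.\<close>

definition volume :: real where
  "volume = real (k * L) * cell_weight"

lemma weight_pos: "0 < cell_weight" and volume_pos: "0 < volume" and signal_pos: "0 < signal"
proof -
  show w: "0 < cell_weight"
    unfolding cell_weight_def by (intro divide_pos_pos) (simp_all del: of_nat_add of_nat_mult)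
  show "0 < volume" "0 < signal" using kL eps w by (simp_all add: volume_def signal_def)
qed

lemma width_small: "c \<in> row_ix \<or> c \<in> col_ix \<Longrightarrow> cell_width ncells c = cell_weight"
  by (auto simp: cell_width_def cell_weight_def)

lemma probe_L2: "probe \<in> L2 d" and probe_norm: "(\<integral>x. (probe x)\<^sup>2 \<partial>cube d) = volume"
proof -
  have sq: "(\<lambda>x. (probe x)\<^sup>2) = (\<lambda>x. of_bool (cell ncells x \<in> col_ix))" by (auto simp: probe_def fun_eq_iff)
  have "(\<Sum>c\<le>ncells. of_bool (c \<in> col_ix) * cell_width ncells c) = (\<Sum>c\<in>col_ix. cell_weight)"
    by (rule sum.mono_neutral_cong_right) (auto simp: width_small)
  also have "\<dots> = volume" by (simp add: volume_def)
  finally have hb: "has_bochner_integral (cube d) (\<lambda>x. of_bool (cell ncells x \<in> col_ix)) volume"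
    using cell_integral[OF d, of "\<lambda>c. of_bool (c \<in> col_ix)" ncells] by simp
  then show "(\<integral>x. (probe x)\<^sup>2 \<partial>cube d) = volume" unfolding sq by (simp add: has_bochner_integral_iff)
  show "probe \<in> L2 d"
    unfolding L2_def mem_Collect_eq sq using hb by (auto simp: has_bochner_integral_iff probe_def[abs_def])
qed

lemma row_region_measurable [measurable]: "row_region \<in> sets (cube d)"
  and row_region_volume: "emeasure (cube d) row_region = ennreal volume"
proof -
  have "row_region = cell ncells -` row_ix \<inter> space (cube d)" by (auto simp: row_region_def)
  then show m: "row_region \<in> sets (cube d)" using measurable_sets[OF cell_measurable[OF d]] by simp
  have "(\<Sum>c\<le>ncells. of_bool (c \<in> row_ix) * cell_width ncells c) = (\<Sum>c\<in>row_ix. cell_weight)"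
    by (rule sum.mono_neutral_cong_right) (auto simp: width_small)
  also have "\<dots> = volume" by (simp add: volume_def)
  finally have hb: "has_bochner_integral (cube d) (\<lambda>x. of_bool (cell ncells x \<in> row_ix)) volume"
    using cell_integral[OF d, of "\<lambda>c. of_bool (c \<in> row_ix)" ncells] by simp
  have "emeasure (cube d) row_region = (\<integral>\<^sup>+x. indicator row_region x \<partial>cube d)" using m by simp
  also have "\<dots> = (\<integral>\<^sup>+x. ennreal (of_bool (cell ncells x \<in> row_ix)) \<partial>cube d)"
    by (intro nn_integral_cong) (auto simp: row_region_def split: split_indicator)
  also have "\<dots> = ennreal volume"
    using hb by (subst nn_integral_eq_integral) (auto simp: has_bochner_integral_iff)
  finally show "emeasure (cube d) row_region = ennreal volume" .
qed

context
  fixes g :: "nat set" and b :: "nat \<Rightarrow> nat \<Rightarrow> nat"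
  assumes g: "g \<subseteq> row_ix" and b: "b \<in> designs k L"
begin

lemma cov_law:
  "x \<in> space (cube d) \<Longrightarrow> y \<in> space (cube d) \<Longrightarrow>
    cov (law g b) x y = design_cov k \<epsilon> g b (cell ncells x) (cell ncells y)"
  using design_gpair[OF b g] cov_step_process[OF d] unfolding law_def by blast

lemma prob_law: "prob_space (law g b)"
  using design_gpair[OF b g] step_process_prob_space[OF d] unfolding law_def by blast

lemma prob_samples_law: "prob_space (samples N (law g b))"
  unfolding samples_def by (intro prob_space_PiM prob_law)

lemma cov_probe_integrable:
  assumes x: "x \<in> space (cube d)"
  shows "has_bochner_integral (cube d) (\<lambda>y. cov (law g b) x y * probe y)
    (\<Sum>c\<le>ncells. design_cov k \<epsilon> g b (cell ncells x) c * of_bool (c \<in> col_ix) * cell_width ncells c)"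
  using cell_integral[OF d, of "\<lambda>c. design_cov k \<epsilon> g b (cell ncells x) c * of_bool (c \<in> col_ix)" ncells] cov_law[OF x]
  by (subst has_bochner_integral_cong[OF refl _ refl]) (auto simp: probe_def)

lemma kernel_op_cov_measurable: "kernel_op d (cov (law g b)) probe \<in> borel_measurable (cube d)"
proof -
  note [measurable] = cell_measurable[OF d]
  have "kernel_op d (cov (law g b)) probe x =
      (\<Sum>c\<le>ncells. design_cov k \<epsilon> g b (cell ncells x) c * of_bool (c \<in> col_ix) * cell_width ncells c)"
    if "x \<in> space (cube d)" for x
    using cov_probe_integrable[OF that] by (simp add: kernel_op_def has_bochner_integral_iff)
  moreover have "(\<lambda>x. \<Sum>c\<le>ncells. design_cov k \<epsilon> g b (cell ncells x) c * of_bool (c \<in> col_ix) * cell_width ncells c)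
      \<in> borel_measurable (cube d)"
    by measurable
  ultimately show ?thesis by (subst measurable_cong) auto
qed

text \<open>The probe sums over all columns, so the result reveals whether a row is on but not which
  columns it uses. One value of a in Le Cam's bound therefore serves all alternatives.\<close>

lemma kernel_op_cov_row:
  assumes x: "x \<in> row_region"
  shows "kernel_op d (cov (law g b)) probe x = signal * of_bool (cell ncells x \<in> g)"
proof -
  let ?i = "cell ncells x"
  have xs: "x \<in> space (cube d)" and i: "?i \<in> row_ix" using x by (auto simp: row_region_def)
  have bi: "b ?i \<in> Pi\<^sub>E {..<k} (col_block k L)" using b i by (auto simp: designs_def)
  have cov_i: "design_cov k \<epsilon> g b ?i c = of_bool (?i \<in> g) * row_vec (b ?i) c" if "c \<in> col_ix" for c
    using that i edges_row_col[OF b g, of c ?i] by (auto simp: design_cov_def cross_cov_def edges_def row_vec_def)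
  have "kernel_op d (cov (law g b)) probe x =
      (\<Sum>c\<le>ncells. design_cov k \<epsilon> g b ?i c * of_bool (c \<in> col_ix) * cell_width ncells c)"
    using cov_probe_integrable[OF xs] by (simp add: kernel_op_def has_bochner_integral_iff)
  also have "\<dots> = (\<Sum>c\<in>col_ix. of_bool (?i \<in> g) * (row_vec (b ?i) c * cell_weight))"
    by (rule sum.mono_neutral_cong_right) (auto simp: cov_i width_small)
  also have "\<dots> = of_bool (?i \<in> g) * (\<epsilon> * (\<Sum>t<k. cell_weight))"
    by (simp only: sum_distrib_left[symmetric] row_vec_bounds(4)[OF bi])
  also have "\<dots> = signal * of_bool (?i \<in> g)" by (simp add: signal_def)
  finally show ?thesis .
qed

end

context
  fixes K :: "(nat \<Rightarrow> path) \<Rightarrow> kernel"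
  assumes Km: "\<And>g b. g \<subseteq> row_ix \<Longrightarrow> b \<in> designs k L \<Longrightarrow>
    (\<lambda>(U, x, y). K U x y) \<in> borel_measurable (samples N (law g b) \<Otimes>\<^sub>M cube d \<Otimes>\<^sub>M cube d)"
begin

definition statistic :: "(nat \<Rightarrow> path) \<Rightarrow> point \<Rightarrow> real" where
  "statistic U x = kernel_op d (K U) probe x"

lemma statistic_measurable:
  assumes "g \<subseteq> row_ix" "b \<in> designs k L"
  shows "(\<lambda>(U, x). statistic U x) \<in> borel_measurable (samples N (law g b) \<Otimes>\<^sub>M cube d)"
proof -
  interpret prob_space "cube d" by (rule prob_space_cube)
  let ?M = "samples N (law g b)"
  have [measurable]: "probe \<in> borel_measurable (cube d)" using probe_L2 by (simp add: L2_def)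
  have 1: "(\<lambda>q. (fst (fst q), snd (fst q), snd q)) \<in> (?M \<Otimes>\<^sub>M cube d) \<Otimes>\<^sub>M cube d \<rightarrow>\<^sub>M ?M \<Otimes>\<^sub>M cube d \<Otimes>\<^sub>M cube d"
    by measurable
  have "(\<lambda>q. K (fst (fst q)) (snd (fst q)) (snd q)) \<in> borel_measurable ((?M \<Otimes>\<^sub>M cube d) \<Otimes>\<^sub>M cube d)"
    using measurable_compose[OF 1 Km[OF assms]] by simp
  then have "(\<lambda>q. K (fst (fst q)) (snd (fst q)) (snd q) * probe (snd q)) \<in> borel_measurable ((?M \<Otimes>\<^sub>M cube d) \<Otimes>\<^sub>M cube d)"
    by measurable
  then have "(\<lambda>p. \<integral>y. K (fst p) (snd p) y * probe y \<partial>cube d) \<in> borel_measurable (?M \<Otimes>\<^sub>M cube d)"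
    by (intro borel_measurable_lebesgue_integral) (simp add: case_prod_beta')
  then show ?thesis by (simp add: statistic_def kernel_op_def case_prod_beta')
qed

definition row_loss :: "nat set \<Rightarrow> (nat \<Rightarrow> nat \<Rightarrow> nat) \<Rightarrow> point \<Rightarrow> ennreal" where
  "row_loss g b x = (\<integral>\<^sup>+U. ennreal \<bar>statistic U x - signal * of_bool (cell ncells x \<in> g)\<bar> \<partial>samples N (law g b))"

text \<open>Fubini puts the expectation inside the integral over x, so that each point of a row cell
  poses its own problem of deciding a single row.\<close>

lemma row_loss_le:
  assumes g: "g \<subseteq> row_ix" and b: "b \<in> designs k L"
  shows "(\<integral>\<^sup>+x. row_loss g b x * indicator row_region x \<partial>cube d) \<le>
     ennreal volume * (\<integral>\<^sup>+U. op_norm d (\<lambda>x y. K U x y - cov (law g b) x y) \<partial>samples N (law g b))"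
    and "row_loss g b \<in> borel_measurable (cube d)"
proof -
  interpret c: prob_space "cube d" by (rule prob_space_cube)
  let ?M = "samples N (law g b)"
  interpret s: prob_space ?M by (rule prob_samples_law[OF g b])
  interpret sc: pair_sigma_finite ?M "cube d" ..
  note [measurable] = cell_measurable[OF d] statistic_measurable[OF g b]
  have lm: "(\<lambda>(U, x). ennreal \<bar>statistic U x - signal * of_bool (cell ncells x \<in> g)\<bar>) \<in> borel_measurable (?M \<Otimes>\<^sub>M cube d)"
  proof -
    have "(\<lambda>p. signal * of_bool (cell ncells (snd p) \<in> g)) \<in> borel_measurable (?M \<Otimes>\<^sub>M cube d)" by measurable
    then have "(\<lambda>p. statistic (fst p) (snd p) - signal * of_bool (cell ncells (snd p) \<in> g)) \<in> borel_measurable (?M \<Otimes>\<^sub>M cube d)"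
      using statistic_measurable[OF g b] by (intro borel_measurable_diff) (simp_all add: case_prod_beta')
    then show ?thesis by (simp add: case_prod_beta')
  qed
  have lm2: "(\<lambda>(U, x). ennreal \<bar>statistic U x - signal * of_bool (cell ncells x \<in> g)\<bar> * indicator row_region x)
      \<in> borel_measurable (?M \<Otimes>\<^sub>M cube d)"
    using lm unfolding case_prod_beta' by measurable
  have lms: "(\<lambda>(x, U). ennreal \<bar>statistic U x - signal * of_bool (cell ncells x \<in> g)\<bar>) \<in> borel_measurable (cube d \<Otimes>\<^sub>M ?M)"
    using measurable_pair_swap[OF lm] by (simp add: case_prod_beta')
  show "row_loss g b \<in> borel_measurable (cube d)"
    unfolding row_loss_def[abs_def] by (rule s.borel_measurable_nn_integral[OF lms])
  have "(\<integral>\<^sup>+x. row_loss g b x * indicator row_region x \<partial>cube d) =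
      (\<integral>\<^sup>+x. (\<integral>\<^sup>+U. ennreal \<bar>statistic U x - signal * of_bool (cell ncells x \<in> g)\<bar> * indicator row_region x \<partial>?M) \<partial>cube d)"
  proof (rule nn_integral_cong)
    fix x assume x: "x \<in> space (cube d)"
    show "row_loss g b x * indicator row_region x =
        (\<integral>\<^sup>+U. ennreal \<bar>statistic U x - signal * of_bool (cell ncells x \<in> g)\<bar> * indicator row_region x \<partial>?M)"
      unfolding row_loss_def using measurable_Pair1[OF lm x] by (simp add: nn_integral_multc)
  qed
  also have "\<dots> = (\<integral>\<^sup>+U. (\<integral>\<^sup>+x. ennreal \<bar>statistic U x - signal * of_bool (cell ncells x \<in> g)\<bar> * indicator row_region x \<partial>cube d) \<partial>?M)"
    by (rule sc.Fubini'[OF lm2])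
  finally have swap: "(\<integral>\<^sup>+x. row_loss g b x * indicator row_region x \<partial>cube d) =
      (\<integral>\<^sup>+U. (\<integral>\<^sup>+x. ennreal \<bar>statistic U x - signal * of_bool (cell ncells x \<in> g)\<bar> * indicator row_region x \<partial>cube d) \<partial>?M)" .
  have pt: "(\<integral>\<^sup>+x. ennreal \<bar>statistic U x - signal * of_bool (cell ncells x \<in> g)\<bar> * indicator row_region x \<partial>cube d)
        \<le> ennreal volume * op_norm d (\<lambda>x y. K U x y - cov (law g b) x y)" if U: "U \<in> space ?M" for U
  proof -
    have "(\<integral>\<^sup>+x. ennreal \<bar>statistic U x - signal * of_bool (cell ncells x \<in> g)\<bar> * indicator row_region x \<partial>cube d) =
        (\<integral>\<^sup>+x. ennreal \<bar>kernel_op d (K U) probe x - kernel_op d (cov (law g b)) probe x\<bar> * indicator row_region x \<partial>cube d)"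
      using kernel_op_cov_row[OF g b] by (intro nn_integral_cong) (auto simp: statistic_def split: split_indicator)
    also have "\<dots> \<le> ennreal volume * op_norm d (\<lambda>x y. K U x y - cov (law g b) x y)"
    proof (rule op_norm_test[OF probe_L2 probe_norm volume_pos row_region_measurable])
      show "emeasure (cube d) row_region \<le> ennreal volume" by (simp add: row_region_volume)
      show "integrable (cube d) (\<lambda>y. cov (law g b) x y * probe y)" if "x \<in> space (cube d)" for x
        using cov_probe_integrable[OF g b that] by (simp add: has_bochner_integral_iff)
      show "kernel_op d (K U) probe \<in> borel_measurable (cube d)"
        using measurable_Pair2[OF statistic_measurable[OF g b] U] by (simp add: statistic_def[abs_def])
      show "kernel_op d (cov (law g b)) probe \<in> borel_measurable (cube d)"
        by (rule kernel_op_cov_measurable[OF g b])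
    qed
    finally show "(\<integral>\<^sup>+x. ennreal \<bar>statistic U x - signal * of_bool (cell ncells x \<in> g)\<bar> * indicator row_region x \<partial>cube d)
        \<le> ennreal volume * op_norm d (\<lambda>x y. K U x y - cov (law g b) x y)" .
  qed
  let ?h = "\<lambda>U. \<integral>\<^sup>+x. ennreal \<bar>statistic U x - signal * of_bool (cell ncells x \<in> g)\<bar> * indicator row_region x \<partial>cube d"
  have one: "ennreal (1 / volume) * ennreal volume = 1"
    using volume_pos by (simp add: ennreal_mult'[symmetric])
  \<comment> \<open>The operator norm need not be measurable in U, so the scalar is moved across the integral of h instead.\<close>
  have "ennreal (1 / volume) * (\<integral>\<^sup>+U. ?h U \<partial>?M) = (\<integral>\<^sup>+U. ennreal (1 / volume) * ?h U \<partial>?M)"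
    by (rule nn_integral_cmult[symmetric]) (rule c.borel_measurable_nn_integral[OF lm2])
  also have "\<dots> \<le> (\<integral>\<^sup>+U. op_norm d (\<lambda>x y. K U x y - cov (law g b) x y) \<partial>?M)"
  proof (rule nn_integral_mono)
    fix U assume "U \<in> space ?M"
    from mult_left_mono[OF pt[OF this], of "ennreal (1 / volume)"]
    show "ennreal (1 / volume) * ?h U \<le> op_norm d (\<lambda>x y. K U x y - cov (law g b) x y)"
      by (simp add: mult.assoc[symmetric] one)
  qed
  finally have "ennreal volume * (ennreal (1 / volume) * (\<integral>\<^sup>+U. ?h U \<partial>?M)) \<le>
      ennreal volume * (\<integral>\<^sup>+U. op_norm d (\<lambda>x y. K U x y - cov (law g b) x y) \<partial>?M)"
    by (intro mult_left_mono) auto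
  then show "(\<integral>\<^sup>+x. row_loss g b x * indicator row_region x \<partial>cube d) \<le>
     ennreal volume * (\<integral>\<^sup>+U. op_norm d (\<lambda>x y. K U x y - cov (law g b) x y) \<partial>?M)"
    unfolding swap using one by (simp add: mult.assoc[symmetric] mult.commute[of "ennreal volume"])
qed

text \<open>The sets g are paired with \<open>insert i g\<close> for the row i of x: Le Cam's bound
  gives signal / 2 to each pair, hence signal / 4 per set. Its average over the columns of row i is
  undone by \<open>design_average\<close>.\<close>

lemma row_loss_average:
  assumes x: "x \<in> row_region"
  shows "of_nat (card (Pow row_ix) * card (designs k L)) * ennreal (signal / 4) \<le>
    (\<Sum>g\<in>Pow row_ix. \<Sum>b\<in>designs k L. row_loss g b x)"
proof -
  let ?i = "cell ncells x" and ?D = "designs k L"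
  have xs: "x \<in> space (cube d)" and i: "?i \<in> row_ix" using x by (auto simp: row_region_def)
  have "(\<Sum>g\<in>Pow row_ix. \<Sum>b\<in>?D. row_loss g b x) =
      (\<Sum>g\<in>Pow (row_ix - {?i}). (\<Sum>b\<in>?D. row_loss g b x) + (\<Sum>b\<in>?D. row_loss (insert ?i g) b x))"
    using i by (intro sum_Pow_split) auto
  also have "\<dots> \<ge> (\<Sum>g\<in>Pow (row_ix - {?i}). \<Sum>b\<in>?D. ennreal (signal / 2))"
  proof (rule sum_mono)
    fix g assume "g \<in> Pow (row_ix - {?i})"
    then have g: "g \<subseteq> row_ix" "?i \<notin> g" by auto
    have "(\<Sum>b\<in>?D. ennreal (signal / 2)) \<le> (\<Sum>b\<in>?D. row_loss g b x +
        (\<Sum>c\<in>row_choices k L b ?i. row_loss (insert ?i g) (b(?i := c)) x) * ennreal (1 / card (row_choices k L b ?i)))"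
    proof (rule sum_mono)
      fix b assume b: "b \<in> ?D"
      have "(\<lambda>U. statistic U x) \<in> borel_measurable (samples N (law g b))"
        using measurable_Pair1[OF statistic_measurable[OF g(1) b] xs] by simp
      from row_le_cam[OF b g(1) i g(2) this, of signal]
      show "ennreal (signal / 2) \<le> row_loss g b x +
        (\<Sum>c\<in>row_choices k L b ?i. row_loss (insert ?i g) (b(?i := c)) x) * ennreal (1 / card (row_choices k L b ?i))"
        using signal_pos g(2) by (simp add: row_loss_def)
    qed
    also have "\<dots> = (\<Sum>b\<in>?D. row_loss g b x) + (\<Sum>b\<in>?D. row_loss (insert ?i g) b x)"
      using i design_average[of ?i k L "\<lambda>b. row_loss (insert ?i g) b x"] by (simp add: sum.distrib)
    finally show "(\<Sum>b\<in>?D. ennreal (signal / 2)) \<le> (\<Sum>b\<in>?D. row_loss g b x) + (\<Sum>b\<in>?D. row_loss (insert ?i g) b x)" .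
  qed
  also (xtrans) have "(\<Sum>g\<in>Pow (row_ix - {?i}). \<Sum>b\<in>?D. ennreal (signal / 2)) =
      of_nat (card (Pow row_ix) * card ?D) * ennreal (signal / 4)"
  proof -
    have "card (Pow row_ix) = 2 * card (Pow (row_ix - {?i}))"
    proof -
      have "card row_ix = Suc (card (row_ix - {?i}))" using i by (metis card_Suc_Diff1 finite_lessThan)
      then show ?thesis by (simp only: card_Pow finite_lessThan finite_Diff power_Suc)
    qed
    then have "of_nat (card (Pow row_ix) * card ?D) * ennreal (signal / 4) =
        of_nat (card (Pow (row_ix - {?i})) * card ?D) * (ennreal 2 * ennreal (signal / 4))"
      by (simp only: of_nat_mult) (simp add: mult_ac)
    also have "ennreal 2 * ennreal (signal / 4) = ennreal (signal / 2)"
      using signal_pos by (subst ennreal_mult'[symmetric]) auto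
    finally show ?thesis by (simp add: mult.assoc)
  qed
  finally show ?thesis by (simp add: ge_iff_diff_ge_0)
qed

text \<open>The bound on the row losses holds at every point of the row region, so integration
  brings in the volume of that region, which cancels against the one in
  \<open>row_loss_le\<close>.\<close>

lemma average_loss:
  "of_nat (card (Pow row_ix) * card (designs k L)) * ennreal (signal / 4) \<le>
    (\<Sum>g\<in>Pow row_ix. \<Sum>b\<in>designs k L.
      \<integral>\<^sup>+U. op_norm d (\<lambda>x y. K U x y - cov (law g b) x y) \<partial>samples N (law g b))" (is "?c \<le> ?S")
proof -
  have "ennreal volume * ?c = (\<integral>\<^sup>+x. ?c * indicator row_region x \<partial>cube d)"
    unfolding nn_integral_cmult_indicator[OF row_region_measurable] row_region_volume by (rule mult.commute)
  also have "\<dots> \<le> (\<integral>\<^sup>+x. (\<Sum>g\<in>Pow row_ix. \<Sum>b\<in>designs k L. row_loss g b x * indicator row_region x) \<partial>cube d)"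
    using row_loss_average by (intro nn_integral_mono) (auto split: split_indicator)
  also have "\<dots> = (\<Sum>g\<in>Pow row_ix. \<Sum>b\<in>designs k L. \<integral>\<^sup>+x. row_loss g b x * indicator row_region x \<partial>cube d)"
  proof -
    have m: "(\<lambda>x. row_loss g b x * indicator row_region x) \<in> borel_measurable (cube d)"
      if "g \<in> Pow row_ix" "b \<in> designs k L" for g b
      using row_loss_le(2)[of g b] that by simp
    then have "(\<lambda>x. \<Sum>b\<in>designs k L. row_loss g b x * indicator row_region x) \<in> borel_measurable (cube d)"
      if "g \<in> Pow row_ix" for g
      using that by (intro borel_measurable_sum) auto
    then show ?thesis using m by (simp add: nn_integral_sum del: Pow_iff)
  qed
  also have "\<dots> \<le> (\<Sum>g\<in>Pow row_ix. \<Sum>b\<in>designs k L. ennreal volume *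
      (\<integral>\<^sup>+U. op_norm d (\<lambda>x y. K U x y - cov (law g b) x y) \<partial>samples N (law g b)))"
    by (intro sum_mono row_loss_le(1)) auto
  also have "\<dots> = ennreal volume * ?S" by (simp add: sum_distrib_left)
  finally have "ennreal volume * ?c \<le> ennreal volume * ?S" .
  then show ?thesis using volume_pos by (simp add: ennreal_mult_le_mult_iff)
qed

end

text \<open>The supremum over the class is at least the average over all g and b. The whole family
  has the operator norm 3 \<open>cell_weight\<close>, so the average loss signal / 4 becomes k
  \<epsilon> / 12 in relative terms.\<close>

lemma minimax_risk_ge:
  assumes q: "0 \<le> q" "q \<le> 1" and G1: "1 \<le> \<Gamma>1" "1 + 2 * real k * \<epsilon> powr q \<le> 3 * \<Gamma>1"
    and G2: "0 < \<Gamma>2" "ln (real (ncells + 1)) \<le> \<Gamma>2\<^sup>2 / 2"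
  shows "ennreal (real k * \<epsilon> / 12) \<le> minimax_risk d N (cov_class d q \<Gamma>1 \<Gamma>2)"
  unfolding minimax_risk_def
proof (rule INF_greatest)
  fix K assume K: "K \<in> estimators d N (cov_class d q \<Gamma>1 \<Gamma>2)"
  have cls: "law g b \<in> cov_class d q \<Gamma>1 \<Gamma>2"
    and opn: "op_norm d (cov (law g b)) = ennreal (3 * cell_weight)" if g: "g \<subseteq> row_ix" and b: "b \<in> designs k L" for g b
  proof -
    obtain Q where gp: "gpair cell_ix Q (cross_cov (\<lambda>i l. \<epsilon> * of_bool (edges k g b i l)))"
      using design_gpair[OF b g] by (auto simp: design_cov_def)
    have row: "card {l. edges k g b i l} \<le> 2 * k" for i using edges_row_card[of g b i] by simp
    have e1: "\<epsilon> \<le> 1" "real k * \<epsilon> \<le> 1" using eps by auto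
    note C = step_process_class[where R=row_ix and C=col_ix and E="edges k g b" and n=ncells,
        OF d q eps(1) e1(1) _ _ _ edges_row_col[OF b g] row edges_col_card[OF b g] e1(2) gp G1 G2]
    show "law g b \<in> cov_class d q \<Gamma>1 \<Gamma>2"
      unfolding law_def design_cov_def by (rule C(1)) auto
    have "op_norm d (cov (law g b)) = ennreal (cell_width ncells ncells)"
      unfolding law_def design_cov_def by (rule C(2)) auto
    then show "op_norm d (cov (law g b)) = ennreal (3 * cell_weight)"
      by (simp add: cell_width_def cell_weight_def)
  qed
  define s where "s = (SUP P\<in>cov_class d q \<Gamma>1 \<Gamma>2. relative_risk d N K P)"
  have Km: "(\<lambda>(U, x, y). K U x y) \<in> borel_measurable (samples N (law g b) \<Otimes>\<^sub>M cube d \<Otimes>\<^sub>M cube d)"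
    if "g \<subseteq> row_ix" "b \<in> designs k L" for g b
    using K cls[OF that] by (simp add: estimators_def)
  let ?w = "ennreal (3 * cell_weight)" and ?c = "card (Pow row_ix) * card (designs k L)"
  have w: "0 < ?w" using weight_pos by simp
  have "(\<integral>\<^sup>+U. op_norm d (\<lambda>x y. K U x y - cov (law g b) x y) \<partial>samples N (law g b)) \<le> s * ?w"
    if "g \<subseteq> row_ix" "b \<in> designs k L" for g b
  proof -
    let ?I = "\<integral>\<^sup>+U. op_norm d (\<lambda>x y. K U x y - cov (law g b) x y) \<partial>samples N (law g b)"
    have "?I / ?w \<le> s"
      unfolding s_def using cls[OF that] opn[OF that] by (intro SUP_upper2[of "law g b"]) (auto simp: relative_risk_def)
    then have "?I / ?w * ?w \<le> s * ?w" by (intro mult_right_mono) auto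
    moreover have "?I / ?w * ?w = ?I"
      using w by (simp add: ennreal_divide_times ennreal_divide_self)
    ultimately show ?thesis by simp
  qed
  then have "(\<Sum>g\<in>Pow row_ix. \<Sum>b\<in>designs k L.
      \<integral>\<^sup>+U. op_norm d (\<lambda>x y. K U x y - cov (law g b) x y) \<partial>samples N (law g b)) \<le>
      (\<Sum>g\<in>Pow row_ix. \<Sum>b\<in>designs k L. s * ?w)"
    by (intro sum_mono) auto
  also have "\<dots> = of_nat ?c * (s * ?w)" by (simp add: mult.assoc)
  finally have le: "of_nat ?c * ennreal (signal / 4) \<le> of_nat ?c * (s * ?w)"
    using average_loss[OF Km] by (rule order_trans[rotated])
  have c: "0 < ?c" using designs_nonempty[OF kL] finite_designs by (auto simp: card_gt_0_iff)
  have "ennreal (real k * \<epsilon> / 12) \<le> s"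
  proof (cases s)
    case (real r)
    have "ennreal (real ?c * (signal / 4)) \<le> ennreal (real ?c * (r * (3 * cell_weight)))"
      using le real weight_pos signal_pos
      by (simp only: ennreal_of_nat_eq_real_of_nat) (simp add: ennreal_mult'[symmetric] ennreal_mult''[symmetric])
    then have "real ?c * (signal / 4) \<le> real ?c * (r * (3 * cell_weight))"
      using real weight_pos by (subst (asm) ennreal_le_iff) auto
    then have "signal / 4 \<le> r * (3 * cell_weight)" using c by (simp only: mult_le_cancel_left_pos of_nat_0_less_iff)
    then have "cell_weight * (real k * \<epsilon> / 12) \<le> cell_weight * r" by (simp add: signal_def algebra_simps)
    then have "real k * \<epsilon> / 12 \<le> r" using weight_pos by (simp only: mult_le_cancel_left_pos)
    then show ?thesis using real by (simp add: ennreal_leI)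
  qed simp
  then show "ennreal (real k * \<epsilon> / 12) \<le> (SUP P\<in>cov_class d q \<Gamma>1 \<Gamma>2. relative_risk d N K P)"
    by (simp add: s_def)
qed

end

section \<open>Choice of the parameters\<close>

text \<open>The price of rounding k and L to positive integers.\<close>

lemma nat_floor_ge_half:
  fixes x :: real
  shows "x / 2 \<le> real (max 1 (nat \<lfloor>x\<rfloor>))"
proof -
  have "x < of_int \<lfloor>x\<rfloor> + 1" by linarith
  moreover have "of_int \<lfloor>x\<rfloor> \<le> real (nat \<lfloor>x\<rfloor>)" by linarith
  ultimately show ?thesis by (simp add: max_def) linarith
qed

text \<open>L is taken as large as the size bound 2 k L + 1 \<le> exp y permits. Then k / L is of
  order k^2 exp (- y) \<le> N exp (- y), and N \<le> exp (y / \<beta>) leaves a decay exp (- a y), a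
  = 1 - 1 / \<beta>, against the growth exp (e y).\<close>

lemma design_size_exists:
  fixes \<beta> e y :: real and k N :: nat
  assumes \<beta>: "1 < \<beta>" and e: "0 \<le> e" "e \<le> (1 - 1 / \<beta>) / 160" and y: "2 \<le> y"
    and k: "1 \<le> k" "real k ^ 2 \<le> real N" and N: "real N powr \<beta> \<le> exp y - 1"
  shows "\<exists>L\<ge>1. real (2 * (k * L) + 1) \<le> exp y \<and> (exp (e * y) - 1) * (2 * real k) / real L \<le> 1 / 5"
proof -
  define a where "a = 1 - 1 / \<beta>"
  have a: "0 < a" "a \<le> 1" using \<beta> by (auto simp: a_def)
  define W where "W = exp y - 1"
  have "(2 + 1) + 2\<^sup>2 / 2 \<le> exp (2::real)"
    using exp_lower_Taylor_quadratic[of "2::real"] by simp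
  also have "exp 2 \<le> exp y" using y by simp
  finally have W: "4 \<le> W" by (simp add: W_def)
  have N1: "1 \<le> real N" using k by (metis le_trans of_nat_1 of_nat_le_iff one_le_power order_trans)
  have "real N powr 1 \<le> real N powr \<beta>" using N1 \<beta> by (intro powr_mono) auto
  moreover have "real N powr 1 = real N" by simp
  ultimately have kW: "(real k)\<^sup>2 \<le> W" using k(2) N unfolding W_def by linarith
  \<comment> \<open>This makes L positive: k is at most sqrt W, and W \<ge> 4.\<close>
  have k2: "2 * real k \<le> W"
  proof (rule ccontr)
    assume "\<not> 2 * real k \<le> W"
    then have "W * W < (2 * real k) * (2 * real k)" using W by (intro mult_strict_mono) auto
    also have "\<dots> \<le> 4 * W" using kW by (simp add: power2_eq_square)
    finally show False using W by simp
  qed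
  define L where "L = nat \<lfloor>W / (2 * real k)\<rfloor>"
  have k0: "0 < real k" using k by simp
  have x1: "1 \<le> W / (2 * real k)" using k2 k0 by (simp add: le_divide_eq)
  then have L1: "1 \<le> L" unfolding L_def by (simp add: le_nat_iff)
  have Lx: "real L \<le> W / (2 * real k)" using x1 unfolding L_def by linarith
  have Lge: "W / (2 * real k) / 2 \<le> real L"
    using nat_floor_ge_half[of "W / (2 * real k)"] L1 by (simp add: L_def max_def split: if_splits)
  have size: "real (2 * (k * L) + 1) \<le> exp y"
  proof -
    have "real L * (2 * real k) \<le> W" using Lx k0 by (simp add: le_divide_eq)
    then show ?thesis by (simp add: W_def mult_ac)
  qed
  have We: "exp y / 2 \<le> W" using W by (simp add: W_def)
  define A where "A = exp (e * y) - 1"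
  have A0: "0 \<le> A" using e y by (simp add: A_def)
  \<comment> \<open>Keeping the factor e, rather than bounding A by exp (e * y), gives smallness
    also for moderate y.\<close>
  have Ab: "A \<le> e * y * exp (e * y)"
  proof -
    have "1 - e * y \<le> exp (- (e * y))" using exp_ge_add_one_self[of "- (e * y)"] by simp
    then have "(1 - e * y) * exp (e * y) \<le> exp (- (e * y)) * exp (e * y)" by (intro mult_right_mono) auto
    then show ?thesis by (simp add: A_def exp_minus algebra_simps)
  qed
  have NE: "real N \<le> exp (y / \<beta>)"
  proof -
    have "real N = (real N powr \<beta>) powr (1 / \<beta>)" using N1 \<beta> by (simp add: powr_powr)
    also have "\<dots> \<le> exp y powr (1 / \<beta>)" using N \<beta> by (intro powr_mono2) auto
    also have "\<dots> = exp (y / \<beta>)" by (simp add: powr_def)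
    finally show ?thesis .
  qed
  have "A * (2 * real k) / real L \<le> A * (2 * real k) / (W / (2 * real k) / 2)"
    using Lge A0 k0 W L1 by (intro divide_left_mono mult_nonneg_nonneg mult_pos_pos) auto
  also have "\<dots> = 8 * A * (real k)\<^sup>2 / W" using k0 by (simp add: power2_eq_square)
  also have "\<dots> \<le> 8 * A * (real k)\<^sup>2 / (exp y / 2)"
    using We A0 W by (intro divide_left_mono mult_nonneg_nonneg mult_pos_pos) auto
  also have "\<dots> = 16 * (A * (real k)\<^sup>2 * exp (- y))" by (simp add: exp_minus field_simps)
  also have "\<dots> \<le> 16 * ((e * y * exp (e * y)) * exp (y / \<beta>) * exp (- y))"
  proof -
    have "(real k)\<^sup>2 \<le> exp (y / \<beta>)" using k(2) NE by linarith
    then show ?thesis using Ab A0 e y by (intro mult_left_mono mult_right_mono mult_mono) auto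
  qed
  also have "\<dots> = 16 * e * (y * exp (e * y + y / \<beta> + - y))" by (simp only: exp_add mult_ac)
  \<comment> \<open>Half of the decay exp (- a y) absorbs exp (e y); the other half will absorb the
    factor y.\<close>
  also have "\<dots> \<le> 16 * e * (y * exp (- (a * y / 2)))"
  proof -
    have "e \<le> a / 2" using e a by (simp add: a_def[symmetric])
    then have "e * y \<le> a / 2 * y" using y by (intro mult_right_mono) auto
    moreover have "a * y = y - y / \<beta>" by (simp add: a_def left_diff_distrib)
    ultimately have "e * y + y / \<beta> + - y \<le> - (a * y / 2)" by linarith
    then show ?thesis using e y by (intro mult_left_mono) auto
  qed
  also have "\<dots> \<le> 16 * e * (2 / a)"
  proof -
    have "a * y / 2 \<le> exp (a * y / 2)" using exp_ge_add_one_self[of "a * y / 2"] by linarith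
    then have "y \<le> 2 / a * exp (a * y / 2)" using a by (simp add: field_simps)
    then have "y * exp (- (a * y / 2)) \<le> 2 / a * exp (a * y / 2) * exp (- (a * y / 2))" by (intro mult_right_mono) auto
    also have "\<dots> = 2 / a" by (simp add: exp_minus)
    finally show ?thesis using e by (intro mult_left_mono) auto
  qed
  \<comment> \<open>The requirement 32 e / a \<le> 1 / 5 is the origin of the constant 160.\<close>
  also have "\<dots> \<le> 1 / 5" using e a by (simp add: a_def[symmetric] field_simps)
  finally have "A * (2 * real k) / real L \<le> 1 / 5" .
  then show ?thesis using L1 size by (auto simp: A_def)
qed

theorem theorem3p6:
  fixes q \<beta> M :: real
  assumes "0 \<le> q" and "q \<le> 1" and "\<beta> > 1" and "M > 0"
  shows "\<exists>c>0. \<forall>(d::nat) (N::nat) (\<Gamma>1::real) (\<Gamma>2::real).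
    d \<ge> 1 \<longrightarrow> \<Gamma>1 > 0 \<longrightarrow> \<Gamma>2 > 0 \<longrightarrow>
    cov_class d q \<Gamma>1 \<Gamma>2 \<noteq> {} \<longrightarrow>
    1 \<le> real N powr \<beta> \<longrightarrow>
    real N powr \<beta> \<le> real_of_int (\<lfloor>exp (\<Gamma>2\<^sup>2 / 2)\<rfloor> - 1) \<longrightarrow>
    \<Gamma>2 \<ge> 2 \<longrightarrow>
    \<Gamma>1 \<le> M * real N powr ((1 - q) / 2) * \<Gamma>2 powr (- 3 + q) \<longrightarrow>
    minimax_risk d N (cov_class d q \<Gamma>1 \<Gamma>2)
      \<ge> ennreal (c * (\<Gamma>1 * (\<Gamma>2 / sqrt (real N)) powr (1 - q)))"
proof -
  note q = assms(1,2) and \<beta> = assms(3) and M = assms(4)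
  define a where "a = 1 - 1 / \<beta>"
  have a: "0 < a" "a \<le> 1" using \<beta> by (auto simp: a_def)
  \<comment> \<open>s scales \<epsilon> = s \<Gamma>2 / sqrt N. The first bound gives \<epsilon>
    \<le> 1/2, since \<Gamma>2 / sqrt N \<le> max 1 M; the second gives 8 s^2 \<le> a / 160, as
    \<open>design_size_exists\<close> asks, with 1280 = 8 * 160.\<close>
  define s where "s = min (1 / (2 * max 1 M)) (sqrt (a / 1280))"
  \<comment> \<open>\<kappa> scales the number of columns of a row. Its three bounds serve, in turn,
    the sparsity, k \<epsilon> \<le> 1/2 and k^2 \<le> N.\<close>
  define \<kappa> where "\<kappa> = min 1 (min (2 / M) (8 * s / M))"
  have s0: "0 < s" using M a by (simp add: s_def)
  have sM: "s * max 1 M \<le> 1 / 2"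
  proof -
    have "s * max 1 M \<le> 1 / (2 * max 1 M) * max 1 M" by (intro mult_right_mono) (auto simp: s_def)
    then show ?thesis by simp
  qed
  have s1: "s \<le> 1"
  proof -
    have "s * 1 \<le> s * max 1 M" using s0 by (intro mult_left_mono) auto
    then show ?thesis using sM by simp
  qed
  have s2: "8 * s\<^sup>2 \<le> a / 160"
  proof -
    have "s\<^sup>2 \<le> (sqrt (a / 1280))\<^sup>2" using s0 by (intro power_mono) (auto simp: s_def)
    then show ?thesis using a by simp
  qed
  have k0: "0 < \<kappa>" "\<kappa> \<le> 1" using M s0 by (auto simp: \<kappa>_def)
  have kM: "\<kappa> * M \<le> 2" "\<kappa> * M \<le> 8 * s"
  proof -
    have "\<kappa> * M \<le> 2 / M * M" using M by (intro mult_right_mono) (auto simp: \<kappa>_def)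
    then show "\<kappa> * M \<le> 2" using M by simp
    have "\<kappa> * M \<le> 8 * s / M * M" using M by (intro mult_right_mono) (auto simp: \<kappa>_def)
    then show "\<kappa> * M \<le> 8 * s" using M by simp
  qed
  have main: "ennreal (\<kappa> * s / 24 * (\<Gamma>1 * (\<Gamma>2 / sqrt (real N)) powr (1 - q))) \<le> minimax_risk d N (cov_class d q \<Gamma>1 \<Gamma>2)"
    if d: "1 \<le> d" and G1: "0 < \<Gamma>1" and ne: "cov_class d q \<Gamma>1 \<Gamma>2 \<noteq> {}" and N1: "1 \<le> real N powr \<beta>"
      and NE: "real N powr \<beta> \<le> real_of_int (\<lfloor>exp (\<Gamma>2\<^sup>2 / 2)\<rfloor> - 1)" and G2: "2 \<le> \<Gamma>2"
      and le: "\<Gamma>1 \<le> M * real N powr ((1 - q) / 2) * \<Gamma>2 powr (- 3 + q)" for d N \<Gamma>1 \<Gamma>2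
  proof -
    \<comment> \<open>The class being nonempty forces \<Gamma>1 \<ge> 1, as no process has a
      sparsity below 1.\<close>
    obtain P where P: "P \<in> cov_class d q \<Gamma>1 \<Gamma>2" using ne by auto
    then have G1': "1 \<le> \<Gamma>1" using sparsity_ge_one[OF _ q, of d P] by (auto simp: cov_class_def)
    \<comment> \<open>N = 0 is excluded because 0 powr \<beta> = 0.\<close>
    have N: "1 \<le> real N"
    proof (cases "N = 0")
      case True
      then show ?thesis using N1 by simp
    qed simp
    define t where "t = \<Gamma>2 / sqrt (real N)"
    have t0: "0 < t" using G2 N by (simp add: t_def)
    have tG: "t \<le> \<Gamma>2"
    proof -
      have "1 \<le> sqrt (real N)" using N by simp
      then show ?thesis using G2 N by (simp add: t_def divide_le_eq)
    qed
    define T where "T = \<Gamma>1 * t powr (1 - q)"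
    have T0: "0 < T" using G1 t0 by (simp add: T_def)
    \<comment> \<open>The hypothesis on \<Gamma>1 in terms of the target rate T: the powers of N
      cancel, and those of \<Gamma>2 add up to - 2.\<close>
    have TM: "T * \<Gamma>2\<^sup>2 \<le> M"
    proof -
      have sq: "sqrt (real N) powr (1 - q) = real N powr ((1 - q) / 2)"
        using N by (simp add: powr_half_sqrt[symmetric] powr_powr)
      have "T * \<Gamma>2\<^sup>2 \<le> (M * real N powr ((1 - q) / 2) * \<Gamma>2 powr (- 3 + q)) * t powr (1 - q) * \<Gamma>2\<^sup>2"
        unfolding T_def using le by (intro mult_right_mono) auto
      also have "t powr (1 - q) = \<Gamma>2 powr (1 - q) / real N powr ((1 - q) / 2)"
        unfolding t_def using G2 N by (simp add: powr_divide sq)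
      also have "(M * real N powr ((1 - q) / 2) * \<Gamma>2 powr (- 3 + q)) * (\<Gamma>2 powr (1 - q) / real N powr ((1 - q) / 2)) * \<Gamma>2\<^sup>2 =
          M * (\<Gamma>2 powr (- 3 + q) * \<Gamma>2 powr (1 - q) * \<Gamma>2 powr 2)"
        using N G2 by (simp add: powr_numeral)
      also have "\<Gamma>2 powr (- 3 + q) * \<Gamma>2 powr (1 - q) * \<Gamma>2 powr 2 = 1"
        using G2 by (simp only: powr_add[symmetric]) simp
      finally show ?thesis by simp
    qed
    have TM4: "T \<le> M / 4"
    proof -
      have "T * 2\<^sup>2 \<le> T * \<Gamma>2\<^sup>2" using T0 G2 by (intro mult_left_mono power_mono) auto
      then show ?thesis using TM by simp
    qed
    \<comment> \<open>For t > 1 also T \<ge> 1, since \<Gamma>1 \<ge> 1. Then \<Gamma>2^2 \<le> M,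
      and t \<le> \<Gamma>2 \<le> \<Gamma>2^2.\<close>
    have tM: "t \<le> max 1 M"
    proof (cases "t \<le> 1")
      case False
      have "1 * 1 \<le> \<Gamma>1 * t powr (1 - q)" using G1' False q by (intro mult_mono ge_one_powr_ge_zero) auto
      then have "1 * \<Gamma>2\<^sup>2 \<le> T * \<Gamma>2\<^sup>2" by (intro mult_right_mono) (auto simp: T_def)
      moreover have "t * 1 \<le> \<Gamma>2 * \<Gamma>2" using tG G2 t0 by (intro mult_mono) auto
      ultimately show ?thesis using TM by (simp add: power2_eq_square)
    qed simp
    define \<epsilon> where "\<epsilon> = s * t"
    have e0: "0 < \<epsilon>" using s0 t0 by (simp add: \<epsilon>_def)
    have e1: "\<epsilon> \<le> 1 / 2"
    proof -
      have "\<epsilon> \<le> s * max 1 M" unfolding \<epsilon>_def using tM s0 by (intro mult_left_mono) auto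
      then show ?thesis using sM by simp
    qed
    have es: "\<epsilon> powr (1 - q) = s powr (1 - q) * t powr (1 - q)"
      using s0 t0 by (simp add: \<epsilon>_def powr_mult)
    have sp: "s \<le> s powr (1 - q)" "s powr (1 - q) \<le> 1"
    proof -
      have "s powr 1 \<le> s powr (1 - q)" using s0 s1 q by (intro powr_mono') auto
      then show "s \<le> s powr (1 - q)" using s0 by simp
      show "s powr (1 - q) \<le> 1" using s0 s1 q by (intro powr_le1) auto
    qed
    \<comment> \<open>The real number of columns that spends the fraction \<kappa> of the sparsity
      budget: x \<epsilon>^q = \<kappa> \<Gamma>1.\<close>
    define x where "x = \<kappa> * \<Gamma>1 * \<epsilon> powr (- q)"
    have x0: "0 < x" using k0 G1 e0 by (simp add: x_def)
    have xe: "x * \<epsilon> = \<kappa> * s powr (1 - q) * T"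
    proof -
      have "\<epsilon> powr (- q) * \<epsilon> = \<epsilon> powr (1 - q)"
        using e0 powr_add[of \<epsilon> "- q" 1] by simp
      then have "x * \<epsilon> = \<kappa> * \<Gamma>1 * \<epsilon> powr (1 - q)" by (simp add: x_def mult.assoc)
      then show ?thesis by (simp add: es T_def mult_ac)
    qed
    have xe_le: "x * \<epsilon> \<le> \<kappa> * T"
    proof -
      have "\<kappa> * s powr (1 - q) * T \<le> \<kappa> * 1 * T" using k0 T0 sp by (intro mult_right_mono mult_left_mono) auto
      then show ?thesis by (simp add: xe)
    qed
    \<comment> \<open>x may be below 1, while a row needs at least one column. Then k = 1, and the
      bounds on k come from \<epsilon> \<le> 1/2, N \<ge> 1 and \<Gamma>1 \<ge> 1 instead.\<close>
    define k where "k = max 1 (nat \<lfloor>x\<rfloor>)"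
    have k1: "1 \<le> k" by (simp add: k_def)
    have k_cases: "k = 1 \<or> real k \<le> x"
      using x0 by (auto simp: k_def max_def)
    have ke: "real k * \<epsilon> \<le> 1 / 2"
    proof -
      have "real k * \<epsilon> \<le> 1 / 2" if "real k \<le> x"
      proof -
        have "real k * \<epsilon> \<le> x * \<epsilon>" using that e0 by (intro mult_right_mono) auto
        also have "\<dots> \<le> \<kappa> * (M / 4)" using xe_le mult_left_mono[OF TM4, of \<kappa>] k0 by linarith
        also have "\<dots> \<le> 1 / 2" using kM(1) by linarith
        finally show ?thesis .
      qed
      then show ?thesis using k_cases e1 by auto
    qed
    \<comment> \<open>From k \<epsilon> \<le> \<kappa> T, T \<Gamma>2^2 \<le> M and \<Gamma>2 \<ge>
      2 follows k \<epsilon> \<Gamma>2 \<le> 4 s. Since \<epsilon> = s \<Gamma>2 / sqrt N, this is k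
      \<Gamma>2^2 \<le> 4 sqrt N, and \<Gamma>2^2 \<ge> 4 cancels the constant.\<close>
    have kN: "(real k)\<^sup>2 \<le> real N"
    proof -
      have "real k \<le> sqrt (real N)" if "real k \<le> x"
      proof -
        have "real k * \<epsilon> \<le> x * \<epsilon>" using that e0 by (intro mult_right_mono) auto
        also have "\<dots> \<le> \<kappa> * T" by (rule xe_le)
        finally have "real k * \<epsilon> * \<Gamma>2 \<le> \<kappa> * T * \<Gamma>2" using G2 by (intro mult_right_mono) auto
        also have "\<dots> \<le> 4 * s"
        proof -
          have "\<kappa> * (T * \<Gamma>2) * 2 \<le> \<kappa> * (T * \<Gamma>2) * \<Gamma>2" using G2 k0 T0 by (intro mult_left_mono) auto
          also have "\<dots> = \<kappa> * (T * \<Gamma>2\<^sup>2)" by (simp add: power2_eq_square mult_ac)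
          also have "\<dots> \<le> \<kappa> * M" using TM k0 by (intro mult_left_mono) auto
          finally show ?thesis using kM(2) by (simp add: mult.assoc)
        qed
        finally have "real k * t * \<Gamma>2 * s \<le> 4 * s" by (simp add: \<epsilon>_def mult_ac)
        then have "real k * t * \<Gamma>2 \<le> 4" using s0 by simp
        then have "real k * \<Gamma>2 * \<Gamma>2 \<le> 4 * sqrt (real N)" using N by (simp add: t_def field_simps)
        moreover have "real k * 2 * 2 \<le> real k * \<Gamma>2 * \<Gamma>2" using G2 by (intro mult_mono) auto
        ultimately show ?thesis by simp
      qed
      moreover have "real k \<le> sqrt (real N)" if "k = 1" using that N by simp
      ultimately have "real k \<le> sqrt (real N)" using k_cases by auto
      then have "(real k)\<^sup>2 \<le> (sqrt (real N))\<^sup>2" by (intro power_mono) auto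
      then show ?thesis by simp
    qed
    define y where "y = \<Gamma>2\<^sup>2 / 2"
    have y: "2 \<le> y"
    proof -
      have "2\<^sup>2 \<le> \<Gamma>2\<^sup>2" using G2 by (intro power_mono) auto
      then show ?thesis by (simp add: y_def)
    qed
    have NE': "real N powr \<beta> \<le> exp y - 1"
      using NE of_int_floor_le[of "exp (\<Gamma>2\<^sup>2 / 2)"] unfolding y_def of_int_diff by linarith
    have "8 * s\<^sup>2 \<le> (1 - 1 / \<beta>) / 160" using s2 by (simp add: a_def)
    from design_size_exists[OF \<beta> _ this y k1 kN NE']
    obtain L where L: "1 \<le> L" "real (2 * (k * L) + 1) \<le> exp y"
      "(exp (8 * s\<^sup>2 * y) - 1) * (2 * real k) / real L \<le> 1 / 5" by auto
    \<comment> \<open>With this \<epsilon> the sample size drops out of the chi-square exponent, and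
      a multiple of y = \<Gamma>2^2 / 2 remains.\<close>
    have e4: "4 * real N * \<epsilon>\<^sup>2 = 8 * s\<^sup>2 * y"
      using N by (simp add: \<epsilon>_def t_def y_def power_mult_distrib power_divide)
    interpret design_model k L \<epsilon> d N
      by unfold_locales (use k1 L e0 e1 ke d in \<open>simp_all only: e4\<close>)
    have ln: "ln (real (2 * (k * L) + 1)) \<le> \<Gamma>2\<^sup>2 / 2"
    proof -
      have "0 < real (2 * (k * L) + 1)" by (simp only: of_nat_0_less_iff)
      then have "ln (real (2 * (k * L) + 1)) \<le> ln (exp y)" using L(2) by (simp only: ln_le_cancel_iff exp_gt_zero)
      then show ?thesis by (simp add: y_def)
    qed
    have sparse: "1 + 2 * real k * \<epsilon> powr q \<le> 3 * \<Gamma>1"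
    proof -
      have eq1: "\<epsilon> powr q \<le> 1" using e0 e1 q by (intro powr_le1) auto
      have "real k * \<epsilon> powr q \<le> \<Gamma>1" if "real k \<le> x"
      proof -
        have "real k * \<epsilon> powr q \<le> x * \<epsilon> powr q" using that by (intro mult_right_mono) auto
        also have "\<dots> = \<kappa> * \<Gamma>1" using e0 by (simp add: x_def powr_minus)
        also have "\<dots> \<le> 1 * \<Gamma>1" using k0 G1 by (intro mult_right_mono) auto
        finally show ?thesis by simp
      qed
      moreover have "real k * \<epsilon> powr q \<le> \<Gamma>1" if "k = 1" using that eq1 G1' by simp
      ultimately have "real k * \<epsilon> powr q \<le> \<Gamma>1" using k_cases by auto
      then show ?thesis using G1' by simp
    qed
    \<comment> \<open>The rounding loss k \<ge> x / 2 turns 12 into 24, and s \<le> s powr (1 - q)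
      holds because s \<le> 1.\<close>
    have "ennreal (\<kappa> * s / 24 * T) \<le> ennreal (real k * \<epsilon> / 12)"
    proof (rule ennreal_leI)
      have "\<kappa> * s * T \<le> \<kappa> * s powr (1 - q) * T"
        using k0 T0 sp by (intro mult_right_mono mult_left_mono) auto
      also have "\<dots> = x * \<epsilon>" by (simp add: xe)
      also have "\<dots> \<le> (2 * real k) * \<epsilon>"
        using nat_floor_ge_half[of x] e0 by (intro mult_right_mono) (auto simp: k_def)
      finally show "\<kappa> * s / 24 * T \<le> real k * \<epsilon> / 12" by (simp add: mult_ac)
    qed
    also have "\<dots> \<le> minimax_risk d N (cov_class d q \<Gamma>1 \<Gamma>2)"
      using G2 by (intro minimax_risk_ge q G1' sparse ln) auto
    finally show ?thesis by (simp add: T_def t_def)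
  qed
  show ?thesis
    using k0 s0 main by (intro exI[of _ "\<kappa> * s / 24"]) auto
qed

end
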